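(* Let $\zeta$ denote the Riemann zeta function. For every real $t\geq 3$, $$|\zeta(1+it)|\leq \min\left(\log t,\ \tfrac{1}{2}\log t+1.93,\ \tfrac{1}{5}\log t+44.02\right).$$ In particular, for $t\geq 8.261\times 10^{60}$, $$|\zeta(1+it)|\leq \tfrac{1}{5}\log t+44.02.$$
   Context: $\log$ denotes the natural logarithm. *)

theory Defs
  imports "HOL-Complex_Analysis.Complex_Analysis"
begin

text \<open>
  The Riemann zeta function is the analytic continuation of its Dirichlet series from
  the half-plane \<open>Re s > 1\<close> to \<open>\<complex> - {1}\<close>. HOL functions are total, so a value at the pole
  has to be chosen; it is set to \<open>0\<close>, which makes the continuation unique as a function on
  all of \<open>\<complex>\<close>.
\<close>

definition is_zeta :: "(complex \<Rightarrow> complex) \<Rightarrow> bool" where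
  "is_zeta f \<longleftrightarrow>
     f holomorphic_on - {1} \<and>
     (\<forall>s. Re s > 1 \<longrightarrow> f s = (\<Sum>n. 1 / of_nat (Suc n) powr s)) \<and>
     f 1 = 0"

definition zeta :: "complex \<Rightarrow> complex" where
  "zeta = (THE f. is_zeta f)"

text \<open>
  The rest of this theory shows that the description in \<open>zeta\<close> is proper. For existence,
  expand \<open>(n + 1) powr (1 - s)\<close> around \<open>n\<close> to order \<open>K\<close> and sum over \<open>n\<close>. This expresses
  \<open>(s - 1) * zeta s\<close> through its values at \<open>s + 1, s + 2, \<dots>\<close> and a remainder series
  converging for \<open>Re s > 1 - K\<close>, so that the half-plane can be enlarged by one unit at a time.
\<close>

lemma holomorphic_on_powr_dominated_series:
  fixes f :: "nat \<Rightarrow> complex \<Rightarrow> complex" and A B :: real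
  assumes hol: "\<And>n. f n holomorphic_on {s. Re s > A}"
    and bound: "\<And>n s. Re s > A \<Longrightarrow> norm (f n s) \<le> C s * real (Suc n) powr - (Re s + B)"
    and C: "continuous_on UNIV C" "\<And>s. C s \<ge> 0"
    and AB: "A + B \<ge> 1"
  shows "(\<lambda>s. \<Sum>n. f n s) holomorphic_on {s. Re s > A}"
    and "\<And>s. Re s > A \<Longrightarrow> summable (\<lambda>n. f n s)"
proof -
  let ?S = "{s. Re s > A}"
  have op: "open ?S" by (rule open_halfspace_Re_gt)
  obtain g where g: "\<forall>x\<in>?S. (\<lambda>n. f n x) sums g x \<and> g field_differentiable (at x)"
  proof (rule series_differentiable_comparison_complex[OF op, of f])
    show "f n field_differentiable at x" if "x \<in> ?S" for n x
      using hol that op by (meson holomorphic_on_imp_differentiable_at)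
    fix x assume x: "x \<in> ?S"
    define d where "d = (Re x - A) / 2"
    have d: "d > 0" using x by (simp add: d_def)
    have "compact (C ` cball x d)"
      by (intro compact_continuous_image continuous_on_subset[OF C(1)]) auto
    then obtain M where M: "\<And>y. y \<in> cball x d \<Longrightarrow> C y \<le> M"
      by (metis compact_imp_bounded bounded_real abs_le_D1 imageI)
    have M0: "M \<ge> 0" using M[of x] C(2)[of x] d by simp
    let ?h = "\<lambda>n. complex_of_real (M * real (Suc n) powr - (Re x - d + B))"
    have "summable (\<lambda>n. real (Suc n) powr - (Re x - d + B))"
      using x AB by (subst summable_Suc_iff, subst summable_real_powr_iff)
        (simp add: d_def field_simps)
    then have "summable ?h"
      by (intro summable_of_real summable_mult)
    moreover have "range ?h \<subseteq> \<real>\<^sub>\<ge>\<^sub>0"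
      using M0 by auto
    moreover have "\<forall>y\<in>ball x d \<inter> ?S. cmod (f n y) \<le> cmod (?h n)" for n
    proof
      fix y assume y: "y \<in> ball x d \<inter> ?S"
      have "\<bar>Re x - Re y\<bar> < d"
        using y abs_Re_le_cmod[of "x - y"] by (auto simp: dist_norm)
      then have le: "Re y \<ge> Re x - d" by linarith
      have "norm (f n y) \<le> C y * real (Suc n) powr - (Re y + B)"
        using bound y by auto
      also have "\<dots> \<le> M * real (Suc n) powr - (Re x - d + B)"
        using le M y M0 by (intro mult_mono powr_mono) auto
      finally show "cmod (f n y) \<le> cmod (?h n)"
        using M0 by (simp only: norm_of_real abs_of_nonneg mult_nonneg_nonneg powr_ge_zero)
    qed
    ultimately show "\<exists>d h. 0 < d \<and> summable h \<and> range h \<subseteq> \<real>\<^sub>\<ge>\<^sub>0 \<and>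
        (\<forall>\<^sub>F n in sequentially. \<forall>y\<in>ball x d \<inter> ?S. cmod (f n y) \<le> cmod (h n))"
      using d by (intro exI[of _ d] exI[of _ ?h] conjI always_eventually allI) auto
  qed blast
  show "\<And>s. Re s > A \<Longrightarrow> summable (\<lambda>n. f n s)"
    using g by (auto simp: sums_iff)
  have "g holomorphic_on ?S"
    using g by (auto simp: holomorphic_on_def intro: field_differentiable_at_within)
  then show "(\<lambda>s. \<Sum>n. f n s) holomorphic_on ?S"
    by (rule holomorphic_transform) (use g in \<open>auto simp: sums_iff\<close>)
qed

lemma
  shows zeta_series_holomorphic:
          "(\<lambda>s. \<Sum>n. 1 / of_nat (Suc n) powr s :: complex) holomorphic_on {s. Re s > 1}"
    and zeta_series_summable:
          "\<And>s. Re s > 1 \<Longrightarrow> summable (\<lambda>n. 1 / of_nat (Suc n) powr s :: complex)"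
proof -
  have 1: "(\<lambda>s. 1 / of_nat (Suc n) powr s :: complex) holomorphic_on {s. Re s > 1}" for n
    by (intro holomorphic_intros) (auto simp del: of_nat_Suc)
  have 2: "norm (1 / of_nat (Suc n) powr s :: complex) \<le> 1 * real (Suc n) powr - (Re s + 0)"
    for n s
    by (simp add: norm_divide norm_powr_real_powr powr_minus_divide del: of_nat_Suc)
  note thms = holomorphic_on_powr_dominated_series[of "\<lambda>n s. 1 / of_nat (Suc n) powr s" 1
      "\<lambda>_. 1" 0, OF 1 2]
  show "(\<lambda>s. \<Sum>n. 1 / of_nat (Suc n) powr s :: complex) holomorphic_on {s. Re s > 1}"
    by (rule thms) auto
  show "\<And>s. Re s > 1 \<Longrightarrow> summable (\<lambda>n. 1 / of_nat (Suc n) powr s :: complex)"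
    by (rule thms) auto
qed

definition ffact :: "nat \<Rightarrow> complex \<Rightarrow> complex" where
  "ffact i s = (\<Prod>j<i. 1 - s - of_nat j)"

definition powr_remainder :: "nat \<Rightarrow> complex \<Rightarrow> nat \<Rightarrow> complex" where
  "powr_remainder K s n =
     of_nat (Suc (Suc n)) powr (1 - s) -
     (\<Sum>i\<le>K. ffact i s * of_nat (Suc n) powr (1 - s - of_nat i) / fact i)"

lemma holomorphic_on_ffact [holomorphic_intros]: "ffact i holomorphic_on A"
  unfolding ffact_def by (intro holomorphic_intros)

lemma norm_powr_remainder_le:
  assumes s: "Re s > 1 - real K"
  shows "norm (powr_remainder K s n)
           \<le> norm (ffact (Suc K) s) / fact K * real (Suc n) powr - (Re s + real K)"
proof -
  define w :: complex where "w = of_nat (Suc n)"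
  define f where "f = (\<lambda>i z. ffact i s * z powr (1 - s - of_nat i))"
  let ?S = "closed_segment w (w + 1)"
  let ?B = "norm (ffact (Suc K) s) * real (Suc n) powr - (Re s + real K)"
  have S: "z \<in> \<real> \<and> Re z \<ge> real (Suc n)" if "z \<in> ?S" for z
  proof -
    have "w = of_real (real (Suc n))" "w + 1 = of_real (real (Suc n) + 1)"
      by (simp_all add: w_def)
    with that have "z \<in> of_real ` closed_segment (real (Suc n)) (real (Suc n) + 1)"
      by (metis closed_segment_of_real)
    then show ?thesis by (auto simp: closed_segment_eq_real_ivl)
  qed
  have "norm (f 0 (w + 1) - (\<Sum>i\<le>K. f i w * (w + 1 - w) ^ i / fact i))
          \<le> ?B * norm (w + 1 - w) ^ Suc K / fact K"
  proof (rule complex_Taylor[where S = ?S])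
    show "(f i has_field_derivative f (Suc i) x) (at x within ?S)" if "x \<in> ?S" for i x
    proof -
      have "x \<notin> \<real>\<^sub>\<le>\<^sub>0" using S[OF that] by (auto simp: complex_nonpos_Reals_iff)
      then have "(f i has_field_derivative
          ffact i s * ((1 - s - of_nat i) * x powr (1 - s - of_nat i - 1))) (at x)"
        unfolding f_def by (intro DERIV_cmult has_field_derivative_powr)
      also have "1 - s - of_nat i - 1 = 1 - s - of_nat (Suc i)" by simp
      also have "ffact i s * ((1 - s - of_nat i) * x powr (1 - s - of_nat (Suc i)))
          = f (Suc i) x"
        unfolding f_def ffact_def prod.lessThan_Suc by (simp only: mult.assoc)
      finally show ?thesis by (rule has_field_derivative_at_within)
    qed
    show "norm (f (Suc K) x) \<le> ?B" if "x \<in> ?S" for x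
    proof -
      have x: "x \<in> \<real>" "Re x \<ge> real (Suc n)" using S[OF that] by auto
      then have "norm (x powr (1 - s - of_nat (Suc K))) = Re x powr - (Re s + real K)"
        by (subst norm_powr_real_powr) auto
      also have "\<dots> \<le> real (Suc n) powr - (Re s + real K)"
        using x s by (intro powr_mono2') auto
      finally show ?thesis
        unfolding f_def norm_mult by (rule mult_left_mono) auto
    qed
  qed auto
  then show ?thesis
    by (simp add: f_def powr_remainder_def w_def ffact_def add.commute add.left_commute)
qed

lemma powr_remainder_series_holomorphic:
  "(\<lambda>s. \<Sum>n. powr_remainder K s n) holomorphic_on {s. Re s > 1 - real K}"
proof (rule holomorphic_on_powr_dominated_series(1))
  show "(\<lambda>s. powr_remainder K s n) holomorphic_on {s. Re s > 1 - real K}" for n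
    unfolding powr_remainder_def
    by (intro holomorphic_intros) (auto simp del: of_nat_Suc)
  show "continuous_on UNIV (\<lambda>s. norm (ffact (Suc K) s) / fact K)"
    by (intro continuous_intros holomorphic_on_imp_continuous_on holomorphic_intros) auto
qed (use norm_powr_remainder_le in auto)

lemma zeta_series_recurrence:
  fixes s :: complex
  defines "Z \<equiv> \<lambda>s. \<Sum>n. 1 / of_nat (Suc n) powr s :: complex"
  assumes s: "Re s > 1"
  shows "(s - 1) * Z s = 1 + (\<Sum>n. powr_remainder (Suc K) s n) -
           (\<Sum>i<K. ffact (Suc i) s / fact (Suc (Suc i)) * ((s + of_nat (Suc i) - 1) * Z (s + of_nat (Suc i))))"
proof -
  let ?p = "\<lambda>n. of_nat (Suc n) powr (1 - s) :: complex"
  have lim: "?p \<longlonglongrightarrow> 0"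
  proof (rule tendsto_norm_zero_cancel)
    have "(\<lambda>n. real (Suc n) powr (1 - Re s)) \<longlonglongrightarrow> 0"
      using s by (intro tendsto_neg_powr filterlim_compose[OF filterlim_real_sequentially
            filterlim_Suc]) auto
    then show "(\<lambda>n. norm (?p n)) \<longlonglongrightarrow> 0"
      by (simp add: norm_powr_real_powr del: of_nat_Suc)
  qed
  have tel: "(\<lambda>n. ?p (Suc n) - ?p n) sums (0 - ?p 0)"
    by (rule telescope_sums[OF lim])
  have Zs: "(\<lambda>n. ffact (Suc i) s * of_nat (Suc n) powr (1 - s - of_nat (Suc i)) / fact (Suc i))
              sums (ffact (Suc i) s / fact (Suc i) * Z (s + of_nat i))" for i
  proof -
    have "(\<lambda>n. 1 / of_nat (Suc n) powr (s + of_nat i) :: complex) sums Z (s + of_nat i)"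
      unfolding Z_def using s by (intro summable_sums zeta_series_summable) auto
    then have "(\<lambda>n. ffact (Suc i) s / fact (Suc i) * (1 / of_nat (Suc n) powr (s + of_nat i)))
              sums (ffact (Suc i) s / fact (Suc i) * Z (s + of_nat i))"
      by (rule sums_mult)
    moreover have "1 - s - of_nat (Suc i) = - (s + of_nat i)" by simp
    ultimately show ?thesis
      by (simp only: powr_minus_divide times_divide_eq_right times_divide_eq_left mult_1_right
            divide_divide_eq_left mult.commute)
  qed
  have "(\<lambda>n. (?p (Suc n) - ?p n) -
          (\<Sum>i\<le>K. ffact (Suc i) s * of_nat (Suc n) powr (1 - s - of_nat (Suc i)) / fact (Suc i)))
        sums ((0 - ?p 0) - (\<Sum>i\<le>K. ffact (Suc i) s / fact (Suc i) * Z (s + of_nat i)))"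
    by (intro sums_diff tel sums_sum Zs)
  moreover have "(?p (Suc n) - ?p n) -
          (\<Sum>i\<le>K. ffact (Suc i) s * of_nat (Suc n) powr (1 - s - of_nat (Suc i)) / fact (Suc i))
        = powr_remainder (Suc K) s n" for n
    unfolding powr_remainder_def sum.atMost_Suc_shift
    by (simp add: ffact_def)
  ultimately have "(\<Sum>n. powr_remainder (Suc K) s n)
      = - 1 - (\<Sum>i\<le>K. ffact (Suc i) s / fact (Suc i) * Z (s + of_nat i))"
    by (simp add: sums_iff)
  also have "(\<Sum>i\<le>K. ffact (Suc i) s / fact (Suc i) * Z (s + of_nat i))
      = (1 - s) * Z s +
        (\<Sum>i<K. ffact (Suc (Suc i)) s / fact (Suc (Suc i)) * Z (s + of_nat (Suc i)))"
    by (simp add: lessThan_Suc_atMost[symmetric] sum.lessThan_Suc_shift ffact_def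
             del: sum.lessThan_Suc fact_Suc of_nat_Suc prod.lessThan_Suc)
  also have "(\<Sum>i<K. ffact (Suc (Suc i)) s / fact (Suc (Suc i)) * Z (s + of_nat (Suc i)))
      = - (\<Sum>i<K. ffact (Suc i) s / fact (Suc (Suc i)) *
              ((s + of_nat (Suc i) - 1) * Z (s + of_nat (Suc i))))"
    unfolding sum_negf[symmetric]
  proof (rule sum.cong[OF refl])
    fix i
    have *: "ffact (Suc (Suc i)) s = - (ffact (Suc i) s * (s + of_nat (Suc i) - 1))"
      by (simp add: ffact_def algebra_simps)
    show "ffact (Suc (Suc i)) s / fact (Suc (Suc i)) * Z (s + of_nat (Suc i))
        = - (ffact (Suc i) s / fact (Suc (Suc i)) *
              ((s + of_nat (Suc i) - 1) * Z (s + of_nat (Suc i))))"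
      unfolding * by simp
  qed
  finally show ?thesis by (simp add: algebra_simps)
qed

lemma zeta_continuation_halfplane:
  "\<exists>h. h holomorphic_on {s. Re s > 1 - real K} \<and>
       (\<forall>s. Re s > 1 \<longrightarrow> h s = (s - 1) * (\<Sum>n. 1 / of_nat (Suc n) powr s :: complex))"
proof (induction K)
  case 0
  show ?case
    by (rule exI[of _ "\<lambda>s. (s - 1) * (\<Sum>n. 1 / of_nat (Suc n) powr s :: complex)"])
       (use zeta_series_holomorphic in \<open>auto intro!: holomorphic_intros\<close>)
next
  case (Suc K)
  then obtain h where h: "h holomorphic_on {s. Re s > 1 - real K}"
    "\<And>s. Re s > 1 \<Longrightarrow> h s = (s - 1) * (\<Sum>n. 1 / of_nat (Suc n) powr s :: complex)"
    by blast
  define h' where "h' = (\<lambda>s. 1 + (\<Sum>n. powr_remainder (Suc K) s n) -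
     (\<Sum>i<K. ffact (Suc i) s / fact (Suc (Suc i)) * h (s + of_nat (Suc i))))"
  have "(\<lambda>s. h (s + of_nat (Suc i))) holomorphic_on {s. Re s > 1 - real (Suc K)}" for i
    using holomorphic_on_compose_gen[of "\<lambda>s. s + of_nat (Suc i)"
        "{s. Re s > 1 - real (Suc K)}" h, OF _ h(1)]
    by (force simp: o_def intro!: holomorphic_intros)
  then have "h' holomorphic_on {s. Re s > 1 - real (Suc K)}"
    unfolding h'_def
    by (intro holomorphic_intros powr_remainder_series_holomorphic) auto
  moreover have "h' s = (s - 1) * (\<Sum>n. 1 / of_nat (Suc n) powr s :: complex)"
    if "Re s > 1" for s
    unfolding h'_def zeta_series_recurrence[OF that, of K]
    using that by (simp add: h(2) del: of_nat_Suc fact_Suc)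
  ultimately show ?case by blast
qed

theorem is_zeta_exists: "\<exists>f. is_zeta f"
proof -
  let ?H = "\<lambda>K. {s::complex. Re s > 1 - real K}"
  obtain h where h: "\<And>K. h K holomorphic_on ?H K"
    "\<And>K s. Re s > 1 \<Longrightarrow> h K s = (s - 1) * (\<Sum>n. 1 / of_nat (Suc n) powr s :: complex)"
    using zeta_continuation_halfplane by metis
  have agree: "h K s = h L s" if "K \<le> L" "s \<in> ?H K" for K L s
  proof (rule analytic_continuation_open[where s = "{s. Re s > 1}" and s' = "?H K"
          and f = "h K" and g = "h L"])
    show "{s::complex. Re s > 1} \<noteq> {}" by (auto intro!: exI[of _ 2])
    show "connected (?H K)" by (intro convex_connected convex_halfspace_Re_gt)
    show "h L holomorphic_on ?H K"
      by (rule holomorphic_on_subset[OF h(1)]) (use that(1) in auto)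
  qed (use h that in \<open>auto simp: open_halfspace_Re_gt\<close>)
  define N where "N = (\<lambda>s. nat \<lceil>2 - Re s\<rceil>)"
  have N: "s \<in> ?H (N s)" for s
    unfolding N_def by (auto, linarith)
  define g where "g = (\<lambda>s. h (N s) s)"
  have g: "g s = h K s" if "s \<in> ?H K" for s K
    using agree[of K "N s" s] agree[of "N s" K s] that N[of s]
    unfolding g_def by (metis nat_le_linear)
  have "g field_differentiable at s" for s
  proof -
    have "g holomorphic_on ?H (N s)"
      by (rule holomorphic_transform[OF h(1)]) (simp add: g)
    then show ?thesis
      using N[of s] by (rule holomorphic_on_imp_differentiable_at[OF _ open_halfspace_Re_gt])
  qed
  then have "g holomorphic_on UNIV"
    by (simp add: holomorphic_on_def)
  then have "g holomorphic_on - {1}"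
    by (rule holomorphic_on_subset) auto
  then have hol: "(\<lambda>s. g s / (s - 1)) holomorphic_on - {1}"
    by (intro holomorphic_intros) auto
  moreover have "g s / (s - 1) = (\<Sum>n. 1 / of_nat (Suc n) powr s)" if "Re s > 1" for s
  proof -
    have "s \<noteq> 1" using that by auto
    then show ?thesis using that by (simp add: g[of s 0] h(2))
  qed
  ultimately show ?thesis
    unfolding is_zeta_def by (intro exI[of _ "\<lambda>s. g s / (s - 1)"]) auto
qed

lemma is_zeta_unique:
  assumes "is_zeta f" "is_zeta g"
  shows "f = g"
proof
  fix z
  show "f z = g z"
  proof (cases "z = 1")
    case False
    show ?thesis
    proof (rule analytic_continuation_open[where s = "{s. Re s > 1}" and s' = "- {1}"
            and f = f and g = g])
      show "{s::complex. Re s > 1} \<noteq> {}" by (auto intro!: exI[of _ 2])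
      show "connected (- {1::complex})" by (intro connected_punctured_universe) auto
    qed (use assms False in \<open>auto simp: is_zeta_def open_halfspace_Re_gt\<close>)
  qed (use assms in \<open>auto simp: is_zeta_def\<close>)
qed

theorem is_zeta_zeta: "is_zeta zeta"
  unfolding zeta_def using is_zeta_exists is_zeta_unique by (metis theI')

end

theory Submission
  imports Defs "HOL-Real_Asymp.Real_Asymp"
begin

text \<open>
  Write \<open>s = 1 + \<i> t\<close>. Applying the trapezoidal rule to \<open>x powr (- s)\<close> approximates \<open>zeta s\<close> by
  the partial sum of its Dirichlet series up to \<open>N\<close>; the error is at most
  \<open>\<bar>s\<bar> \<bar>s + 1\<bar> / 2\<close> times the corresponding error for the harmonic series, because \<open>\<bar>f''\<bar>\<close> is
  dominated by a multiple of the second derivative of \<open>1 / x\<close>.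

  For small \<open>t\<close> the trivial estimate of the partial sum with \<open>N\<close> about \<open>t / 3\<close> gives \<open>ln t\<close>.
  For larger \<open>t\<close> only the terms up to \<open>y\<close>, a constant times \<open>sqrt t\<close>, are estimated trivially.
  Beyond \<open>y\<close> the phase increments \<open>t / (2 \<pi>) * ln (1 + 1 / n)\<close> decrease slowly; blocks where they are
  near an integer \<open>k\<close> are again estimated trivially and the gaps in between by the Kusmin--Landau
  inequality. All this costs \<open>O(1)\<close>, which gives \<open>1/2 ln t + 1.93\<close>. For the third bound
  the terms between a multiple of \<open>t powr (1/5)\<close> and \<open>y\<close> are split dyadically and estimated by van
  der Corput's fifth derivative test. It is stated for finite differences of the phase and follows from
  a second difference test (again by Kusmin--Landau) by three steps of Weyl differencing.
\<close>

section \<open>The trapezoidal rule for the zeta function\<close>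

text \<open>The truncation error is about t^2 / (24 N^2), so \<open>N\<close> must be of order t,
  and trivial estimation alone then yields coefficient 1. For the coefficient 1/2 put a = t / (2
  pi): about K stationary points a / k lie beyond y = a / (K + 1/2), with K of order sqrt t. A block
  of relative half-width \<open>\<rho>\<close> around each costs about 2 \<open>\<rho>\<close>, each
  gap about 2 / (pi a \<open>\<rho>\<close>); taking \<open>\<rho>\<close> of order 1 / sqrt t keeps
  both totals bounded. For the coefficient 1/5, the fifth difference test bounds the dyadic block at
  M by multiples of t^(1/30) M^(-1/6) and t^(-1/30) M^(1/24). The first becomes bounded once M is of
  order t^(1/5), which is where the coefficient comes from; the second is worst at M near sqrt t,
  where it is about t^(-1/80). The explicit constants shape the rest. Each bound is proved directly
  only near and beyond the place where it starts to beat the previous one (t = 50 and ln t = 140)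
  and is inherited below. For t near 3 there is hardly any slack, so the truncation error is
  compared with an exactly known quantity for harmonic numbers.\<close>

lemma ln_numeral_bounds:
  "ln (2::real) \<ge> 0.69314" "ln (2::real) \<le> 0.69315"
  "ln (3::real) \<ge> 1.0984" "ln (5::real) \<ge> 1.6093" "ln (5::real) \<le> 1.6095"
proof -
  have 2: "ln (2::real) \<ge> 0.69314" "ln (2::real) \<le> 0.69315"
    using ln_approx_bounds[of 2 5] by (simp_all add: eval_nat_numeral)
  have 3: "ln (3/2::real) \<ge> 0.40545" using ln_approx_bounds[of "3/2" 3] by (simp add: eval_nat_numeral)
  have 5: "ln (5/4::real) \<ge> 0.22314" "ln (5/4::real) \<le> 0.22315"
    using ln_approx_bounds[of "5/4" 3] by (simp_all add: eval_nat_numeral)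
  have "ln (3::real) = ln 2 + ln (3/2)" "ln (5::real) = 2 * ln 2 + ln (5/4)"
    using ln_realpow[of 2 2] by (auto simp: ln_div)
  with 2 3 5 show "ln (2::real) \<ge> 0.69314" "ln (2::real) \<le> 0.69315"
    "ln (3::real) \<ge> 1.0984" "ln (5::real) \<ge> 1.6093" "ln (5::real) \<le> 1.6095"
    by simp_all
qed

text \<open>The total error of the trapezoidal rule for 1/x on [n, infinity); it is asymptotic to 1
  / (12 n^2). All truncation errors for zeta are measured against it.\<close>

definition harm_defect :: "nat \<Rightarrow> real" where
  "harm_defect n = ln (real n) + euler_mascheroni - harm n + 1 / (2 * real n)"

lemma harm_defect_tendsto: "harm_defect \<longlonglongrightarrow> 0"
proof -
  have "(\<lambda>n. euler_mascheroni - (harm n - ln (real n)) + (1/2) * (1 / real n)) \<longlonglongrightarrow> euler_mascheroni - euler_mascheroni + (1/2) * 0"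
    by (intro tendsto_intros euler_mascheroni_LIMSEQ lim_const_over_n)
  then show ?thesis by (simp add: harm_defect_def[abs_def] algebra_simps)
qed

definition trap_err :: "real \<Rightarrow> real" where
  "trap_err x = (1/x + 1/(x+1)) / 2 - (ln (x+1) - ln x)"

lemma harm_defect_diff:
  "harm_defect n - harm_defect (Suc n) = trap_err (real n)"
proof -
  have *: "L + g - h + p / 2 - (L' + g - (h + q) + q / 2) = (p + q) / 2 - (L' - L)"
    for L L' g h p q :: real
    by (simp add: field_simps)
  show ?thesis
    using *[of "ln (real n)" _ _ "1 / real n" "ln (real n + 1)" "1 / (real n + 1)"]
    by (simp add: harm_defect_def trap_err_def harm_Suc inverse_eq_divide add.commute mult.commute)
qed

text \<open>The right-hand side is the leading Euler-Maclaurin correction and telescopes over the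
  integers. The difference of the two sides is nondecreasing and tends to 0 at infinity, hence it is
  nonpositive.\<close>

lemma trap_err_le:
  assumes "x > 0"
  shows "trap_err x \<le> (1/x^2 - 1/(x+1)^2) / 12"
proof -
  define g where "g = (\<lambda>x. (1/x + 1/(x+1)) / 2 - (ln (x+1) - ln x) - (1/x^2 - 1/(x+1)^2) / 12 :: real)"
  have D: "(g has_real_derivative (1/y*(1/(y+1)))*(1/y-1/(y+1))^2/6) (at y)" if "y > 0" for y
  proof -
    have 1: "((\<lambda>x. 1/(x+c)) has_real_derivative - (1/(y+c)^2)) (at y)" if "c \<ge> 0" for c
      using \<open>y > 0\<close> that by (auto intro!: derivative_eq_intros simp: power2_eq_square)
    have 2: "((\<lambda>x. 1/(x+c)^2) has_real_derivative - 2 * (1/(y+c)^3)) (at y)" if "c \<ge> 0" for c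
      using \<open>y > 0\<close> that
      by (auto intro!: derivative_eq_intros simp: divide_simps) (simp add: algebra_simps power_numeral_reduce)
    have 3: "((\<lambda>x. ln (x+c)) has_real_derivative 1/(y+c)) (at y)" if "c \<ge> 0" for c
      using \<open>y > 0\<close> that by (auto intro!: derivative_eq_intros)
    have "(g has_real_derivative (- (1/y^2) + - (1/(y+1)^2))/2 - (1/(y+1) - 1/y) - (- 2 * (1/y^3) - - 2 * (1/(y+1)^3))/12) (at y)"
      unfolding g_def using 1[of 0] 1[of 1] 2[of 0] 2[of 1] 3[of 0] 3[of 1]
      by (intro DERIV_diff DERIV_add DERIV_cdivide) simp_all
    also have "(- (1/y^2) + - (1/(y+1)^2))/2 - (1/(y+1) - 1/y) - (- 2 * (1/y^3) - - 2 * (1/(y+1)^3))/12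
        = (- (1/y^2) - 1/(y+1)^2)/2 - (1/(y+1) - 1/y) + (1/y^3 - 1/(y+1)^3)/6"
      by (simp add: field_split_simps)
    also have "(- (1/y^2) - 1/(y+1)^2)/2 - (1/(y+1) - 1/y) + (1/y^3 - 1/(y+1)^3)/6 = (1/y*(1/(y+1)))*(1/y-1/(y+1))^2/6"
    proof -
      define p q where "p = 1/y" and "q = 1/(y+1)"
      \<comment> \<open>This relation between the reciprocals turns the derivative into a product
        with a square, so that its sign is visible.\<close>
      have pq: "p - q = p * q" using that by (simp add: p_def q_def field_simps)
      have "(- (p^2) - q^2)/2 - (q - p) + (p^3 - q^3)/6 = p*q*(p-q)^2/6"
        using pq by algebra
      then show ?thesis by (simp add: p_def q_def power_divide)
    qed
    finally show ?thesis .
  qed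
  have mono: "g y \<le> g z" if "0 < y" "y \<le> z" for y z
    by (rule DERIV_nonneg_imp_nondecreasing[OF that(2)]) (use that in \<open>force intro!: exI D\<close>)
  have "(g \<longlongrightarrow> 0) at_top" unfolding g_def by real_asymp
  then have "g x \<le> 0"
    by (rule tendsto_lowerbound) (use mono assms in \<open>auto intro!: eventually_at_top_linorderI[of x]\<close>)
  then show ?thesis by (simp add: g_def trap_err_def)
qed

lemma harm_defect_le:
  assumes "n > 0"
  shows "harm_defect n \<le> 1 / (12 * real n ^ 2)"
proof -
  define d where "d = (\<lambda>n. harm_defect n - 1 / (12 * real n ^ 2))"
  have "d m \<le> d (Suc m)" if "m > 0" for m
    using harm_defect_diff[of m] trap_err_le[of "real m"] that
    by (simp add: d_def add.commute diff_divide_distrib)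
  note d = this
  have "d n \<le> d m" if "n \<le> m" for m
    using that
  proof (induction m rule: dec_induct)
    case (step m)
    then show ?case using d[of m] assms by simp
  qed simp
  moreover have "d \<longlonglongrightarrow> 0 - 0"
    unfolding d_def by (intro tendsto_diff harm_defect_tendsto) real_asymp
  ultimately have "d n \<le> 0"
    by (intro tendsto_lowerbound[of d 0]) (auto intro!: eventually_sequentiallyI[of n])
  then show ?thesis by (simp add: d_def)
qed

text \<open>As a function of the step length \<open>h\<close>, the error starts at 0 and has the
  derivative (h / (x + h))^2 / (2 x).\<close>

lemma trap_err_nonneg:
  assumes "x > 0"
  shows "trap_err x \<ge> 0"
proof -
  define g where "g = (\<lambda>h. h/2*(1/x + 1/(x+h)) - (ln (x+h) - ln x) :: real)"
  have "g 0 \<le> g 1"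
  proof (rule DERIV_nonneg_imp_nondecreasing[of 0 1 g])
    fix h :: real assume "0 \<le> h" "h \<le> 1"
    moreover have "(g has_real_derivative (h/(x+h))^2/(2*x)) (at h)" if "h \<ge> 0"
    proof -
      have 1: "((\<lambda>h. 1/(x+h)) has_real_derivative - (1/(x+h)^2)) (at h)"
        using that assms by (auto intro!: derivative_eq_intros simp: power2_eq_square)
      have "(g has_real_derivative (1/2) * (1/x + 1/(x+h)) + (0 + - (1/(x+h)^2)) * (h/2) - (1/(x+h) - 0)) (at h)"
        unfolding g_def using that assms
        by (intro DERIV_diff DERIV_mult DERIV_add 1 DERIV_const DERIV_cdivide DERIV_ident)
           (auto intro!: derivative_eq_intros)
      then have "(g has_real_derivative (1/x + 1/(x+h))/2 - h/2 * (1/(x+h)^2) - 1/(x+h)) (at h)"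
        by (simp add: mult.commute)
      moreover have "(1/x + 1/(x+h))/2 - h/2 * (1/(x+h)^2) - 1/(x+h) = (h/(x+h))^2/(2*x)"
        using that assms by (simp add: field_simps power2_eq_square add_nonneg_eq_0_iff)
      ultimately show ?thesis by simp
    qed
    ultimately show "\<exists>d. (g has_real_derivative d) (at h) \<and> 0 \<le> d"
      using assms by (intro exI[of _ "(h/(x+h))^2/(2*x)"]) auto
  qed auto
  then show ?thesis using assms by (simp add: g_def trap_err_def)
qed

lemma harm_defect_antimono:
  assumes "0 < m" "m \<le> n"
  shows "harm_defect n \<le> harm_defect m"
  using assms(2)
proof (induction n rule: dec_induct)
  case (step n)
  with harm_defect_diff[of n] trap_err_nonneg[of "real n"] assms show ?case by simp
qed simp

lemma harm_defect_nonneg: "n > 0 \<Longrightarrow> harm_defect n \<ge> 0"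
  by (rule tendsto_upperbound[OF harm_defect_tendsto])
     (auto intro!: eventually_sequentiallyI[of n] harm_defect_antimono)

text \<open>This is \<open>harm_defect_le\<close> at n = 4: 25/12 - 1/8 + 1/192 < 1.963545. With 2
  ln 2 kept on the left, the later estimates of \<open>harm_defect 1\<close>,
  \<open>harm_defect 2\<close> and the constant itself need only a lower bound for ln 2.\<close>

lemma euler_mascheroni_le: "euler_mascheroni + 2 * ln 2 \<le> (1.963545 :: real)"
proof -
  have "ln (4::real) = 2 * ln 2" using ln_realpow[of 2 2] by simp
  then show ?thesis
    using harm_defect_le[of 4] by (simp add: harm_defect_def harm_expand)
qed

text \<open>Let the step length \<open>h\<close> vary. The error \<open>E\<close> for f and the
  error \<open>P\<close> for 1/x both vanish to first order at h = 0, and their second derivatives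
  are (h/2) f''(x + h) and h / (x + h)^3. Since Re s >= 1, the former is dominated by
  \<open>C\<close> times the latter; integrating this domination twice gives the claim at h =
  1.\<close>

lemma trapezoid_powr_bound:
  fixes s :: complex and x :: real
  assumes s: "Re s \<ge> 1" "s \<noteq> 1" and x: "x \<ge> 1"
  defines "f \<equiv> \<lambda>y::real. of_real y powr (- s)"
    and "F \<equiv> \<lambda>y::real. of_real y powr (1 - s) / (1 - s)"
  shows "cmod ((f x + f (x + 1)) / 2 - (F (x + 1) - F x)) \<le> cmod s * cmod (s + 1) / 2 * trap_err x"
proof -
  define f' where "f' = (\<lambda>y::real. - s * of_real y powr (- s - 1))"
  define f'' where "f'' = (\<lambda>y::real. s * (s + 1) * of_real y powr (- s - 2))"
  have pos: "x + h \<noteq> 0" "complex_of_real x + of_real h \<notin> \<real>\<^sub>\<le>\<^sub>0" if "h \<ge> 0" for h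
  proof -
    show "x + h \<noteq> 0" using that x by simp
    have "complex_of_real x + of_real h = of_real (x + h)" by simp
    then show "complex_of_real x + of_real h \<notin> \<real>\<^sub>\<le>\<^sub>0"
      using that x by (simp only: complex_nonpos_Reals_iff) auto
  qed
  have Df: "((\<lambda>h. f (x + h)) has_vector_derivative f' (x + h)) (at h)"
    and Df': "((\<lambda>h. f' (x + h)) has_vector_derivative f'' (x + h)) (at h)"
    and DF: "((\<lambda>h. F (x + h)) has_vector_derivative f (x + h)) (at h)" if "h \<ge> 0" for h
  proof -
    have D: "((\<lambda>h. (h + of_real x) powr c) has_field_derivative c * (of_real h + of_real x) powr (c - 1)) (at (of_real h))" for c :: complex
      using pos(2)[OF that] by (subst DERIV_shift[symmetric]) (auto intro!: has_field_derivative_powr simp: add.commute)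
    have V: "((\<lambda>h. b * of_real (x + h) powr c) has_vector_derivative b * (c * of_real (x + h) powr (c - 1))) (at h)" for b c :: complex
      using has_vector_derivative_real_field[OF DERIV_cmult[OF D, of b c], of UNIV] by (simp add: add.commute)
    have e: "1 - s \<noteq> 0" using s by simp
    show "((\<lambda>h. f (x + h)) has_vector_derivative f' (x + h)) (at h)"
      using V[of 1 "-s"] by (simp add: f_def f'_def)
    show "((\<lambda>h. f' (x + h)) has_vector_derivative f'' (x + h)) (at h)"
      using V[of "-s" "-s-1"] by (simp add: f''_def f'_def algebra_simps)
    show "((\<lambda>h. F (x + h)) has_vector_derivative f (x + h)) (at h)"
      using V[of "1/(1-s)" "1-s"] e by (simp add: F_def f_def)
  qed
  define C where "C = cmod s * cmod (s + 1) / 2"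
  define E where "E = (\<lambda>h. (h/2) *\<^sub>R (f x + f (x + h)) - (F (x + h) - F x))"
  define E' where "E' = (\<lambda>h. (f x - f (x + h)) / 2 + (h/2) *\<^sub>R f' (x + h))"
  define P where "P = (\<lambda>h. h/2 * (1/x + 1/(x+h)) - (ln (x+h) - ln x))"
  define P' where "P' = (\<lambda>h. (1/x - 1/(x+h)) / 2 - h/2 * (1/(x+h)^2))"
  have E: "(E has_vector_derivative E' h) (at h)" if "h \<ge> 0" for h
    unfolding E_def E'_def
    by (rule has_vector_derivative_eq_rhs, (rule Df DF that has_vector_derivative_diff has_vector_derivative_scaleR has_vector_derivative_add has_vector_derivative_const DERIV_cdivide DERIV_ident)+)
       (simp add: field_simps scaleR_conv_of_real)
  have E': "(E' has_vector_derivative (h/2) *\<^sub>R f'' (x + h)) (at h)" if "h \<ge> 0" for h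
    unfolding E'_def
    by (rule has_vector_derivative_eq_rhs, (rule Df Df' that has_vector_derivative_diff has_vector_derivative_scaleR has_vector_derivative_add has_vector_derivative_const has_vector_derivative_divide DERIV_cdivide DERIV_ident)+)
       (simp add: algebra_simps scaleR_conv_of_real)
  have D1: "((\<lambda>h. 1/(x+h)) has_real_derivative - (1/(x+h)^2)) (at h)"
    and D2: "((\<lambda>h. 1/(x+h)^2) has_real_derivative - 2 * (1/(x+h)^3)) (at h)"
    and D3: "((\<lambda>h. ln (x+h)) has_real_derivative 1/(x+h)) (at h)" if "h \<ge> 0" for h
    subgoal using x that by (auto intro!: derivative_eq_intros simp: power2_eq_square)
    subgoal using x that
      by (auto intro!: derivative_eq_intros simp: divide_simps)
         (simp add: algebra_simps power_numeral_reduce)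
    subgoal using x that by (auto intro!: derivative_eq_intros)
    done
  have P: "(P has_real_derivative P' h) (at h)" if "h \<ge> 0" for h
    unfolding P_def P'_def
    by (rule DERIV_cong, (rule D1 D3 that DERIV_diff DERIV_add DERIV_mult DERIV_const DERIV_cdivide DERIV_ident)+)
       (simp add: algebra_simps, use that x in \<open>simp add: divide_simps algebra_simps\<close>)
  have P': "(P' has_real_derivative h * (1/(x+h)^3)) (at h)" if "h \<ge> 0" for h
    unfolding P'_def
    by (rule DERIV_cong, (rule D1 D2 that DERIV_diff DERIV_add DERIV_mult DERIV_const DERIV_cdivide DERIV_ident)+)
       (simp add: algebra_simps)
  have cont: "continuous_on {0..h} E" "continuous_on {0..h} E'"
    "continuous_on {0..h} (\<lambda>h. C * P h)" "continuous_on {0..h} (\<lambda>h. C * P' h)" for h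
    using has_vector_derivative_continuous[OF E] has_vector_derivative_continuous[OF E']
      DERIV_isCont[OF P] DERIV_isCont[OF P']
    by (auto intro!: continuous_at_imp_continuous_on isCont_mult)
  have "cmod (E' h) \<le> C * P' h" if "h > 0" for h
  proof -
    have "cmod (E' h - E' 0) \<le> C * P' h - C * P' 0"
    proof (rule differentiable_bound_general[OF that cont(2,4)])
      fix u assume u: "0 < u" "u < h"
      show "(E' has_vector_derivative (u/2) *\<^sub>R f'' (x + u)) (at u)" using E' u by simp
      show "((\<lambda>h. C * P' h) has_vector_derivative C * (u * (1/(x+u)^3))) (at u)"
        using DERIV_cmult[OF P', of u C] u by (simp add: has_real_derivative_iff_has_vector_derivative)
      have "cmod (of_real (x + u) powr (- s - 2)) = (x + u) powr (- Re s - 2)"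
        using x u by (subst norm_powr_real_powr) auto
      also have "\<dots> \<le> (x + u) powr (- 3)"
        using x u s by (intro powr_mono) auto
      also have "\<dots> = 1/(x+u)^3"
        using x u by (simp add: powr_minus divide_inverse powr_numeral)
      finally have "cmod s * cmod (s + 1) * (u/2) * cmod (of_real (x + u) powr (- s - 2))
          \<le> cmod s * cmod (s + 1) * (u/2) * (1/(x+u)^3)"
        using u by (intro mult_left_mono) auto
      then show "norm ((u/2) *\<^sub>R f'' (x + u)) \<le> C * (u * (1/(x+u)^3))"
        using u by (simp add: f''_def C_def norm_mult mult_ac)
    qed
    then show ?thesis by (simp add: E'_def P'_def)
  qed
  then have "cmod (E 1 - E 0) \<le> C * P 1 - C * P 0"
    by (intro differentiable_bound_general[OF zero_less_one cont(1,3), where f' = E' and \<phi>' = "\<lambda>h. C * P' h"])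
       (use E DERIV_cmult[OF P] in \<open>auto simp: has_real_derivative_iff_has_vector_derivative[symmetric]\<close>)
  then show ?thesis
    by (simp add: E_def P_def C_def trap_err_def scaleR_conv_of_real)
qed


text \<open>The mean of the tails starting at \<open>N\<close> and at \<open>N + 1\<close> is the
  trapezoidal sum. The integrals \<open>F (n + 1) - F n\<close> telescope, and the errors
  \<open>trap_err\<close> sum to \<open>harm_defect N\<close>.\<close>

lemma zeta_euler_maclaurin_aux:
  fixes s :: complex
  assumes s: "Re s > 1" and N: "N > 0"
  shows "cmod (zeta s - ((\<Sum>n=1..<N. of_nat n powr (- s)) + of_nat N powr (- s) / 2
              + of_nat N powr (1 - s) / (s - 1)))
           \<le> cmod s * cmod (s + 1) / 2 * harm_defect N"
proof -
  define f where "f = (\<lambda>n::nat. complex_of_nat n powr (- s))"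
  define F where "F = (\<lambda>n::nat. complex_of_nat n powr (1 - s) / (1 - s))"
  define Z where "Z = zeta s - (\<Sum>n=1..<N. f n)"
  have s1: "s \<noteq> 1" using s by auto
  obtain M where M: "N = Suc M" using N by (cases N) auto
  have "(\<lambda>n. 1 / of_nat (Suc n) powr s) sums zeta s"
    using is_zeta_zeta s zeta_series_summable[OF s]
    by (auto simp: is_zeta_def sums_iff simp del: of_nat_Suc)
  then have "(\<lambda>n. f (Suc n)) sums zeta s"
    by (simp add: f_def powr_minus_divide del: of_nat_Suc)
  from sums_split_initial_segment[OF this, of M]
  have 1: "(\<lambda>n. f (n + N)) sums Z"
    by (simp add: M Z_def atLeastLessThanSuc_atLeastAtMost sum.atLeast1_atMost_eq)
  then have 2: "(\<lambda>n. f (n + N + 1)) sums (Z - f N)"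
    using sums_split_initial_segment[OF 1, of 1] by simp
  have "(\<lambda>n. F (n + N)) \<longlonglongrightarrow> 0"
  proof (rule tendsto_norm_zero_cancel)
    have "filterlim (\<lambda>n. real (n + N)) at_top sequentially" by real_asymp
    then have "(\<lambda>n. real (n + N) powr (1 - Re s) / cmod (1 - s)) \<longlonglongrightarrow> 0 / cmod (1 - s)"
      using s s1 by (intro tendsto_intros tendsto_neg_powr) auto
    moreover have "norm (F (n + N)) = real (n + N) powr (1 - Re s) / cmod (1 - s)" for n
      unfolding F_def norm_divide using N by (subst norm_powr_real_powr) auto
    ultimately show "(\<lambda>n. norm (F (n + N))) \<longlonglongrightarrow> 0" by simp
  qed
  from telescope_sums[OF this] have 3: "(\<lambda>n. F (n + N + 1) - F (n + N)) sums (0 - F N)"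
    by simp
  have "(\<lambda>n. (f (n + N) + f (n + N + 1)) / 2 - (F (n + N + 1) - F (n + N))) sums ((Z + (Z - f N)) / 2 - (0 - F N))"
    by (intro sums_diff sums_add sums_divide 1 2 3)
  moreover have "(\<lambda>n. cmod s * cmod (s + 1) / 2 * trap_err (real (n + N))) sums (cmod s * cmod (s + 1) / 2 * (harm_defect N - 0))"
  proof (rule sums_mult)
    have "(\<lambda>n. harm_defect (n + N)) \<longlonglongrightarrow> 0"
      using harm_defect_tendsto by (rule LIMSEQ_ignore_initial_segment)
    from telescope_sums'[OF this] show "(\<lambda>n. trap_err (real (n + N))) sums (harm_defect N - 0)"
      using harm_defect_diff by simp
  qed
  moreover have "cmod ((f (n + N) + f (n + N + 1)) / 2 - (F (n + N + 1) - F (n + N)))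
      \<le> cmod s * cmod (s + 1) / 2 * trap_err (real (n + N))" for n
    using trapezoid_powr_bound[of s "real (n + N)"] s s1 N
    by (simp add: f_def F_def add_ac)
  ultimately have "cmod ((Z + (Z - f N)) / 2 - (0 - F N)) \<le> cmod s * cmod (s + 1) / 2 * (harm_defect N - 0)"
    by (rule norm_sums_le)
  moreover have "F N = - (of_nat N powr (1 - s) / (s - 1))"
    using s1 by (simp add: F_def field_simps)
  ultimately show ?thesis
    by (simp add: Z_def f_def algebra_simps diff_divide_distrib add_divide_distrib)
qed

lemma zeta_euler_maclaurin:
  fixes t :: real
  assumes t: "t > 0" and N: "N > 0"
  defines "s \<equiv> 1 + \<i> * complex_of_real t"
  shows "cmod (zeta s - ((\<Sum>n=1..<N. of_nat n powr (- s)) + of_nat N powr (- s) / 2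
              + of_nat N powr (1 - s) / (s - 1)))
           \<le> cmod s * cmod (s + 1) / 2 * harm_defect N"
proof -
  define L where "L = (\<lambda>s. cmod (zeta s - ((\<Sum>n=1..<N. of_nat n powr (- s)) + of_nat N powr (- s) / 2
              + of_nat N powr (1 - s) / (s - 1))))"
  define R where "R = (\<lambda>s. cmod s * cmod (s + 1) / 2 * harm_defect N)"
  define \<sigma> where "\<sigma> = (\<lambda>k::nat. s + of_real (1 / real (Suc k)))"
  have s1: "s \<noteq> 1" using t by (simp add: s_def)
  have \<sigma>: "\<sigma> \<longlonglongrightarrow> s"
  proof -
    have "\<sigma> \<longlonglongrightarrow> s + of_real 0"
      unfolding \<sigma>_def by (intro tendsto_intros LIMSEQ_Suc[OF lim_1_over_n])
    then show ?thesis by simp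
  qed
  have "zeta holomorphic_on - {1}" using is_zeta_zeta by (simp add: is_zeta_def)
  then have "isCont zeta s"
    using s1 by (intro field_differentiable_imp_continuous_at holomorphic_on_imp_differentiable_at[of _ "-{1}"]) auto
  then have "isCont L s"
    unfolding L_def using s1 N by (intro continuous_intros) auto
  then have "(\<lambda>k. L (\<sigma> k)) \<longlonglongrightarrow> L s" by (rule isCont_tendsto_compose[OF _ \<sigma>])
  moreover have "isCont R s" unfolding R_def by (intro continuous_intros) auto
  then have "(\<lambda>k. R (\<sigma> k)) \<longlonglongrightarrow> R s" by (rule isCont_tendsto_compose[OF _ \<sigma>])
  moreover have "L (\<sigma> k) \<le> R (\<sigma> k)" for k
    unfolding L_def R_def by (rule zeta_euler_maclaurin_aux) (use N in \<open>simp_all add: \<sigma>_def s_def\<close>)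
  ultimately have "L s \<le> R s" by (intro LIMSEQ_le) auto
  then show ?thesis by (simp add: L_def R_def)
qed

section \<open>Bounds for small imaginary part\<close>

lemma cmod_one_plus_ii: "cmod (1 + \<i> * of_real t) * cmod (1 + \<i> * of_real t + 1) \<le> t\<^sup>2 + 5/2"
proof -
  have "cmod (1 + \<i> * of_real t) * cmod (1 + \<i> * of_real t + 1) = sqrt ((1 + t\<^sup>2) * (4 + t\<^sup>2))"
    by (simp add: cmod_def real_sqrt_mult)
  also have "\<dots> \<le> ((1 + t\<^sup>2) + (4 + t\<^sup>2)) / 2"
    by (rule arith_geo_mean_sqrt) auto
  finally show ?thesis by (simp add: field_simps)
qed

lemma cmod_powr_minus_one_line: "n > 0 \<Longrightarrow> cmod (of_nat n powr (- (1 + \<i> * of_real t))) = 1 / real n"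
  by (subst norm_powr_real_powr) (auto simp: powr_minus divide_inverse)

text \<open>The half term and the integral term are both multiples of N powr (-s), with factors 1/2
  and -i N / t. These are orthogonal, so they combine to a square root; the triangle inequality
  would lose too much for t near 3.\<close>

lemma cmod_zeta_le_truncated:
  fixes t :: real
  assumes t: "t > 0" and N: "N > 0"
  defines "s \<equiv> 1 + \<i> * complex_of_real t"
  shows "cmod (zeta s) \<le> cmod (\<Sum>n=1..<N. of_nat n powr (- s)) + sqrt (1/4 + (real N)\<^sup>2 / t\<^sup>2) / real N
           + (t\<^sup>2 + 5/2) / 2 * harm_defect N"
proof -
  define A where "A = (\<Sum>n=1..<N. complex_of_nat n powr (- s))"
  define B where "B = of_nat N powr (- s) / 2 + of_nat N powr (1 - s) / (s - 1)"
  have "cmod (zeta s - (A + B)) \<le> cmod s * cmod (s + 1) / 2 * harm_defect N"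
    using zeta_euler_maclaurin[OF t N] by (simp add: s_def A_def B_def add.assoc)
  also have "\<dots> \<le> (t\<^sup>2 + 5/2) / 2 * harm_defect N"
    using cmod_one_plus_ii[of t] harm_defect_nonneg[OF N]
    by (intro mult_right_mono divide_right_mono) (simp_all add: s_def)
  finally have 1: "cmod (zeta s - (A + B)) \<le> (t\<^sup>2 + 5/2) / 2 * harm_defect N" .
  have "of_nat N powr (1 - s) = of_nat N * complex_of_nat N powr (- s)"
    using N powr_add[of "of_nat N" 1 "- s"] by simp
  moreover have "Complex (1/2) (- (real N / t)) = 1/2 + of_nat N / (s - 1)"
    using t by (simp add: s_def complex_eq_iff Re_divide Im_divide power2_eq_square)
  ultimately have "B = of_nat N powr (- s) * Complex (1/2) (- (real N / t))"
    by (simp add: B_def algebra_simps)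
  then have "cmod B = 1 / real N * cmod (Complex (1/2) (- (real N / t)))"
    unfolding s_def by (simp only: norm_mult cmod_powr_minus_one_line[OF N])
  also have "cmod (Complex (1/2) (- (real N / t))) = sqrt (1/4 + (real N)\<^sup>2 / t\<^sup>2)"
    by (simp add: cmod_def power_divide)
  finally have "cmod B = 1 / real N * sqrt (1/4 + (real N)\<^sup>2 / t\<^sup>2)" .
  moreover have "cmod (zeta s) \<le> cmod A + cmod B + cmod (zeta s - (A + B))"
    using norm_triangle_ineq[of "A + B" "zeta s - (A + B)"] norm_triangle_ineq[of A B] by simp
  ultimately show ?thesis using 1 by (simp add: A_def)
qed

lemma cmod_sum_powr_le_harm:
  "cmod (\<Sum>n=1..<N. of_nat n powr (- (1 + \<i> * complex_of_real t))) \<le> harm (N - 1)"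
proof -
  have "cmod (\<Sum>n=1..<N. of_nat n powr (- (1 + \<i> * complex_of_real t))) \<le> (\<Sum>n=1..<N. 1 / real n)"
    by (intro sum_norm_le eq_refl cmod_powr_minus_one_line) simp
  also have "\<dots> = harm (N - 1)"
    unfolding harm_def divide_inverse by (rule sum.cong) auto
  finally show ?thesis .
qed

text \<open>harm (N - 1) + 1 / (2 N) equals ln N + gamma - \<open>harm_defect N\<close> exactly. The
  negative defect is set against the truncation error, which lowers its factor from (t^2 + 5/2) / 2
  to (t^2 + 1/2) / 2.\<close>

lemma cmod_zeta_le_ln_N:
  fixes t :: real
  assumes t: "t > 0" and N: "N > 0"
  defines "s \<equiv> 1 + \<i> * complex_of_real t"
  shows "cmod (zeta s) \<le> ln (real N) + euler_mascheroni + 1 / t + (t\<^sup>2 + 1/2) / (24 * (real N)\<^sup>2)"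
proof -
  have 1: "sqrt (1/4 + (real N)\<^sup>2 / t\<^sup>2) / real N \<le> 1 / (2 * real N) + 1 / t"
  proof -
    have "sqrt (1/4 + (real N / t)\<^sup>2) \<le> 1/2 + real N / t"
      using t by (intro real_le_lsqrt) (auto simp: power2_sum power_divide)
    then have "sqrt (1/4 + (real N / t)\<^sup>2) / real N \<le> (1/2 + real N / t) / real N"
      by (rule divide_right_mono) auto
    then show ?thesis using N by (simp add: power_divide add_divide_distrib)
  qed
  have "harm N = harm (N - 1) + 1 / real N"
    using N by (cases N) (auto simp: harm_Suc inverse_eq_divide)
  moreover have "1 / (2 * real N) = (1 / real N) / 2" by simp
  ultimately have 2: "harm (N - 1) + 1 / (2 * real N) = ln (real N) + euler_mascheroni - harm_defect N"
    unfolding harm_defect_def by linarith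
  have "((t\<^sup>2 + 5/2) / 2 - 1) * harm_defect N = (t\<^sup>2 + 1/2) / 2 * harm_defect N"
    by (simp add: field_simps)
  also have "\<dots> \<le> (t\<^sup>2 + 1/2) / 2 * (1 / (12 * (real N)\<^sup>2))"
    by (intro mult_left_mono harm_defect_le N) auto
  finally have "(t\<^sup>2 + 5/2) / 2 * harm_defect N - harm_defect N \<le> (t\<^sup>2 + 1/2) / (24 * (real N)\<^sup>2)"
    by (simp add: algebra_simps)
  then show ?thesis
    using cmod_zeta_le_truncated[OF t N] cmod_sum_powr_le_harm[of t N] 1 2
    unfolding s_def by linarith
qed

lemma ln_ge_chord:
  fixes a b t :: real
  assumes "0 < a" "a \<le> t" "t \<le> b" "a < b"
  shows "ln t \<ge> ln a + (t - a) / (b - a) * (ln b - ln a)"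
proof -
  define u where "u = (t - a) / (b - a)"
  have u: "0 \<le> u" "u \<le> 1" using assms by (auto simp: u_def)
  have "u * (b - a) = t - a" using assms by (simp add: u_def)
  then have "(1 - u) *\<^sub>R a + u *\<^sub>R b = t" by (simp add: algebra_simps)
  moreover have "(1 - u) * ln a + u * ln b \<le> ln ((1 - u) *\<^sub>R a + u *\<^sub>R b)"
    using concave_onD[OF ln_concave, of u a b] u assms by auto
  ultimately show ?thesis by (simp add: u_def[symmetric] algebra_simps)
qed

lemma inverse_square_le_chord:
  fixes a b t :: real
  assumes "0 < a" "a \<le> t" "t \<le> b" "a < b"
  shows "1 / t\<^sup>2 \<le> 1 / a\<^sup>2 - (t - a) * ((a + b) / (a\<^sup>2 * b\<^sup>2))"
proof -
  have "(t - a) * (b - t) * (t * (a + b) + a * b) \<ge> 0" using assms by simp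
  also have "(t - a) * (b - t) * (t * (a + b) + a * b) = b\<^sup>2 * t\<^sup>2 - (t - a) * (a + b) * t\<^sup>2 - a\<^sup>2 * b\<^sup>2"
    by algebra
  finally have "a\<^sup>2 * b\<^sup>2 \<le> (b\<^sup>2 - (t - a) * (a + b)) * t\<^sup>2" by (simp add: algebra_simps)
  moreover have "1 / a\<^sup>2 - (t - a) * ((a + b) / (a\<^sup>2 * b\<^sup>2)) = (b\<^sup>2 - (t - a) * (a + b)) / (a\<^sup>2 * b\<^sup>2)"
    using assms by (simp add: divide_simps)
  ultimately show ?thesis using assms by (simp add: divide_simps)
qed

text \<open>Here N = 1, so the partial sum is empty. Chords over [3, 5] bound t^2 and 1 / t^2 from
  above and \<open>ln t\<close> from below, and a linear inequality in t remains.\<close>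

lemma cmod_zeta_le_ln_3_5:
  fixes t :: real
  assumes t: "3 \<le> t" "t \<le> 5"
  shows "cmod (zeta (1 + \<i> * of_real t)) \<le> ln t"
proof -
  have "sqrt (1/4 + 1 / t\<^sup>2) \<le> 1/2 + 1/t\<^sup>2"
    by (rule real_le_lsqrt) (auto simp: power2_sum field_simps)
  also have "1/t\<^sup>2 \<le> 1/9 - (t - 3) * (8 / 225)"
    using inverse_square_le_chord[of 3 t 5] t by simp
  finally have 1: "sqrt (1/4 + 1 / t\<^sup>2) \<le> 1/2 + (1/9 - (t - 3) * (8 / 225))" by simp
  have "(t - 3) * (5 - t) \<ge> 0" using t by simp
  then have sq: "t\<^sup>2 \<le> 8 * t - 15" by (simp add: power2_eq_square algebra_simps)
  have "harm_defect 1 \<le> 0.07727"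
    using euler_mascheroni_le ln_numeral_bounds(1) by (simp add: harm_defect_def harm_expand)
  with sq have "(t\<^sup>2 + 5/2) / 2 * harm_defect 1 \<le> (8 * t - 15 + 5/2) / 2 * 0.07727"
    using t by (intro mult_mono harm_defect_nonneg) auto
  moreover have "cmod (zeta (1 + \<i> * of_real t)) \<le> sqrt (1/4 + 1 / t\<^sup>2) + (t\<^sup>2 + 5/2) / 2 * harm_defect 1"
    using cmod_zeta_le_truncated[of t 1] t by simp
  ultimately have 2: "cmod (zeta (1 + \<i> * of_real t)) \<le>
      1/2 + (1/9 - (t - 3) * (8 / 225)) + (8 * t - 15 + 5/2) / 2 * 0.07727"
    using 1 by linarith
  have "ln t \<ge> ln 3 + (t - 3) / 2 * (ln 5 - ln 3)" using ln_ge_chord[of 3 t 5] t by simp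
  moreover have "ln 3 + (t - 3) / 2 * (ln 5 - ln 3) = (5 - t) / 2 * ln 3 + (t - 3) / 2 * ln 5"
    by (simp add: field_simps)
  moreover have "(5 - t) / 2 * ln 3 \<ge> (5 - t) / 2 * 1.0984"  "(t - 3) / 2 * ln 5 \<ge> (t - 3) / 2 * 1.6093"
    using t ln_numeral_bounds by (intro mult_left_mono; simp)+
  ultimately have "ln t \<ge> (5 - t) / 2 * 1.0984 + (t - 3) / 2 * 1.6093" by linarith
  with 2 t show ?thesis by (simp add: field_simps)
qed

text \<open>As on [3, 5], but with N = 2 and chords over [5, 9].\<close>

lemma cmod_zeta_le_ln_5_9:
  fixes t :: real
  assumes t: "5 \<le> t" "t \<le> 9"
  shows "cmod (zeta (1 + \<i> * of_real t)) \<le> ln t"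
proof -
  define Q where "Q = sqrt (1/4 + 4 / t\<^sup>2)"
  \<comment> \<open>0.641 is sqrt (1/4 + 4/25) rounded up and 500/641 = 1 / (2 * 0.641): a tangent
    to the square root, taken near t = 5.\<close>
  have "sqrt (1/4 + 4 / t\<^sup>2) \<le> 641/1000 + (4/t\<^sup>2 - 4/25) * (500/641)"
  proof (rule real_le_lsqrt)
    define y where "y = 4/t\<^sup>2 - 4/25"
    have "1/4 + 4/t\<^sup>2 = 41/100 + y" by (simp add: y_def)
    moreover have "(641/1000)\<^sup>2 + 2 * (641/1000) * (y * (500/641)) = 410881/1000000 + y"
      by (simp add: power2_eq_square)
    then have "41/100 + y \<le> (641/1000)\<^sup>2 + 2 * (641/1000) * (y * (500/641)) + (y * (500/641))\<^sup>2"
      using zero_le_power2[of "y * (500/641)"] by linarith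
    ultimately show "1/4 + 4/t\<^sup>2 \<le> (641/1000 + (4/t\<^sup>2 - 4/25) * (500/641))\<^sup>2"
      by (simp only: power2_sum y_def mult_ac add_ac)
    have "4/t\<^sup>2 \<ge> 0" by simp
    then show "0 \<le> 641/1000 + (4/t\<^sup>2 - 4/25) * (500/641)" by (simp add: field_simps)
  qed
  also have "4/t\<^sup>2 \<le> 4 * (1/25 - (t - 5) * (14 / 2025))"
  proof -
    have "1/t\<^sup>2 \<le> 1/25 - (t - 5) * (14 / 2025)"
      using inverse_square_le_chord[of 5 t 9] t by simp
    from mult_left_mono[OF this, of 4] show ?thesis by simp
  qed
  finally have 1: "sqrt (1/4 + 4 / t\<^sup>2) \<le> 641/1000 + (4 * (1/25 - (t - 5) * (14 / 2025)) - 4/25) * (500/641)"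
    by (simp add: field_simps)
  have "(t - 5) * (9 - t) \<ge> 0" using t by simp
  then have sq: "t\<^sup>2 \<le> 14 * t - 45" by (simp add: power2_eq_square algebra_simps)
  have "harm_defect 2 \<le> 0.020406"
    using euler_mascheroni_le ln_numeral_bounds(1) by (simp add: harm_defect_def harm_expand)
  with sq have "(t\<^sup>2 + 5/2) / 2 * harm_defect 2 \<le> (14 * t - 45 + 5/2) / 2 * 0.020406"
    using t by (intro mult_mono harm_defect_nonneg) auto
  moreover have "cmod (zeta (1 + \<i> * of_real t)) \<le> 1 + sqrt (1/4 + 4 / t\<^sup>2) / 2 + (t\<^sup>2 + 5/2) / 2 * harm_defect 2"
    using cmod_zeta_le_truncated[of t 2] t by (simp add: eval_nat_numeral)
  then have "cmod (zeta (1 + \<i> * of_real t)) \<le> 1 + Q / 2 + (t\<^sup>2 + 5/2) / 2 * harm_defect 2"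
    by (simp only: Q_def)
  moreover have "Q / 2 \<le> (641/1000 + (4 * (1/25 - (t - 5) * (14 / 2025)) - 4/25) * (500/641)) / 2"
    using 1 unfolding Q_def by (rule divide_right_mono) simp
  ultimately have 2: "cmod (zeta (1 + \<i> * of_real t)) \<le>
      1 + (641/1000 + (4 * (1/25 - (t - 5) * (14 / 2025)) - 4/25) * (500/641)) / 2 + (14 * t - 45 + 5/2) / 2 * 0.020406"
    by (smt (verit) add_mono)
  have "ln (9::real) = 2 * ln 3" using ln_realpow[of 3 2] by simp
  then have 9: "ln (9::real) \<ge> 2.1968" using ln_numeral_bounds by simp
  have "ln t \<ge> ln 5 + (t - 5) / 4 * (ln 9 - ln 5)" using ln_ge_chord[of 5 t 9] t by simp
  moreover have "ln 5 + (t - 5) / 4 * (ln 9 - ln 5) = (9 - t) / 4 * ln 5 + (t - 5) / 4 * ln 9"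
    by (simp add: field_simps)
  moreover have "(9 - t) / 4 * ln 5 \<ge> (9 - t) / 4 * 1.6093"  "(t - 5) / 4 * ln 9 \<ge> (t - 5) / 4 * 2.1968"
    using t ln_numeral_bounds 9 by (intro mult_left_mono; simp)+
  ultimately have "ln t \<ge> (9 - t) / 4 * 1.6093 + (t - 5) / 4 * 2.1968" by linarith
  with 2 t show ?thesis by (simp add: field_simps)
qed

text \<open>With N = floor (t / 3) the ratio u = t / N stays in [3, 4], where ln u exceeds gamma
  plus the truncation error. The gain 0.1115 is just above 1/9, so it absorbs 1 / t from t = 9 on;
  for 20 <= t < 50 what is left of it also serves the bound with 1/2.\<close>

lemma cmod_zeta_le_ln_ge_9:
  fixes t :: real
  assumes t: "t \<ge> 9"
  shows "cmod (zeta (1 + \<i> * of_real t)) \<le> ln t - 0.1115 + 1 / t"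
proof -
  define N where "N = nat \<lfloor>t / 3\<rfloor>"
  define u where "u = t / real N"
  have N: "real N \<le> t / 3" "t / 3 < real N + 1" "real N \<ge> 3"
  proof -
    have "\<lfloor>t / 3\<rfloor> \<ge> 3" using t by (simp add: le_floor_iff)
    then have "real N = of_int \<lfloor>t / 3\<rfloor>" "real_of_int \<lfloor>t / 3\<rfloor> \<ge> 3" by (simp_all add: N_def)
    then show "real N \<le> t / 3" "t / 3 < real N + 1" "real N \<ge> 3"
      using floor_correct[of "t / 3"] by linarith+
  qed
  have u: "3 \<le> u" "u \<le> 4" using N by (auto simp: u_def field_simps)
  have "ln (18 / 5 / u) \<le> 18 / 5 / u - 1" using u by (intro ln_le_minus_one) auto
  moreover have "ln (18 / 5 / u) = ln (18/5) - ln u" using u by (intro ln_divide_pos) auto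
  moreover have "ln (18 / 5 :: real) = ln 2 + 2 * ln 3 - ln 5"
    using ln_realpow[of 3 2] ln_mult[of 2 9] by (simp add: ln_div)
  ultimately have lnu: "ln u \<ge> 2.2804 - 18 / 5 / u"
    using ln_numeral_bounds by simp
  \<comment> \<open>The factor u + 7 removes the quadratic term of the cubic. The resulting bound on
    u^2 / 24 contains -3.5 / u, which nearly cancels 3.6 / u; this is why \<open>ln u\<close> was
    expanded at 18/5.\<close>
  have cubic: "18 / 5 / u + u\<^sup>2 / 24 \<le> 1.589"
  proof -
    have "(u - 3) * (4 - u) * (u + 7) \<ge> 0" using u by simp
    then have "u * u\<^sup>2 \<le> 37 * u - 84" by (simp add: power2_eq_square algebra_simps)
    then show ?thesis using u by (simp add: field_simps)
  qed
  have tN: "(t\<^sup>2 + 1/2) / (24 * (real N)\<^sup>2) \<le> u\<^sup>2 / 24 + 0.0024"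
  proof -
    have "(real N)\<^sup>2 \<ge> 3\<^sup>2" using N by (intro power_mono) auto
    then have "1 / (48 * (real N)\<^sup>2) \<le> 1 / (48 * 9)" using N(3) by (intro divide_left_mono) auto
    moreover have "(t\<^sup>2 + 1/2) / (24 * (real N)\<^sup>2) = u\<^sup>2 / 24 + 1 / (48 * (real N)\<^sup>2)"
      using N(3) by (simp add: u_def power_divide add_divide_distrib)
    ultimately show ?thesis by simp
  qed
  have "ln t = ln (real N) + ln u" using N u by (simp add: u_def ln_div)
  moreover have "cmod (zeta (1 + \<i> * of_real t))
      \<le> ln (real N) + euler_mascheroni + 1 / t + (t\<^sup>2 + 1/2) / (24 * (real N)\<^sup>2)"
    using t N by (intro cmod_zeta_le_ln_N) auto
  moreover have "euler_mascheroni \<le> (0.57727::real)"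
    using euler_mascheroni_le ln_numeral_bounds(1) by simp
  moreover have "1.589 + 0.0024 + 0.57727 - 2.2804 \<le> (- 0.1115::real)" by simp
  ultimately show ?thesis using lnu cubic tN by linarith
qed

section \<open>Summation by parts for exponential sums\<close>

text \<open>The left-hand side is cot (x / 2), and y <= tan y.\<close>

lemma inverse_sin_plus_cot_le:
  fixes x :: real
  assumes "0 < x" "x < pi"
  shows "(1 + cos x) / sin x \<le> 2 / x"
proof -
  define y where "y = x / 2"
  have y: "0 < y" "y < pi / 2" "x = 2 * y" using assms by (auto simp: y_def)
  have pos: "sin y > 0" "cos y > 0" using y by (auto intro!: sin_gt_zero cos_gt_zero)
  have "y \<le> tan y"
    using abs_tan_ge[of y] tan_gt_zero[of y] y by simp
  then have "cos y / sin y \<le> 1 / y" using pos y by (simp add: tan_def field_simps)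
  moreover have "(1 + cos x) / sin x = cos y / sin y"
    using pos by (simp add: y sin_double cos_double_cos power2_eq_square)
  ultimately show ?thesis using y by simp
qed

lemma sqrt_one_plus_cot_square:
  assumes "0 < x" "x < pi"
  shows "sqrt (1 + (cot x)\<^sup>2) = 1 / sin x"
proof -
  have "sin x > 0" using assms by (rule sin_gt_zero)
  then have "1 + (cot x)\<^sup>2 = (1 / sin x)\<^sup>2"
    using sin_cos_squared_add[of x] by (simp add: cot_def power_divide field_simps)
  then show ?thesis using \<open>sin x > 0\<close> by (simp add: real_sqrt_divide)
qed

lemma cot_antimono:
  fixes x y :: real
  assumes "0 < x" "x \<le> y" "y < pi"
  shows "cot y \<le> cot x"
proof -
  have "sin x > 0" "sin y > 0" "sin (y - x) \<ge> 0"
    using assms by (auto intro!: sin_gt_zero sin_ge_zero)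
  then show ?thesis by (simp add: cot_def sin_diff field_simps)
qed

text \<open>The first factor is 1 / (cis (2 x) - 1). Its real part does not depend on
  \<open>x\<close>, so in a summation by parts only the cotangent varies.\<close>

lemma cis_eq_cot_times_difference:
  assumes x: "0 < x" "x < pi"
  shows "(- 1/2 - \<i> / 2 * of_real (cot x)) * (cis (2 * x) - 1) = 1"
proof -
  have s: "sin x \<noteq> 0" using sin_gt_zero[OF x] by simp
  have "cis (2 * x) - 1 = of_real (2 * sin x) * (\<i> * of_real (cos x) - of_real (sin x))"
    by (simp add: complex_eq_iff sin_double cos_double_sin power2_eq_square)
  show ?thesis
    unfolding \<open>cis (2 * x) - 1 = _\<close> using s
    by (simp add: complex_eq_iff cot_def field_simps) (use sin_cos_squared_add[of x] in algebra)
qed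

text \<open>
  Since \<open>E (n + 1) = E n * cis (2 x)\<close> with \<open>x\<close> the fractional part of the phase increment times
  \<open>\<pi>\<close>, each term \<open>E n\<close> is \<open>- (1 + \<i> cot x) / 2\<close> times the difference \<open>E (n + 1) - E n\<close>;
  monotonicity of the cotangents makes the total variation in the summation by parts telescope.
\<close>
lemma kusmin_landau:
  fixes f :: "nat \<Rightarrow> real" and k :: int
  assumes d: "d1 > 0" "d2 > 0" "d1 + d2 \<le> 1"
    and mono: "\<And>n. n + 2 < N \<Longrightarrow> f (n + 1) - f n \<le> f (n + 2) - f (n + 1)"
    and range: "\<And>n. n + 1 < N \<Longrightarrow> of_int k + d1 \<le> f (n + 1) - f n \<and> f (n + 1) - f n \<le> of_int k + 1 - d2"
  shows "cmod (\<Sum>n<N. cis (2 * pi * f n)) \<le> (1 / d1 + 1 / d2) / pi"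
proof -
  \<comment> \<open>Serves a single term, where the claimed bound has to be at least 1; pi < 4
    finishes that case.\<close>
  have *: "1 / d1 + 1 / d2 \<ge> 4"
  proof -
    have "0 \<le> (d1 - d2)\<^sup>2" by simp
    then have "4 * (d1 * d2) \<le> (d1 + d2) * (d1 + d2)" by (simp add: power2_eq_square algebra_simps)
    also have "\<dots> \<le> d1 + d2" using d by (intro mult_left_le) auto
    finally show ?thesis using d by (simp add: field_simps)
  qed
  consider "N = 0" | "N = 1" | m where "N = m + 2"
    by (metis One_nat_def Suc_pred add_2_eq_Suc' neq0_conv)
  then show ?thesis
  proof cases
    case 1
    then show ?thesis using d by simp
  next
    case 2
    have "pi \<le> 4" using pi_less_4 by simp
    then have "1 \<le> (1 / d1 + 1 / d2) / pi" using * by (simp add: field_simps)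
    then show ?thesis using 2 by simp
  next
    case 3
    define E where "E = (\<lambda>n. cis (2 * pi * f n))"
    define x where "x = (\<lambda>n. pi * (f (n + 1) - f n - of_int k))"
    define c where "c = (\<lambda>n. cot (x n))"
    have x: "pi * d1 \<le> x n" "pi * d2 \<le> pi - x n" "0 < x n" "x n < pi" if "n \<le> m" for n
    proof -
      have "d1 \<le> f (n + 1) - f n - of_int k" "d2 \<le> 1 - (f (n + 1) - f n - of_int k)"
        using range[of n] that 3 by auto
      then have "pi * d1 \<le> pi * (f (n + 1) - f n - of_int k)"
        "pi * d2 \<le> pi * (1 - (f (n + 1) - f n - of_int k))"
        by (auto intro!: mult_left_mono)
      then show 1: "pi * d1 \<le> x n" "pi * d2 \<le> pi - x n"
        by (simp_all add: x_def right_diff_distrib)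
      have "pi * d1 > 0" "pi * d2 > 0" using d by auto
      with 1 show "0 < x n" "x n < pi" by linarith+
    qed
    have c_mono: "c (Suc n) \<le> c n" if "Suc n \<le> m" for n
      unfolding c_def using mono[of n] that 3 x[of n] x[of "Suc n"]
      by (intro cot_antimono) (auto simp: x_def)
    have E_eq: "E n = (- 1/2 - \<i> / 2 * of_real (c n)) * (E (Suc n) - E n)" if "n \<le> m" for n
    proof -
      have "cis (2 * pi * f (n + 1)) = cis (2 * pi * f n + 2 * x n + 2 * pi * of_int k)"
        by (simp add: x_def algebra_simps)
      also have "\<dots> = E n * cis (2 * x n)"
        by (simp add: E_def cis_mult[symmetric])
      finally have "E (Suc n) - E n = E n * (cis (2 * x n) - 1)"
        by (simp add: E_def algebra_simps)
      then have "(- 1/2 - \<i> / 2 * of_real (c n)) * (E (Suc n) - E n) =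
          E n * ((- 1/2 - \<i> / 2 * of_real (cot (x n))) * (cis (2 * x n) - 1))"
        by (simp add: c_def)
      then show ?thesis using cis_eq_cot_times_difference[OF x(3,4)[OF that]] by simp
    qed
    define X where "X = (\<lambda>j. \<Sum>n<Suc j. of_real (c n) * (E (Suc n) - E n))"
    \<comment> \<open>Summation by parts: apart from the two boundary terms, only the total
      variation of the decreasing cotangents remains.\<close>
    have X: "cmod (X j - of_real (c j) * E (Suc j) + of_real (c 0) * E 0) \<le> c 0 - c j" if "j \<le> m" for j
      using that
    proof (induction j)
      case 0
      then show ?case by (simp add: X_def algebra_simps)
    next
      case (Suc j)
      have "X (Suc j) - of_real (c (Suc j)) * E (Suc (Suc j)) + of_real (c 0) * E 0 =
          (X j - of_real (c j) * E (Suc j) + of_real (c 0) * E 0) + of_real (c j - c (Suc j)) * E (Suc j)"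
        by (simp add: X_def algebra_simps)
      also have "cmod \<dots> \<le> (c 0 - c j) + (c j - c (Suc j))"
        using Suc c_mono[of j] by (intro norm_triangle_mono) (auto simp: norm_mult E_def simp del: of_real_diff)
      finally show ?case by simp
    qed
    define Y where "Y = X m - of_real (c m) * E (Suc m) + of_real (c 0) * E 0"
    have sub: "(\<Sum>n<Suc m. E n) = (- 1/2) * (E (Suc m) - E 0) - \<i> / 2 * X m"
    proof -
      have "(\<Sum>n<Suc m. E n) = (\<Sum>n<Suc m. (- 1/2) * (E (Suc n) - E n) - \<i> / 2 * (of_real (c n) * (E (Suc n) - E n)))"
      proof (rule sum.cong[OF refl])
        fix n assume "n \<in> {..<Suc m}"
        then have "E n = (- 1/2 - \<i> / 2 * of_real (c n)) * (E (Suc n) - E n)" by (intro E_eq) simp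
        then show "E n = (- 1/2) * (E (Suc n) - E n) - \<i> / 2 * (of_real (c n) * (E (Suc n) - E n))"
          by (simp only: left_diff_distrib mult.assoc)
      qed
      also have "\<dots> = (- 1/2) * (\<Sum>n<Suc m. E (Suc n) - E n) - \<i> / 2 * X m"
        by (simp only: X_def sum_subtractf sum_distrib_left right_diff_distrib)
      finally show ?thesis by (simp only: sum_lessThan_telescope)
    qed
    have N: "N = Suc (Suc m)" using 3 by simp
    have "(\<Sum>n<N. E n) = (\<Sum>n<Suc m. E n) + E (Suc m)" by (simp add: N)
    also have "\<dots> = 1/2 * (1 - \<i> * of_real (c m)) * E (Suc m) + 1/2 * (1 + \<i> * of_real (c 0)) * E 0 - \<i> / 2 * Y"
      unfolding sub Y_def by (simp add: algebra_simps)
    also have "cmod \<dots> \<le> cmod (1/2 * (1 - \<i> * of_real (c m)) * E (Suc m)) + cmod (1/2 * (1 + \<i> * of_real (c 0)) * E 0) + cmod (\<i> / 2 * Y)"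
      by (meson add_right_mono norm_triangle_ineq norm_triangle_ineq4 order_trans)
    also have "\<dots> = (sqrt (1 + (c m)\<^sup>2) + sqrt (1 + (c 0)\<^sup>2) + cmod Y) / 2"
    proof -
      have "cmod (1 - \<i> * of_real x) = sqrt (1 + x\<^sup>2)" "cmod (1 + \<i> * of_real x) = sqrt (1 + x\<^sup>2)" for x
        by (simp_all add: cmod_def)
      then show ?thesis by (simp add: norm_mult norm_divide E_def)
    qed
    also have "\<dots> \<le> (2 / (pi * d2) + 2 / (pi * d1)) / 2"
    proof -
      \<comment> \<open>The variation c 0 - c m is shared between the endpoints. Each share
        completes 1 / sin to a half-angle cotangent, at the right end after reflecting x to pi -
        x.\<close>
      have "sqrt (1 + (c 0)\<^sup>2) + c 0 = (1 + cos (x 0)) / sin (x 0)"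
        using sqrt_one_plus_cot_square[OF x(3,4)] by (simp add: c_def cot_def add_divide_distrib)
      also have "\<dots> \<le> 2 / x 0" by (rule inverse_sin_plus_cot_le) (use x in auto)
      also have "\<dots> \<le> 2 / (pi * d1)" using x[of 0] d by (intro divide_left_mono) auto
      finally have 1: "sqrt (1 + (c 0)\<^sup>2) + c 0 \<le> 2 / (pi * d1)" .
      have "sqrt (1 + (c m)\<^sup>2) - c m = (1 + cos (pi - x m)) / sin (pi - x m)"
        using sqrt_one_plus_cot_square[OF x(3,4)[of m]] by (simp add: c_def cot_def diff_divide_distrib)
      also have "\<dots> \<le> 2 / (pi - x m)" by (rule inverse_sin_plus_cot_le) (use x[of m] in auto)
      also have "\<dots> \<le> 2 / (pi * d2)" using x[of m] d by (intro divide_left_mono) auto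
      finally have "sqrt (1 + (c m)\<^sup>2) - c m \<le> 2 / (pi * d2)" .
      with 1 X[of m] show ?thesis by (simp add: Y_def)
    qed
    finally show ?thesis using d by (simp add: E_def field_simps)
  qed
qed

text \<open>Abel's inequality. Replacing all weights by the last one costs at most their total
  decrease times \<open>B\<close>.\<close>

lemma norm_sum_antimono_weights_le:
  fixes z :: "nat \<Rightarrow> complex" and w :: "nat \<Rightarrow> real"
  assumes w: "\<And>n. n < N \<Longrightarrow> w n \<ge> 0" "\<And>n. Suc n < N \<Longrightarrow> w (Suc n) \<le> w n"
    and B: "\<And>m. m \<le> N \<Longrightarrow> cmod (\<Sum>n<m. z n) \<le> B" and N: "N > 0"
  shows "cmod (\<Sum>n<N. of_real (w n) * z n) \<le> w 0 * B"
proof -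
  have *: "cmod ((\<Sum>n<Suc j. of_real (w n) * z n) - of_real (w j) * (\<Sum>n<Suc j. z n)) \<le> (w 0 - w j) * B"
    if "j < N" for j
    using that
  proof (induction j)
    case 0
    then show ?case by simp
  next
    case (Suc j)
    have "(\<Sum>n<Suc (Suc j). of_real (w n) * z n) - of_real (w (Suc j)) * (\<Sum>n<Suc (Suc j). z n)
       = ((\<Sum>n<Suc j. of_real (w n) * z n) - of_real (w j) * (\<Sum>n<Suc j. z n)) + of_real (w j - w (Suc j)) * (\<Sum>n<Suc j. z n)"
      by (simp add: algebra_simps)
    also have "cmod \<dots> \<le> (w 0 - w j) * B + (w j - w (Suc j)) * B"
      using Suc w(2)[of j] B[of "Suc j"]
      by (intro norm_triangle_mono) (auto simp: norm_mult intro!: mult_left_mono simp del: of_real_diff sum.lessThan_Suc)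
    finally show ?case by (simp add: algebra_simps)
  qed
  obtain j where j: "N = Suc j" using N by (cases N) auto
  have "cmod (\<Sum>n<N. of_real (w n) * z n) \<le>
      cmod ((\<Sum>n<Suc j. of_real (w n) * z n) - of_real (w j) * (\<Sum>n<Suc j. z n)) + cmod (of_real (w j) * (\<Sum>n<Suc j. z n))"
    unfolding j by (metis norm_triangle_ineq diff_add_cancel)
  also have "\<dots> \<le> (w 0 - w j) * B + w j * B"
    using *[of j] w(1)[of j] B[of N] j
    by (intro add_mono) (auto simp: norm_mult intro!: mult_left_mono simp del: sum.lessThan_Suc)
  finally show ?thesis by (simp add: algebra_simps)
qed

section \<open>From exponential sums to sums of n powr -(1 + i t)\<close>

lemma powr_one_line_cis:
  assumes "n > 0"
  shows "of_nat n powr (- (1 + \<i> * complex_of_real t)) = of_real (1 / real n) * cis (- (t * ln (real n)))"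
proof -
  have "of_nat n powr (- (1 + \<i> * complex_of_real t)) = exp (of_real (- ln (real n)) + \<i> * of_real (- (t * ln (real n))))"
    using assms by (simp add: powr_def Ln_of_nat algebra_simps)
  also have "\<dots> = of_real (exp (- ln (real n))) * cis (- (t * ln (real n)))"
    by (simp only: exp_add cis_conv_exp exp_of_real)
  finally show ?thesis using assms by (simp add: exp_minus divide_inverse)
qed

lemma sum_powr_shift:
  fixes A B :: nat
  assumes "A > 0"
  shows "(\<Sum>n=A..<B. of_nat n powr (- (1 + \<i> * complex_of_real t)))
    = (\<Sum>i<B - A. of_real (1 / real (A + i)) * cis (- (t * ln (real (A + i)))))"
proof -
  have "(\<Sum>n=A..<B. of_nat n powr (- (1 + \<i> * complex_of_real t)))
     = (\<Sum>n=A..<B. of_real (1 / real n) * cis (- (t * ln (real n))))"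
    using assms by (intro sum.cong powr_one_line_cis) auto
  also have "\<dots> = (\<Sum>i=0..<B - A. of_real (1 / real (A + i)) * cis (- (t * ln (real (A + i)))))"
    by (subst sum.atLeastLessThan_shift_0) (simp add: add.commute)
  finally show ?thesis by (simp add: atLeast0LessThan)
qed

lemma cmod_sum_powr_le_of_cis:
  fixes A B :: nat
  assumes A: "A > 0" and bnd: "\<And>m. m \<le> B - A \<Longrightarrow> cmod (\<Sum>i<m. cis (t * ln (real (A + i)))) \<le> C"
  shows "cmod (\<Sum>n=A..<B. of_nat n powr (- (1 + \<i> * complex_of_real t))) \<le> C / real A"
proof (cases "A < B")
  case False
  then show ?thesis using bnd[of 0] A by simp
next
  case True
  have "cmod (\<Sum>i<m. cis (- (t * ln (real (A + i))))) = cmod (\<Sum>i<m. cis (t * ln (real (A + i))))" for m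
    by (subst complex_mod_cnj[symmetric]) (simp add: cis_cnj)
  then have "cmod (\<Sum>n<B - A. of_real (1 / real (A + n)) * cis (- (t * ln (real (A + n))))) \<le> 1 / real (A + 0) * C"
    using A True bnd by (intro norm_sum_antimono_weights_le) (auto intro!: divide_left_mono)
  then show ?thesis unfolding sum_powr_shift[OF A] by simp
qed

section \<open>The sum beyond the square root of t\<close>

definition nceil :: "real \<Rightarrow> nat" where
  "nceil x = nat \<lceil>x\<rceil>"

lemma le_real_nceil: "x \<le> real (nceil x)"
  unfolding nceil_def by linarith

lemma less_nceil_iff: "n < nceil x \<longleftrightarrow> real n < x"
  unfolding nceil_def using zless_nat_eq_int_zless[of n "\<lceil>x\<rceil>"] by (simp add: less_ceiling_iff)

lemma real_nceil_less: "x \<ge> 0 \<Longrightarrow> real (nceil x) < x + 1"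
  unfolding nceil_def by (simp add: ceiling_correct) linarith

lemma nceil_pos: "x > 0 \<Longrightarrow> nceil x > 0"
  by (simp add: less_nceil_iff)

lemma nceil_mono: "x \<le> y \<Longrightarrow> nceil x \<le> nceil y"
  unfolding nceil_def by (intro nat_mono ceiling_mono)

text \<open>The first summand is at most 1 / x, and each later one satisfies 1 / n <= ln n - ln (n -
  1). The induction uses \<open>real m - 1\<close> because that is the last index.\<close>

lemma sum_inverse_le:
  fixes x y :: real
  assumes "0 < x" "x \<le> y"
  shows "(\<Sum>n=nceil x..<nceil y. 1 / real n) \<le> 1 / x + ln (y / x)"
proof -
  define A where "A = nceil x"
  have A: "x \<le> real A" "A > 0" using assms by (auto simp: A_def le_real_nceil nceil_pos)
  have "(\<Sum>n=A..<m. 1 / real n) \<le> 1 / x + ln ((real m - 1) / x)" if "A < m" for m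
    using that
  proof (induction m)
    case (Suc m)
    show ?case
    proof (cases "A = m")
      case True
      have "1 / real A \<le> 1 / x" using A assms by (intro divide_left_mono) auto
      moreover have "ln (real m / x) \<ge> 0" using True A assms by simp
      ultimately show ?thesis using True by simp
    next
      case False
      with Suc have m: "A < m" by simp
      then have m2: "real m \<ge> 2" using A by linarith
      have "ln ((real m - 1) / real m) \<le> (real m - 1) / real m - 1"
        using m2 by (intro ln_le_minus_one) auto
      moreover have "ln ((real m - 1) / real m) = ln (real m - 1) - ln (real m)"
        using m2 by (intro ln_divide_pos) auto
      moreover have "(real m - 1) / real m - 1 = - (1 / real m)" using m2 by (simp add: field_simps)
      moreover have "ln ((real m - 1) / x) = ln (real m - 1) - ln x" "ln (real m / x) = ln (real m) - ln x"
        using m2 assms by (auto intro!: ln_divide_pos)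
      ultimately show ?thesis using Suc.IH[OF m] m by simp
    qed
  qed simp
  note * = this
  show ?thesis
  proof (cases "A < nceil y")
    case True
    have "ln ((real (nceil y) - 1) / x) \<le> ln (y / x)"
    proof -
      have "real (nceil y) - 1 \<le> y" using real_nceil_less[of y] assms by simp
      moreover have "nceil y \<ge> 2" using True A by linarith
      ultimately show ?thesis using assms by (intro ln_mono divide_right_mono) auto
    qed
    with *[OF True] show ?thesis unfolding A_def by linarith
  next
    case False
    then show ?thesis using assms by (simp add: A_def)
  qed
qed

text \<open>The index set consists of the integers n with x <= n < y. Half-open intervals with real
  endpoints concatenate without overlap, so block boundaries such as a / k need no rounding.\<close>

definition line_sum :: "real \<Rightarrow> real \<Rightarrow> real \<Rightarrow> complex" where
  "line_sum t x y = (\<Sum>n=nceil x..<nceil y. of_nat n powr (- (1 + \<i> * complex_of_real t)))"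

lemma line_sum_add:
  assumes "x \<le> y" "y \<le> z"
  shows "line_sum t x z = line_sum t x y + line_sum t y z"
  unfolding line_sum_def using assms by (intro sum.atLeastLessThan_concat[symmetric] nceil_mono)

lemma cmod_line_sum_trivial:
  assumes "0 < x" "x \<le> y"
  shows "cmod (line_sum t x y) \<le> 1 / x + ln (y / x)"
proof -
  have "cmod (line_sum t x y) \<le> (\<Sum>n=nceil x..<nceil y. 1 / real n)"
    unfolding line_sum_def
  proof (rule sum_norm_le)
    fix n assume "n \<in> {nceil x..<nceil y}"
    then have "n > 0" using nceil_pos[OF assms(1)] by simp
    then show "cmod (of_nat n powr (- (1 + \<i> * complex_of_real t))) \<le> 1 / real n"
      by (simp only: cmod_powr_minus_one_line)
  qed
  also have "\<dots> \<le> 1 / x + ln (y / x)" by (rule sum_inverse_le[OF assms])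
  finally show ?thesis .
qed

lemma ln_Suc_diff_bounds:
  fixes x :: real
  assumes "x > 0"
  shows "1 / (x + 1) \<le> ln (x + 1) - ln x" "ln (x + 1) - ln x \<le> 1 / x"
proof -
  have "ln ((x + 1) / x) \<le> (x + 1) / x - 1" "ln (x / (x + 1)) \<le> x / (x + 1) - 1"
    using assms by (auto intro!: ln_le_minus_one)
  moreover have "ln ((x + 1) / x) = ln (x + 1) - ln x" "ln (x / (x + 1)) = ln x - ln (x + 1)"
    using assms by (auto intro!: ln_divide_pos)
  moreover have "(x + 1) / x - 1 = 1 / x" "x / (x + 1) - 1 = - (1 / (x + 1))"
    using assms by (auto simp: field_simps)
  ultimately show "1 / (x + 1) \<le> ln (x + 1) - ln x" "ln (x + 1) - ln x \<le> 1 / x" by linarith+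
qed

lemma ln_second_difference:
  fixes x :: real
  assumes "x > 0"
  shows "ln (x + 2) - ln (x + 1) \<le> ln (x + 1) - ln x"
proof -
  have "ln ((x + 2) * x) \<le> ln ((x + 1) * (x + 1))"
    using assms by (intro ln_mono mult_pos_pos) (auto simp: algebra_simps)
  then show ?thesis using assms by (simp add: ln_mult)
qed

text \<open>
  Between consecutive stationary points: for \<open>n\<close> in this range the phase increments
  \<open>a * ln ((n + 1) / n)\<close> lie strictly between the integers \<open>k\<close> and \<open>k + 1\<close>.
\<close>
lemma cmod_line_sum_gap:
  fixes a d1 d2 :: real and k :: nat
  assumes a: "a > 0" and d: "d1 > 0" "d2 > 0" "d1 + d2 \<le> 1"
  shows "cmod (line_sum (2 * pi * a) (a / (real k + 1 - d2)) (a / (real k + d1)))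
           \<le> (1 / d1 + 1 / d2) * (real k + 1 - d2) / (pi * a)"
proof -
  define A where "A = nceil (a / (real k + 1 - d2))"
  define B where "B = nceil (a / (real k + d1))"
  define C where "C = (1 / d1 + 1 / d2) / pi"
  have kd: "real k + 1 - d2 > 0" "real k + d1 > 0" using d by linarith+
  have A: "A > 0" "a / (real k + 1 - d2) \<le> real A"
    using a kd by (auto simp: A_def le_real_nceil intro!: nceil_pos)
  have lnb: "1 / (y + 1) \<le> ln (y + 1) - ln y" "ln (y + 1) - ln y \<le> 1 / y" if "y > 0" for y :: real
    using ln_Suc_diff_bounds[OF that] by auto
  have "cmod (line_sum (2 * pi * a) (a / (real k + 1 - d2)) (a / (real k + d1))) \<le> C / real A"
    unfolding line_sum_def A_def[symmetric] B_def[symmetric]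
  proof (rule cmod_sum_powr_le_of_cis[OF A(1)])
    fix m assume m: "m \<le> B - A"
    \<comment> \<open>Increments of the logarithm decrease, whereas \<open>kusmin_landau\<close>
      wants them nondecreasing. Negating the phase moves the range from (k, k + 1) to (-k - 1, -k)
      and exchanges \<open>d1\<close> with \<open>d2\<close>; conjugation undoes it at the
      end.\<close>
    define f where "f = (\<lambda>i. - a * ln (real (A + i)))"
    have "cmod (\<Sum>i<m. cis (2 * pi * f i)) \<le> (1 / d2 + 1 / d1) / pi"
    proof (rule kusmin_landau[where k = "- int k - 1"])
      fix n assume "n + 2 < m"
      have "real (A + n) > 0" using A by simp
      from ln_second_difference[OF this] have "ln (real (A + n) + 2) - ln (real (A + n) + 1) \<le> ln (real (A + n) + 1) - ln (real (A + n))" .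
      then have "a * (ln (real (A + n) + 2) - ln (real (A + n) + 1)) \<le> a * (ln (real (A + n) + 1) - ln (real (A + n)))"
        using a by (intro mult_left_mono) auto
      then show "f (n + 1) - f n \<le> f (n + 2) - f (n + 1)"
        by (simp add: f_def algebra_simps)
    next
      fix n assume n: "n + 1 < m"
      define x where "x = real (A + n)"
      have x: "x > 0" "real A \<le> x" using A by (auto simp: x_def)
      have "A + n + 1 < B" using n m by simp
      then have "real (A + n + 1) < a / (real k + d1)" unfolding B_def by (simp only: less_nceil_iff)
      then have "real k + d1 \<le> a / (x + 1)" using x kd by (simp add: x_def field_simps)
      also have "\<dots> \<le> a * (ln (x + 1) - ln x)"
        using lnb(1)[OF x(1)] a mult_left_mono[OF lnb(1)[OF x(1)], of a] by simp
      finally have 1: "real k + d1 \<le> a * (ln (x + 1) - ln x)" .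
      have "a * (ln (x + 1) - ln x) \<le> a / x"
        using mult_left_mono[OF lnb(2)[OF x(1)], of a] a by simp
      also have "\<dots> \<le> a / (a / (real k + 1 - d2))"
        using x A a kd by (intro divide_left_mono) auto
      also have "\<dots> = real k + 1 - d2" using a by simp
      finally have "a * (ln (x + 1) - ln x) \<le> real k + 1 - d2" .
      with 1 show "of_int (- int k - 1) + d2 \<le> f (n + 1) - f n \<and> f (n + 1) - f n \<le> of_int (- int k - 1) + 1 - d1"
        by (simp add: f_def x_def algebra_simps)
    qed (use d in auto)
    moreover have "cmod (\<Sum>i<m. cis (2 * pi * f i)) = cmod (\<Sum>i<m. cis (2 * pi * a * ln (real (A + i))))"
      by (subst complex_mod_cnj[symmetric]) (simp add: cis_cnj f_def mult.assoc)
    ultimately show "cmod (\<Sum>i<m. cis (2 * pi * a * ln (real (A + i)))) \<le> C"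
      by (simp add: C_def add.commute)
  qed
  also have "\<dots> \<le> C / (a / (real k + 1 - d2))"
    using A a kd d by (intro divide_left_mono) (auto simp: C_def)
  finally show ?thesis by (simp add: C_def)
qed

lemma sum_inverse_le_half: "K \<ge> 1 \<Longrightarrow> (\<Sum>k=1..<K. 1 / real k) \<le> real K / 2"
proof (induction K rule: dec_induct)
  case (step K)
  then show ?case
  proof (cases "K = 1")
    case False
    then have "1 / real K \<le> 1 / 2" using step by (intro divide_left_mono) auto
    moreover have "(\<Sum>k=1..<Suc K. 1 / real k) = (\<Sum>k=1..<K. 1 / real k) + 1 / real K"
      using step.hyps by simp
    moreover have "real (Suc K) / 2 = real K / 2 + 1 / 2" by simp
    ultimately show ?thesis using step.IH by linarith
  qed simp
qed simp

text \<open>The frequency at n is about a / n, with a = t / (2 pi). A stationary block around a / k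
  covers the frequencies from k (1 - \<open>\<rho>\<close>) to k (1 + \<open>\<rho>\<close>), and
  \<open>u0\<close> is the lowest frequency, reached at the truncation point.\<close>

context
  fixes a \<rho> u0 :: real
  assumes a: "a > 0" and \<rho>: "\<rho> > 0" and u0: "u0 > 0" "u0 + \<rho> \<le> 1"
begin

lemma cmod_line_sum_stationary:
  assumes "k \<ge> 1" "\<rho> < 1"
  shows "cmod (line_sum (2 * pi * a) (a / (real k * (1 + \<rho>))) (a / (real k * (1 - \<rho>))))
           \<le> real k * (1 + \<rho>) / a + ln ((1 + \<rho>) / (1 - \<rho>))"
proof -
  have "a / (real k * (1 - \<rho>)) / (a / (real k * (1 + \<rho>))) = (1 + \<rho>) / (1 - \<rho>)"
    using a assms \<rho> by simp
  moreover have "a / (real k * (1 + \<rho>)) \<le> a / (real k * (1 - \<rho>))"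
    using a assms \<rho> by (intro divide_left_mono mult_left_mono) auto
  ultimately show ?thesis
    using cmod_line_sum_trivial[of "a / (real k * (1 + \<rho>))" "a / (real k * (1 - \<rho>))" "2 * pi * a"] a assms \<rho>
    by simp
qed

text \<open>Induction towards smaller n: each step prepends the block of frequency K + 1 and the gap
  between it and the block of K. The hypothesis \<open>\<rho>K\<close> keeps neighbouring blocks
  disjoint. In a gap the distances to the integers are \<open>\<rho>\<close> k and
  \<open>\<rho>\<close> (k + 1), which produces 2 + 1 / k; the last summand is the gap between
  \<open>u0\<close> and the block of 1.\<close>

lemma cmod_line_sum_from_stationary:
  assumes K: "K \<ge> 1" and \<rho>K: "2 * \<rho> * real K \<le> 1"
  shows "cmod (line_sum (2 * pi * a) (a / (real K * (1 + \<rho>))) (a / u0))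
           \<le> real K * ln ((1 + \<rho>) / (1 - \<rho>)) + (1 + \<rho>) * real K * (real K + 1) / (2 * a)
             + (1 - \<rho>) / (pi * a * \<rho>) * (\<Sum>k=1..<K. 2 + 1 / real k)
             + (1 / u0 + 1 / \<rho>) * (1 - \<rho>) / (pi * a)"
  using K \<rho>K
proof (induction K rule: dec_induct)
  case base
  then have \<rho>1: "\<rho> < 1" using \<rho> by simp
  have "a / (1 + \<rho>) \<le> a / (1 - \<rho>)" "a / (1 - \<rho>) \<le> a / u0"
    using a \<rho> u0 \<rho>1 by (auto intro!: divide_left_mono)
  then have "line_sum (2 * pi * a) (a / (1 + \<rho>)) (a / u0)
     = line_sum (2 * pi * a) (a / (1 + \<rho>)) (a / (1 - \<rho>)) + line_sum (2 * pi * a) (a / (1 - \<rho>)) (a / u0)"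
    by (rule line_sum_add)
  moreover have "cmod (line_sum (2 * pi * a) (a / (1 + \<rho>)) (a / (1 - \<rho>))) \<le> (1 + \<rho>) / a + ln ((1 + \<rho>) / (1 - \<rho>))"
    using cmod_line_sum_stationary[of 1] \<rho>1 by simp
  moreover have "cmod (line_sum (2 * pi * a) (a / (1 - \<rho>)) (a / u0)) \<le> (1 / u0 + 1 / \<rho>) * (1 - \<rho>) / (pi * a)"
    using cmod_line_sum_gap[of a u0 \<rho> 0] a \<rho> u0 by simp
  ultimately have "cmod (line_sum (2 * pi * a) (a / (1 + \<rho>)) (a / u0)) \<le>
      (1 + \<rho>) / a + ln ((1 + \<rho>) / (1 - \<rho>)) + (1 / u0 + 1 / \<rho>) * (1 - \<rho>) / (pi * a)"
    using norm_triangle_mono by (simp only:)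
  moreover have "(1 + \<rho>) * real 1 * (real 1 + 1) / (2 * a) = (1 + \<rho>) / a" using a by (simp add: field_simps)
  ultimately show ?case by simp
next
  case (step K)
  define x where "x = real K"
  have x: "x \<ge> 1" "real (Suc K) = x + 1" using step by (auto simp: x_def)
  have \<rho>x: "2 * \<rho> * (x + 1) \<le> 1" using step.prems x by (simp add: add.commute)
  have "2 * \<rho> * x \<le> 2 * \<rho> * (x + 1)" "\<rho> * 1 \<le> \<rho> * x" using \<rho> x by (auto intro!: mult_left_mono)
  then have \<rho>x': "2 * \<rho> * x \<le> 1" "\<rho> \<le> \<rho> * x" using \<rho>x by linarith+
  then have \<rho>1: "\<rho> < 1" using \<rho> by linarith
  have xx: "x * (1 + \<rho>) \<le> (x + 1) * (1 - \<rho>)" "u0 \<le> x * (1 + \<rho>)" "(x + 1) * (1 - \<rho>) \<le> (x + 1) * (1 + \<rho>)"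
  proof -
    have e: "x * (1 + \<rho>) = x + \<rho> * x" "(x + 1) * (1 - \<rho>) = x + 1 - \<rho> * x - \<rho>"
      "(x + 1) * (1 + \<rho>) = x + 1 + \<rho> * x + \<rho>" "2 * \<rho> * (x + 1) = 2 * (\<rho> * x) + 2 * \<rho>"
      by (simp_all add: algebra_simps)
    show "x * (1 + \<rho>) \<le> (x + 1) * (1 - \<rho>)" "u0 \<le> x * (1 + \<rho>)" "(x + 1) * (1 - \<rho>) \<le> (x + 1) * (1 + \<rho>)"
      using \<rho>x \<rho> x u0 \<rho>x' unfolding e by linarith+
  qed
  let ?s = "line_sum (2 * pi * a)"
  have ge: "a / ((x + 1) * (1 + \<rho>)) \<le> a / ((x + 1) * (1 - \<rho>))"
    "a / ((x + 1) * (1 - \<rho>)) \<le> a / (x * (1 + \<rho>))" "a / (x * (1 + \<rho>)) \<le> a / u0"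
    using a x \<rho> \<rho>1 u0 xx by (auto intro!: divide_left_mono)
  have "?s (a / ((x + 1) * (1 + \<rho>))) (a / u0) =
     ?s (a / ((x + 1) * (1 + \<rho>))) (a / ((x + 1) * (1 - \<rho>)))
     + (?s (a / ((x + 1) * (1 - \<rho>))) (a / (x * (1 + \<rho>))) + ?s (a / (x * (1 + \<rho>))) (a / u0))"
    using line_sum_add[OF ge(1) order_trans[OF ge(2,3)]] line_sum_add[OF ge(2,3)] by simp
  then have "cmod (?s (a / ((x + 1) * (1 + \<rho>))) (a / u0)) \<le>
     cmod (?s (a / ((x + 1) * (1 + \<rho>))) (a / ((x + 1) * (1 - \<rho>))))
     + (cmod (?s (a / ((x + 1) * (1 - \<rho>))) (a / (x * (1 + \<rho>)))) + cmod (?s (a / (x * (1 + \<rho>))) (a / u0)))"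
    by (simp only:) (intro order_trans[OF norm_triangle_ineq] add_left_mono norm_triangle_ineq)
  moreover have "cmod (?s (a / ((x + 1) * (1 + \<rho>))) (a / ((x + 1) * (1 - \<rho>)))) \<le> (x + 1) * (1 + \<rho>) / a + ln ((1 + \<rho>) / (1 - \<rho>))"
    using cmod_line_sum_stationary[of "Suc K"] \<rho>1 unfolding x(2) by simp
  moreover have "cmod (?s (a / ((x + 1) * (1 - \<rho>))) (a / (x * (1 + \<rho>)))) \<le> (1 - \<rho>) / (pi * a * \<rho>) * (2 + 1 / x)"
  proof -
    have "\<rho> * x + \<rho> * (x + 1) \<le> 1" using \<rho>x \<rho> by (simp add: algebra_simps)
    moreover have "real K + 1 - \<rho> * (x + 1) = (x + 1) * (1 - \<rho>)" "real K + \<rho> * x = x * (1 + \<rho>)"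
      by (simp_all add: x_def algebra_simps)
    moreover have "\<rho> * x > 0" "\<rho> * (x + 1) > 0" using \<rho> x by simp_all
    ultimately have "cmod (?s (a / ((x + 1) * (1 - \<rho>))) (a / (x * (1 + \<rho>)))) \<le> (1 / (\<rho> * x) + 1 / (\<rho> * (x + 1))) * ((x + 1) * (1 - \<rho>)) / (pi * a)"
      using cmod_line_sum_gap[OF a, of "\<rho> * x" "\<rho> * (x + 1)" K] by simp
    also have "(1 / (\<rho> * x) + 1 / (\<rho> * (x + 1))) * ((x + 1) * (1 - \<rho>)) = (1 - \<rho>) / \<rho> * (2 + 1 / x)"
      using \<rho> x by (simp add: divide_simps)
    finally show ?thesis by (simp add: mult_ac)
  qed
  moreover have "cmod (?s (a / (x * (1 + \<rho>))) (a / u0)) \<le> x * ln ((1 + \<rho>) / (1 - \<rho>)) + (1 + \<rho>) * x * (x + 1) / (2 * a)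
             + (1 - \<rho>) / (pi * a * \<rho>) * (\<Sum>k=1..<K. 2 + 1 / real k)
             + (1 / u0 + 1 / \<rho>) * (1 - \<rho>) / (pi * a)"
    using step.IH \<rho>x' by (simp add: x_def)
  moreover have "(1 + \<rho>) * (x + 1) * (x + 1 + 1) / (2 * a) = (x + 1) * (1 + \<rho>) / a + (1 + \<rho>) * x * (x + 1) / (2 * a)"
    using a by (simp add: field_simps)
  moreover have "(\<Sum>k=1..<Suc K. 2 + 1 / real k) = (\<Sum>k=1..<K. 2 + 1 / real k) + (2 + 1 / x)"
    using step.hyps by (simp add: x_def)
  ultimately show ?case unfolding x(2) by (simp add: distrib_left distrib_right)
qed

text \<open>One more partial gap is added, from frequency K (1 + \<open>\<rho>\<close>) up to K +
  1/2. Stopping halfway between two integers leaves distance 1/2 at that end.\<close>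

lemma cmod_line_sum_tail:
  assumes K: "K \<ge> 1" and \<rho>K: "2 * \<rho> * real K \<le> 1"
  shows "cmod (line_sum (2 * pi * a) (a / (real K + 1/2)) (a / u0))
           \<le> (1 / (\<rho> * real K) + 2) * (real K + 1/2) / (pi * a)
             + real K * ln ((1 + \<rho>) / (1 - \<rho>)) + (1 + \<rho>) * real K * (real K + 1) / (2 * a)
             + (1 - \<rho>) / (pi * a * \<rho>) * (5 / 2 * real K - 2)
             + (1 / u0 + 1 / \<rho>) * (1 - \<rho>) / (pi * a)"
proof -
  let ?s = "line_sum (2 * pi * a)"
  define x where "x = real K"
  have x: "x \<ge> 1" using K by (simp add: x_def)
  have \<rho>x: "\<rho> * x \<le> 1 / 2" "\<rho> * 1 \<le> \<rho> * x" using \<rho>K \<rho> x by (auto simp: x_def intro!: mult_left_mono)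
  have "x * (1 + \<rho>) \<le> x + 1/2" "u0 \<le> x * (1 + \<rho>)"
    using \<rho>x x u0 \<rho> by (simp_all only: distrib_left mult_1_right mult.commute[of x \<rho>])
  then have ge: "a / (x + 1/2) \<le> a / (x * (1 + \<rho>))" "a / (x * (1 + \<rho>)) \<le> a / u0"
    using a x \<rho> u0 by (auto intro!: divide_left_mono)
  have "?s (a / (x + 1/2)) (a / u0) = ?s (a / (x + 1/2)) (a / (x * (1 + \<rho>))) + ?s (a / (x * (1 + \<rho>))) (a / u0)"
    by (rule line_sum_add[OF ge])
  then have "cmod (?s (a / (x + 1/2)) (a / u0)) \<le> cmod (?s (a / (x + 1/2)) (a / (x * (1 + \<rho>)))) + cmod (?s (a / (x * (1 + \<rho>))) (a / u0))"
    by (metis norm_triangle_ineq)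
  moreover have "cmod (?s (a / (x + 1/2)) (a / (x * (1 + \<rho>)))) \<le> (1 / (\<rho> * x) + 2) * (x + 1/2) / (pi * a)"
    using cmod_line_sum_gap[OF a, of "\<rho> * x" "1/2" K] \<rho> x \<rho>x by (simp add: x_def[symmetric] algebra_simps)
  moreover have "(1 - \<rho>) / (pi * a * \<rho>) * (\<Sum>k=1..<K. 2 + 1 / real k) \<le> (1 - \<rho>) / (pi * a * \<rho>) * (5 / 2 * real K - 2)"
  proof (rule mult_left_mono)
    have "(\<Sum>k=1..<K. 2 + 1 / real k) = 2 * (real K - 1) + (\<Sum>k=1..<K. 1 / real k)"
      using K by (simp add: sum.distrib of_nat_diff)
    then show "(\<Sum>k=1..<K. 2 + 1 / real k) \<le> 5 / 2 * real K - 2"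
      using sum_inverse_le_half[OF K] by simp
    show "0 \<le> (1 - \<rho>) / (pi * a * \<rho>)" using a \<rho> u0 by simp
  qed
  ultimately show ?thesis using cmod_line_sum_from_stationary[OF K \<rho>K] unfolding x_def by linarith
qed

end

section \<open>The bound with one half of the logarithm\<close>

lemma cmod_zeta_le_line_sum:
  fixes t y z :: real
  assumes t: "t > 0" and yz: "1 \<le> y" "y \<le> z"
  shows "cmod (zeta (1 + \<i> * of_real t)) \<le> cmod (\<Sum>n=1..<nceil y. of_nat n powr (- (1 + \<i> * complex_of_real t)))
      + cmod (line_sum t y z) + 1 / (2 * z) + 1 / t + (t\<^sup>2 + 5/2) / (24 * z\<^sup>2)"
proof -
  define N where "N = nceil z"
  have N: "z \<le> real N" "N > 0" using yz by (auto simp: N_def le_real_nceil intro!: nceil_pos)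
  let ?f = "\<lambda>n. of_nat n powr (- (1 + \<i> * complex_of_real t))"
  have "(\<Sum>n=1..<N. ?f n) = (\<Sum>n=1..<nceil y. ?f n) + line_sum t y z"
  proof -
    have "1 \<le> nceil y" using nceil_pos[of y] yz by simp
    then show ?thesis
      unfolding line_sum_def N_def using yz by (intro sum.atLeastLessThan_concat[symmetric] nceil_mono)
  qed
  then have "cmod (\<Sum>n=1..<N. ?f n) \<le> cmod (\<Sum>n=1..<nceil y. ?f n) + cmod (line_sum t y z)"
    by (simp only: norm_triangle_ineq)
  moreover have "sqrt (1/4 + (real N)\<^sup>2 / t\<^sup>2) / real N \<le> 1 / (2 * z) + 1 / t"
  proof -
    have "sqrt (1/4 + (real N / t)\<^sup>2) \<le> 1/2 + real N / t"
      using t by (intro real_le_lsqrt) (auto simp: power2_sum power_divide)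
    then have "sqrt (1/4 + (real N / t)\<^sup>2) / real N \<le> (1/2 + real N / t) / real N"
      by (rule divide_right_mono) auto
    also have "\<dots> = 1 / (2 * real N) + 1 / t" using N by (simp add: add_divide_distrib)
    also have "1 / (2 * real N) \<le> 1 / (2 * z)" using N yz by (intro divide_left_mono) auto
    finally show ?thesis by (simp add: power_divide)
  qed
  moreover have "(t\<^sup>2 + 5/2) / 2 * harm_defect N \<le> (t\<^sup>2 + 5/2) / (24 * z\<^sup>2)"
  proof -
    have "harm_defect N \<le> 1 / (12 * (real N)\<^sup>2)" by (rule harm_defect_le[OF N(2)])
    also have "\<dots> \<le> 1 / (12 * z\<^sup>2)"
      using N yz by (intro divide_left_mono mult_left_mono power_mono) auto
    finally have "(t\<^sup>2 + 5/2) / 2 * harm_defect N \<le> (t\<^sup>2 + 5/2) / 2 * (1 / (12 * z\<^sup>2))"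
      by (rule mult_left_mono) simp
    then show ?thesis by simp
  qed
  ultimately show ?thesis using cmod_zeta_le_truncated[OF t N(2)] by linarith
qed

text \<open>The harmonic sum ends at the last integer Y below y; Y may be replaced by y because ln x
  + 1 / (2 x) increases for x >= 1/2.\<close>

lemma cmod_sum_powr_le_ln:
  assumes y: "y \<ge> 1"
  shows "cmod (\<Sum>n=1..<nceil y. of_nat n powr (- (1 + \<i> * complex_of_real t)))
           \<le> ln y + euler_mascheroni + 1 / (2 * y)"
proof (cases "nceil y \<le> 1")
  case True
  then show ?thesis using y euler_mascheroni_pos by simp
next
  case False
  define Y where "Y = nceil y - 1"
  have Y: "Y > 0" "real Y \<le> y" using False real_nceil_less[of y] y by (auto simp: Y_def of_nat_diff)
  have "cmod (\<Sum>n=1..<nceil y. of_nat n powr (- (1 + \<i> * complex_of_real t))) \<le> harm Y"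
    unfolding Y_def by (rule cmod_sum_powr_le_harm)
  also have "harm Y \<le> ln (real Y) + euler_mascheroni + 1 / (2 * real Y)"
    using harm_defect_nonneg[OF Y(1)] by (simp add: harm_defect_def)
  finally have "cmod (\<Sum>n=1..<nceil y. of_nat n powr (- (1 + \<i> * complex_of_real t))) \<le> ln (real Y) + euler_mascheroni + 1 / (2 * real Y)" .
  moreover have "ln (real Y) + 1 / (2 * real Y) \<le> ln y + 1 / (2 * y)"
  proof -
    have "ln (real Y / y) \<le> real Y / y - 1" using Y y by (intro ln_le_minus_one) auto
    moreover have "ln (real Y / y) = ln (real Y) - ln y" using Y y by (intro ln_divide_pos) auto
    moreover have "real Y / y - 1 \<le> 1 / (2 * y) - 1 / (2 * real Y)"
    proof -
      have "(y - real Y) * (2 * real Y - 1) \<ge> 0" using Y by simp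
      then have "2 * (real Y * real Y) + y \<le> 2 * (y * real Y) + real Y" by (simp add: algebra_simps)
      from mult_left_mono[OF this, of y] show ?thesis
        using Y y by (simp add: divide_simps algebra_simps)
    qed
    ultimately show ?thesis by linarith
  qed
  ultimately show ?thesis by linarith
qed

text \<open>
  The tail of the sum beyond the saddle frequency \<open>K + 1/2\<close>, in the variables \<open>q = 1 / sqrt t\<close>
  and \<open>p = K q\<close>; the widths of the blocks around the stationary points are \<open>8/5 q\<close> relative to
  their positions, and the Euler--Maclaurin cutoff is where the phase increment is \<open>1/5\<close>.
\<close>
lemma cmod_line_sum_tail_poly:
  fixes q :: real and K :: nat
  assumes q: "q > 0" "q \<le> 1/7" and K: "K \<ge> 1" "real K * q \<le> 17/100"
  defines "p \<equiv> real K * q" and "a \<equiv> 1 / (2 * pi * q\<^sup>2)"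
  shows "cmod (line_sum (2 * pi * a) (a / (real K + 1/2)) (a / (1/5))) \<le>
     5/4 * q + 5/8 * q / real K + 4 * p * q + 2 * q\<^sup>2 + 16/5 * p + 29/10 * p * q\<^sup>2
      + pi * (1 + 8/5 * q) * (p\<^sup>2 + p * q) + (1 - 8/5 * q) * (5/4) * (5/2 * p - 2 * q)
      + (1 - 8/5 * q) * (5/4 * q + 10 * q\<^sup>2)"
proof -
  define \<rho> where "\<rho> = 8/5 * q"
  have \<rho>: "\<rho> > 0" "\<rho> \<le> 8/35" using q by (auto simp: \<rho>_def)
  have a: "a > 0" using q by (simp add: a_def)
  have x: "real K \<ge> 1" using K by simp
  have "2 * \<rho> * real K \<le> 1" using K by (simp add: \<rho>_def algebra_simps)
  moreover have "1/5 + \<rho> \<le> 1" using \<rho> by simp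
  ultimately have main: "cmod (line_sum (2 * pi * a) (a / (real K + 1/2)) (a / (1/5))) \<le>
      (1 / (\<rho> * real K) + 2) * (real K + 1/2) / (pi * a)
             + real K * ln ((1 + \<rho>) / (1 - \<rho>)) + (1 + \<rho>) * real K * (real K + 1) / (2 * a)
             + (1 - \<rho>) / (pi * a * \<rho>) * (5 / 2 * real K - 2)
             + (1 / (1/5) + 1 / \<rho>) * (1 - \<rho>) / (pi * a)"
    using cmod_line_sum_tail[OF a \<rho>(1), of "1/5" K] K by simp
  have pa: "1 / (pi * a) = 2 * q\<^sup>2" "1 / (2 * a) = pi * q\<^sup>2" using q by (simp_all add: a_def)
  have "(1 / (\<rho> * real K) + 2) * (real K + 1/2) / (pi * a) = (1 / (\<rho> * real K) + 2) * (real K + 1/2) * (2 * q\<^sup>2)"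
    unfolding pa(1)[symmetric] by simp
  also have "\<dots> = 5/4 * q + 5/8 * q / real K + 4 * p * q + 2 * q\<^sup>2"
    using q x by (simp add: \<rho>_def p_def field_simps power2_eq_square)
  finally have 1: "(1 / (\<rho> * real K) + 2) * (real K + 1/2) / (pi * a) = 5/4 * q + 5/8 * q / real K + 4 * p * q + 2 * q\<^sup>2" .
  have 2: "real K * ln ((1 + \<rho>) / (1 - \<rho>)) \<le> 16/5 * p + 29/10 * p * q\<^sup>2"
  proof -
    \<comment> \<open>The logarithm is 2 artanh \<open>\<rho>\<close>: the expansion variable (x -
      1) / (x + 1) in \<open>ln_approx_bounds\<close> is \<open>\<rho>\<close> itself.\<close>
    have "(1 + \<rho>) / (1 - \<rho>) > 1" using \<rho> by (simp add: field_simps)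
    from ln_approx_bounds[OF this, of 1]
    have "ln ((1 + \<rho>) / (1 - \<rho>)) \<le> 2 * r + 2 * (r^3 / (1 - r\<^sup>2) / 3)"
      if "r = ((1 + \<rho>) / (1 - \<rho>) - 1) / ((1 + \<rho>) / (1 - \<rho>) + 1)" for r
      using that by (simp add: eval_nat_numeral)
    moreover have "\<rho> = ((1 + \<rho>) / (1 - \<rho>) - 1) / ((1 + \<rho>) / (1 - \<rho>) + 1)"
      using \<rho> by (simp add: divide_simps)
    ultimately have "ln ((1 + \<rho>) / (1 - \<rho>)) \<le> 2 * \<rho> + 2 * (\<rho>^3 / (1 - \<rho>\<^sup>2) / 3)" by blast
    also have "\<rho>^3 / (1 - \<rho>\<^sup>2) \<le> \<rho>^3 / (947/1000)"
    proof (rule divide_left_mono)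
      have "\<rho>\<^sup>2 \<le> (8/35)\<^sup>2" using \<rho> by (intro power_mono) auto
      then show "947/1000 \<le> 1 - \<rho>\<^sup>2" by (simp add: power_divide)
      then show "0 < (1 - \<rho>\<^sup>2) * (947/1000)" by simp
    qed (use \<rho> in auto)
    also have "2 * \<rho> + 2 * (\<rho>^3 / (947/1000) / 3) \<le> 16/5 * q + 29/10 * q^3"
      using q by (simp add: \<rho>_def power_mult_distrib power_divide)
    finally have "real K * ln ((1 + \<rho>) / (1 - \<rho>)) \<le> real K * (16/5 * q + 29/10 * q^3)"
      by (rule mult_left_mono) auto
    then show ?thesis by (simp add: p_def algebra_simps power_numeral_reduce)
  qed
  have "(1 + \<rho>) * real K * (real K + 1) / (2 * a) = (1 + \<rho>) * real K * (real K + 1) * (pi * q\<^sup>2)"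
    unfolding pa(2)[symmetric] by simp
  then have 3: "(1 + \<rho>) * real K * (real K + 1) / (2 * a) = pi * (1 + 8/5 * q) * (p\<^sup>2 + p * q)"
    by (simp add: \<rho>_def p_def field_simps power2_eq_square)
  have "(1 - \<rho>) / (pi * a * \<rho>) * (5 / 2 * real K - 2) = (1 - \<rho>) / \<rho> * (5 / 2 * real K - 2) * (2 * q\<^sup>2)"
    unfolding pa(1)[symmetric] by (simp add: mult_ac)
  also have "\<dots> = (1 - 8/5 * q) * (5/4) * (5/2 * p - 2 * q)"
    using q by (simp add: \<rho>_def p_def field_simps power2_eq_square)
  finally have 4: "(1 - \<rho>) / (pi * a * \<rho>) * (5 / 2 * real K - 2) = (1 - 8/5 * q) * (5/4) * (5/2 * p - 2 * q)" .
  have "(1 / (1/5) + 1 / \<rho>) * (1 - \<rho>) / (pi * a) = (5 + 1 / \<rho>) * (1 - \<rho>) * (2 * q\<^sup>2)"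
    unfolding pa(1)[symmetric] by simp
  also have "\<dots> = (1 - 8/5 * q) * (5/4 * q + 10 * q\<^sup>2)"
    using q by (simp add: \<rho>_def field_simps power2_eq_square)
  finally have 5: "(1 / (1/5) + 1 / \<rho>) * (1 - \<rho>) / (pi * a) = (1 - 8/5 * q) * (5/4 * q + 10 * q\<^sup>2)" .
  show ?thesis using main 2 unfolding 1 3 4 5 by linarith
qed

lemma euler_maclaurin_error_poly:
  fixes q :: real
  assumes q: "q > 0"
  defines "a \<equiv> 1 / (2 * pi * q\<^sup>2)"
  shows "1 / (2 * (a / (1/5))) + 1 / (2 * pi * a) + ((2 * pi * a)\<^sup>2 + 5/2) / (24 * (a / (1/5))\<^sup>2)
      \<le> (pi / 5 + 1) * q\<^sup>2 + pi\<^sup>2 / 150 * (1 + 5/2 * q ^ 4)"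
  using q by (simp add: a_def field_simps power2_eq_square power4_eq_xxxx)

lemma pi_bounds: "pi \<ge> 3.1415" "pi \<le> 3.1416" "pi\<^sup>2 \<le> 9.87"
proof -
  show 1: "pi \<ge> 3.1415" "pi \<le> 3.1416" using pi_approx by simp_all
  have "pi * pi \<le> 3.1416 * 3.1416" using 1 by (intro mult_mono) auto
  then show "pi\<^sup>2 \<le> 9.87" by (simp add: power2_eq_square)
qed

text \<open>Cutting at y = 1 / (2 pi q (p + q/2)) makes the initial sum contribute ln (1 / q), which
  is half of ln t. A small p makes -ln (2 pi (p + q/2)) large, while stationary blocks and gaps cost
  about 6.3 p; keeping p close to 0.17 is a workable compromise.\<close>

lemma cmod_zeta_le_p_q:
  fixes q :: real and K :: nat
  assumes q: "q > 0" "q \<le> 1/7" and K: "K \<ge> 1" "real K * q \<le> 17/100"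
  defines "p \<equiv> real K * q"
  shows "cmod (zeta (1 + \<i> * of_real (1 / q\<^sup>2))) \<le> ln (1 / q) - ln (2 * pi * (p + q/2)) + 0.57727 +
     5/4 * q + 5/8 * q / real K + 4 * p * q + 2 * q\<^sup>2 + 16/5 * p + 29/10 * p * q\<^sup>2
      + pi * (1 + 8/5 * q) * (p\<^sup>2 + p * q) + (1 - 8/5 * q) * (5/4) * (5/2 * p - 2 * q)
      + (1 - 8/5 * q) * (5/4 * q + 10 * q\<^sup>2) + (pi / 5 + 1) * q\<^sup>2 + pi\<^sup>2 / 150 * (1 + 5/2 * q ^ 4)
      + pi * (p * q + q\<^sup>2 / 2)"
proof -
  define a where "a = 1 / (2 * pi * q\<^sup>2)"
  define y where "y = a / (real K + 1/2)"
  have t: "2 * pi * a = 1 / q\<^sup>2" by (simp add: a_def)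
  have w: "p + q/2 > 0" using q by (intro add_nonneg_pos) (auto simp: p_def)
  have y: "y = 1 / (q * (2 * pi * (p + q/2)))"
  proof -
    have "2 * pi * q\<^sup>2 * (real K + 1/2) = q * (2 * pi * (p + q/2))"
      by (simp add: p_def algebra_simps power2_eq_square)
    then show ?thesis by (simp add: y_def a_def)
  qed
  have "q * (2 * pi * (p + q/2)) \<le> 1/7 * (2 * 4 * (17/100 + 1/14))"
    using q K w pi_less_4 unfolding p_def by (intro mult_mono) auto
  also have "\<dots> \<le> 1" by simp
  finally have "y \<ge> 1" unfolding y using q w by simp
  have "y \<le> a / (1/5)" unfolding y_def using q by (intro divide_left_mono) (auto simp: a_def)
  have "cmod (zeta (1 + \<i> * of_real (2 * pi * a))) \<le>
      cmod (\<Sum>n=1..<nceil y. of_nat n powr (- (1 + \<i> * complex_of_real (2 * pi * a))))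
      + cmod (line_sum (2 * pi * a) y (a / (1/5))) + 1 / (2 * (a / (1/5))) + 1 / (2 * pi * a) + ((2 * pi * a)\<^sup>2 + 5/2) / (24 * (a / (1/5))\<^sup>2)"
    using \<open>y \<ge> 1\<close> \<open>y \<le> a / (1/5)\<close> q by (intro cmod_zeta_le_line_sum) (auto simp: a_def)
  moreover have "cmod (\<Sum>n=1..<nceil y. of_nat n powr (- (1 + \<i> * complex_of_real (2 * pi * a)))) \<le> ln y + euler_mascheroni + 1 / (2 * y)"
    by (rule cmod_sum_powr_le_ln[OF \<open>y \<ge> 1\<close>])
  moreover have "euler_mascheroni \<le> (0.57727::real)"
    using euler_mascheroni_le ln_numeral_bounds(1) by simp
  moreover have "ln y = ln (1 / q) - ln (2 * pi * (p + q/2))"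
    unfolding y using q w ln_divide_pos[of "1/q" "2 * pi * (p + q/2)"] by simp
  moreover have "1 / (2 * y) = pi * (p * q + q\<^sup>2 / 2)"
    unfolding y by (simp add: field_simps power2_eq_square)
  ultimately show ?thesis
    using cmod_line_sum_tail_poly[OF q K] euler_maclaurin_error_poly[OF q(1)]
    unfolding a_def[symmetric] y_def[symmetric] t p_def[symmetric] by linarith
qed


text \<open>This covers t from 50 to about 138 with a single stationary point, K = 1, so that p = q.
  The logarithm and q^2 are bounded by linear functions of q on the interval.\<close>

lemma cmod_zeta_le_half_ln_medium:
  fixes q :: real
  assumes q: "85/1000 \<le> q" "q \<le> 1415/10000"
  shows "cmod (zeta (1 + \<i> * of_real (1 / q\<^sup>2))) \<le> ln (1 / q) + 1.93"
proof -
  have q0: "q > 0" "q \<le> 1/7" "real 1 * q \<le> 17/100" using q by auto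
  have sq: "q\<^sup>2 \<le> 2265/10000 * q - 120275/10000000"
  proof -
    have "(q - 85/1000) * (1415/10000 - q) \<ge> 0" using q by simp
    moreover have "(q - 85/1000) * (1415/10000 - q) = 2265/10000 * q - 120275/10000000 - q\<^sup>2"
      by (simp add: power2_eq_square field_simps)
    ultimately show ?thesis by simp
  qed
  have q4: "q ^ 4 \<le> 1/2000"
  proof -
    have "q ^ 4 \<le> (1415/10000) ^ 4" using q by (intro power_mono) auto
    then show ?thesis by (simp add: power_divide)
  qed
  define w where "w = 3 * pi * q"
  have w: "w > 0" using q by (simp add: w_def)
  have "ln (1 / w) \<le> 1 / w - 1" using w by (intro ln_le_minus_one) auto
  then have lnw: "- ln w \<le> 1 / w - 1" using w by (simp add: ln_div)
  have "3 * 3.1415 * q \<le> w" using q pi_bounds by (simp add: w_def)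
  then have "1 / w \<le> 1 / (3 * 3.1415 * q)" using q w by (intro divide_left_mono) auto
  also have "\<dots> \<le> 125/100 - 88/10 * (q - 85/1000)"
  proof -
    have "3 * 3.1415 * q * (125/100 - 88/10 * (q - 85/1000)) = 3 * 3.1415 * (1998/1000 * q - 88/10 * q\<^sup>2)"
      by (simp add: power2_eq_square algebra_simps)
    also have "\<dots> \<ge> 1" using sq q by simp
    finally show ?thesis using q by (simp add: pos_divide_le_eq mult.commute)
  qed
  finally have 1: "- ln w \<le> 125/100 - 88/10 * (q - 85/1000) - 1" using lnw by linarith
  have pi1: "pi * ((1 + 8/5 * q) * (q\<^sup>2 + q * q)) \<le> 3.1416 * ((1 + 8/5 * q) * (q\<^sup>2 + q * q))"
    using q pi_bounds by (intro mult_right_mono) auto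
  have pi2: "(pi / 5 + 1) * q\<^sup>2 \<le> (3.1416 / 5 + 1) * q\<^sup>2"
    using q pi_bounds by (intro mult_right_mono) auto
  have pi3: "pi\<^sup>2 / 150 * (1 + 5/2 * q ^ 4) \<le> 9.87 / 150 * (1 + 5/2 * (1/2000))"
    using q q4 pi_bounds by (intro mult_mono divide_right_mono add_mono) auto
  have pi4: "pi * (q * q + q\<^sup>2 / 2) \<le> 3.1416 * (q * q + q\<^sup>2 / 2)"
    using q pi_bounds by (intro mult_right_mono) auto
  have "cmod (zeta (1 + \<i> * of_real (1 / q\<^sup>2))) \<le> ln (1 / q) - ln w + 0.57727 +
     5/4 * q + 5/8 * q + 4 * q * q + 2 * q\<^sup>2 + 16/5 * q + 29/10 * q * q\<^sup>2
      + pi * ((1 + 8/5 * q) * (q\<^sup>2 + q * q)) + (1 - 8/5 * q) * (5/4) * (5/2 * q - 2 * q)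
      + (1 - 8/5 * q) * (5/4 * q + 10 * q\<^sup>2) + (pi / 5 + 1) * q\<^sup>2 + pi\<^sup>2 / 150 * (1 + 5/2 * q ^ 4)
      + pi * (q * q + q\<^sup>2 / 2)"
  proof -
    have "2 * pi * (real 1 * q + q / 2) = w" by (simp add: w_def algebra_simps)
    then show ?thesis using cmod_zeta_le_p_q[OF q0(1,2) _ q0(3)] by (simp add: mult.assoc)
  qed
  also have "\<dots> \<le> ln (1 / q) + (125/100 - 88/10 * (q - 85/1000) - 1) + 0.57727 +
     5/4 * q + 5/8 * q + 4 * q * q + 2 * q\<^sup>2 + 16/5 * q + 29/10 * q * q\<^sup>2
      + 3.1416 * ((1 + 8/5 * q) * (q\<^sup>2 + q * q)) + (1 - 8/5 * q) * (5/4) * (5/2 * q - 2 * q)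
      + (1 - 8/5 * q) * (5/4 * q + 10 * q\<^sup>2) + (3.1416 / 5 + 1) * q\<^sup>2 + 9.87 / 150 * (1 + 5/2 * (1/2000))
      + 3.1416 * (q * q + q\<^sup>2 / 2)"
    using 1 pi1 pi2 pi3 pi4 by linarith
  also have "\<dots> \<le> ln (1 / q) + 1.93"
  proof -
    define S T L where "S = q\<^sup>2" and "T = q * q\<^sup>2" and "L = ln (1 / q)"
    have e: "(1 + 8/5 * q) * (q\<^sup>2 + q * q) = 2 * S + 16/5 * T"
      "(1 - 8/5 * q) * (5/4) * (5/2 * q - 2 * q) = 5/8 * q - S"
      "(1 - 8/5 * q) * (5/4 * q + 10 * q\<^sup>2) = 5/4 * q + 8 * S - 16 * T"
      "4 * q * q = 4 * S" "29/10 * q * q\<^sup>2 = 29/10 * T"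
      by (simp_all add: S_def T_def algebra_simps power2_eq_square)
    have qq: "q * q = q\<^sup>2" by (simp add: power2_eq_square)
    have "T \<ge> 0" using q by (simp add: T_def)
    with sq q show ?thesis
      unfolding e unfolding qq unfolding S_def[symmetric] L_def[symmetric] by (simp add: field_simps)
  qed
  finally show ?thesis .
qed


text \<open>K is the largest integer with K q <= 0.17, so p lies within q of 0.17 and p + q/2 in
  [0.127, 0.213]. On that range -ln w lies below a line in p + q/2.\<close>

lemma cmod_zeta_le_half_ln_large:
  fixes q :: real and K :: nat
  assumes K: "K \<ge> 2" "real K * q \<le> 17/100" "17/100 < real K * q + q" and q: "q > 0"
  shows "cmod (zeta (1 + \<i> * of_real (1 / q\<^sup>2))) \<le> ln (1 / q) + 1.93"
proof -
  define p where "p = real K * q"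
  have "2 * q \<le> real K * q" using K q by (intro mult_right_mono) auto
  then have q': "q \<le> 85/1000" "q \<le> 1/7" using K(2) by linarith+
  have p: "p \<le> 17/100" "17/100 - q < p" "p \<ge> 0" using K q by (auto simp: p_def)
  define w where "w = 2 * pi * (p + q / 2)"
  have z: "p + q/2 \<ge> 127/1000" "p + q/2 \<le> 213/1000" using p q' by linarith+
  have w: "w > 0" using z by (simp add: w_def)
  have lnw: "- ln w \<le> 1026/1000 - 6 * (p + q/2)"
  proof -
    define z where "z = p + q/2"
    have "(z - 127/1000) * (213/1000 - z) \<ge> 0" using \<open>p + q/2 \<ge> 127/1000\<close> \<open>p + q/2 \<le> 213/1000\<close> by (simp add: z_def)
    moreover have "(z - 127/1000) * (213/1000 - z) = 34/100 * z - 27051/1000000 - z\<^sup>2"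
      by (simp add: power2_eq_square field_simps)
    ultimately have sq: "z\<^sup>2 \<le> 34/100 * z - 27051/1000000" by simp
    have "6.283 * z * (2026/1000 - 6 * z) = 6.283 * (2026/1000 * z - 6 * z\<^sup>2)"
      by (simp add: power2_eq_square algebra_simps)
    also have "\<dots> \<ge> 1" using sq \<open>p + q/2 \<le> 213/1000\<close> unfolding z_def[symmetric] by simp
    finally have "1 / (6.283 * z) \<le> 2026/1000 - 6 * z"
      using \<open>p + q/2 \<ge> 127/1000\<close> by (simp add: z_def[symmetric] pos_divide_le_eq mult.commute)
    moreover have "6.283 * z \<le> w"
      using \<open>p + q/2 \<ge> 127/1000\<close> pi_bounds unfolding w_def z_def[symmetric] by (intro mult_right_mono) auto
    then have "1 / w \<le> 1 / (6.283 * z)"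
      using \<open>p + q/2 \<ge> 127/1000\<close> w by (intro divide_left_mono) (auto simp: z_def[symmetric])
    moreover have "ln (1 / w) \<le> 1 / w - 1" using w by (intro ln_le_minus_one) auto
    then have "- ln w \<le> 1 / w - 1" using w by (simp add: ln_div)
    ultimately show ?thesis unfolding z_def by linarith
  qed
  have "cmod (zeta (1 + \<i> * of_real (1 / q\<^sup>2))) \<le> ln (1 / q) - ln w + 0.57727 +
     5/4 * q + 5/8 * q / real K + 4 * p * q + 2 * q\<^sup>2 + 16/5 * p + 29/10 * p * q\<^sup>2
      + pi * ((1 + 8/5 * q) * (p\<^sup>2 + p * q)) + (1 - 8/5 * q) * (5/4) * (5/2 * p - 2 * q)
      + (1 - 8/5 * q) * (5/4 * q + 10 * q\<^sup>2) + (pi / 5 + 1) * q\<^sup>2 + pi\<^sup>2 / 150 * (1 + 5/2 * q ^ 4)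
      + pi * (p * q + q\<^sup>2 / 2)"
    using cmod_zeta_le_p_q[OF q q'(2) _ K(2)] K(1) by (simp add: mult.assoc p_def w_def)
  moreover have "5/8 * q / real K \<le> 5/16 * q"
  proof -
    have "5/8 * q / real K \<le> 5/8 * q / 2" using K(1) q by (intro divide_left_mono) auto
    then show ?thesis by simp
  qed
  moreover have "(pi / 5 + 1) * q\<^sup>2 \<le> (3.1416 / 5 + 1) * q\<^sup>2"
    using pi_bounds by (intro mult_right_mono) auto
  moreover have "pi\<^sup>2 / 150 * (1 + 5/2 * q ^ 4) \<le> 9.87 / 150 * (1 + 5/2 * (1/10000))"
  proof -
    have "q ^ 4 \<le> (85/1000) ^ 4" using q q' by (intro power_mono) auto
    then have "q ^ 4 \<le> 1 / 10000" by (simp add: power_divide)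
    then show ?thesis using pi_bounds q by (intro mult_mono divide_right_mono add_mono) auto
  qed
  moreover have "pi * ((1 + 8/5 * q) * (p\<^sup>2 + p * q)) \<le> 3.1416 * ((1 + 8/5 * q) * (17/100 * (p + q)))"
  proof (rule mult_mono)
    have "p * (p + q) \<le> 17/100 * (p + q)" using p q by (intro mult_right_mono) auto
    then have "p\<^sup>2 + p * q \<le> 17/100 * (p + q)" by (simp add: power2_eq_square distrib_left)
    then show "(1 + 8/5 * q) * (p\<^sup>2 + p * q) \<le> (1 + 8/5 * q) * (17/100 * (p + q))"
      using q by (intro mult_left_mono) auto
  qed (use pi_bounds p q in auto)
  moreover have "pi * (p * q + q\<^sup>2 / 2) \<le> 3.1416 * (p * q + q\<^sup>2 / 2)"
    using q p pi_bounds by (intro mult_right_mono) auto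
  moreover have "29/10 * p * q\<^sup>2 \<le> 29/10 * (17/100) * q\<^sup>2"
    using q p by (intro mult_right_mono) auto
  ultimately have "cmod (zeta (1 + \<i> * of_real (1 / q\<^sup>2))) \<le> ln (1 / q) + (1026/1000 - 6 * (p + q/2)) + 0.57727 +
     5/4 * q + 5/16 * q + 4 * p * q + 2 * q\<^sup>2 + 16/5 * p + 29/10 * (17/100) * q\<^sup>2
      + 3.1416 * ((1 + 8/5 * q) * (17/100 * (p + q))) + (1 - 8/5 * q) * (5/4) * (5/2 * p - 2 * q)
      + (1 - 8/5 * q) * (5/4 * q + 10 * q\<^sup>2) + (3.1416 / 5 + 1) * q\<^sup>2 + 9.87 / 150 * (1 + 5/2 * (1/10000))
      + 3.1416 * (p * q + q\<^sup>2 / 2)"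
    using lnw by linarith
  also have "\<dots> \<le> ln (1 / q) + 1.93"
  proof -
    define S T L P where "S = q\<^sup>2" and "T = q * q\<^sup>2" and "L = ln (1 / q)" and "P = p * q"
    have e: "(1 + 8/5 * q) * (17/100 * (p + q)) = 17/100 * (p + q + 8/5 * P + 8/5 * S)"
      "(1 - 8/5 * q) * (5/4) * (5/2 * p - 2 * q) = 25/8 * p - 5/2 * q - 5 * P + 4 * S"
      "(1 - 8/5 * q) * (5/4 * q + 10 * q\<^sup>2) = 5/4 * q + 8 * S - 16 * T"
      "4 * p * q = 4 * P" "p * q = P"
      by (simp_all add: S_def T_def P_def algebra_simps power2_eq_square)
    \<comment> \<open>q^3 occurs only with a negative coefficient. Bounding q^2 and p q by multiples
      of q leaves a linear inequality in p and q.\<close>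
    have "T \<ge> 0" "P \<ge> 0" "S \<ge> 0" using q p by (simp_all add: T_def P_def S_def)
    moreover have "S \<le> 85/1000 * q" using q q' by (simp add: S_def power2_eq_square)
    moreover have "P \<le> 17/100 * q" using q p by (simp add: P_def)
    ultimately show ?thesis
      unfolding e unfolding S_def[symmetric] L_def[symmetric] using p q q' by (simp add: field_simps)
  qed
  finally show ?thesis .
qed

section \<open>Differencing and the higher difference tests\<close>

text \<open>Weyl-van der Corput inequality. The sum, extended by zero, is averaged over
  \<open>q\<close> shifts; Cauchy-Schwarz over the N + q positions gives correlations of pairs of
  shifts. These depend only on the distance of i and j, written with truncated subtraction as
  \<open>(i - j) + (j - i)\<close>.\<close>

lemma van_der_corput:
  fixes z :: "nat \<Rightarrow> complex" and G :: "nat \<Rightarrow> real"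
  assumes G: "\<And>r. r < q \<Longrightarrow> cmod (\<Sum>n<N - r. z (n + r) * cnj (z n)) \<le> G r"
  shows "(real q * cmod (\<Sum>n<N. z n))\<^sup>2 \<le> real (N + q) * (\<Sum>i<q. \<Sum>j<q. G ((i - j) + (j - i)))"
proof -
  define Z where "Z = (\<lambda>m j. if j \<le> m \<and> m - j < N then z (m - j) else 0)"
  define W where "W = (\<lambda>m. \<Sum>j<q. Z m j)"
  have Zsum: "(\<Sum>m<N + q. Z m j) = (\<Sum>n<N. z n)" if "j < q" for j
  proof -
    have "(\<Sum>n<N. z n) = (\<Sum>m\<in>{j..<j + N}. Z m j)"
      by (rule sum.reindex_bij_witness[of _ "\<lambda>m. m - j" "\<lambda>n. n + j"]) (auto simp: Z_def)
    also have "\<dots> = (\<Sum>m<N + q. Z m j)"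
      using that by (intro sum.mono_neutral_left) (auto simp: Z_def)
    finally show ?thesis by simp
  qed
  have corr: "cmod (\<Sum>m<N + q. Z m i * cnj (Z m j)) \<le> G (j - i)" if "i \<le> j" "j < q" for i j
  proof -
    have "(\<Sum>n<N - (j - i). z (n + (j - i)) * cnj (z n)) = (\<Sum>m\<in>{j..<N + i}. Z m i * cnj (Z m j))"
      using that by (intro sum.reindex_bij_witness[of _ "\<lambda>m. m - j" "\<lambda>n. n + j"]) (auto simp: Z_def)
    also have "\<dots> = (\<Sum>m<N + q. Z m i * cnj (Z m j))"
      using that by (intro sum.mono_neutral_left) (auto simp: Z_def)
    finally show ?thesis using G[of "j - i"] that by simp
  qed
  have corr': "cmod (\<Sum>m<N + q. Z m i * cnj (Z m j)) \<le> G ((i - j) + (j - i))" if "i < q" "j < q" for i j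
  proof (cases "i \<le> j")
    case True
    then show ?thesis using corr[of i j] that by simp
  next
    case False
    have "cmod (\<Sum>m<N + q. Z m i * cnj (Z m j)) = cmod (\<Sum>m<N + q. Z m j * cnj (Z m i))"
      by (subst complex_mod_cnj[symmetric]) (simp add: mult.commute)
    then show ?thesis using corr[of j i] False that by simp
  qed
  have "of_nat q * (\<Sum>n<N. z n) = (\<Sum>j<q. \<Sum>m<N + q. Z m j)" using Zsum by simp
  also have "\<dots> = (\<Sum>m<N + q. W m)" unfolding W_def by (rule sum.swap)
  finally have "real q * cmod (\<Sum>n<N. z n) = cmod (\<Sum>m<N + q. W m)"
    by (metis norm_mult norm_of_nat)
  also have "\<dots> \<le> (\<Sum>m<N + q. cmod (W m))" by (rule norm_sum)
  finally have "(real q * cmod (\<Sum>n<N. z n))\<^sup>2 \<le> (\<Sum>m<N + q. cmod (W m))\<^sup>2"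
    by (rule power_mono) auto
  also have "\<dots> \<le> (\<Sum>m<N + q. (cmod (W m))\<^sup>2) * real (card {..<N + q})"
    by (rule sum_squared_le_sum_of_squares)
  also have "\<dots> = real (N + q) * (\<Sum>m<N + q. (cmod (W m))\<^sup>2)" by simp
  finally have fin: "(real q * cmod (\<Sum>n<N. z n))\<^sup>2 \<le> real (N + q) * (\<Sum>m<N + q. (cmod (W m))\<^sup>2)" .
  have "(\<Sum>m<N + q. (cmod (W m))\<^sup>2) \<le> (\<Sum>i<q. \<Sum>j<q. G ((i - j) + (j - i)))"
  proof -
    have "complex_of_real (\<Sum>m<N + q. (cmod (W m))\<^sup>2) = (\<Sum>m<N + q. W m * cnj (W m))"
      by (simp only: of_real_sum complex_norm_square)
    also have "\<dots> = (\<Sum>m<N + q. \<Sum>i<q. \<Sum>j<q. Z m i * cnj (Z m j))"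
      by (simp only: W_def cnj_sum sum_product)
    also have "\<dots> = (\<Sum>i<q. \<Sum>m<N + q. \<Sum>j<q. Z m i * cnj (Z m j))" by (rule sum.swap)
    also have "\<dots> = (\<Sum>i<q. \<Sum>j<q. \<Sum>m<N + q. Z m i * cnj (Z m j))"
      by (intro sum.cong refl sum.swap)
    finally have e: "complex_of_real (\<Sum>m<N + q. (cmod (W m))\<^sup>2) = (\<Sum>i<q. \<Sum>j<q. \<Sum>m<N + q. Z m i * cnj (Z m j))" .
    have "(\<Sum>m<N + q. (cmod (W m))\<^sup>2) = cmod (complex_of_real (\<Sum>m<N + q. (cmod (W m))\<^sup>2))"
      by (simp only: norm_of_real) (simp add: sum_nonneg)
    also have "\<dots> \<le> (\<Sum>i<q. \<Sum>j<q. G ((i - j) + (j - i)))"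
      unfolding e by (intro sum_norm_le corr') auto
    finally show ?thesis .
  qed
  then have "real (N + q) * (\<Sum>m<N + q. (cmod (W m))\<^sup>2) \<le> real (N + q) * (\<Sum>i<q. \<Sum>j<q. G ((i - j) + (j - i)))"
    by (rule mult_left_mono) simp
  with fin show ?thesis by (rule order_trans)
qed

section \<open>Finite differences of the phase\<close>

fun fdiff :: "nat \<Rightarrow> (nat \<Rightarrow> real) \<Rightarrow> nat \<Rightarrow> real" where
  "fdiff 0 f n = f n"
| "fdiff (Suc k) f n = fdiff k (\<lambda>m. f (Suc m) - f m) n"

lemma fdiff_shift: "fdiff k (\<lambda>m. f (m + i)) n = fdiff k f (n + i)"
  by (induction k arbitrary: f) simp_all

lemma fdiff_sum: "fdiff k (\<lambda>m. \<Sum>i\<in>I. g i m) n = (\<Sum>i\<in>I. fdiff k (g i) n)"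
  by (induction k arbitrary: g) (simp_all add: sum_subtractf[symmetric])

text \<open>A difference with lag \<open>r\<close> is a sum of \<open>r\<close> unit differences.
  Hence differencing multiplies both the lower and the upper bound for the next order by
  \<open>r\<close> and preserves their ratio.\<close>

lemma fdiff_long_difference: "fdiff k (\<lambda>m. f (m + r) - f m) n = (\<Sum>i<r. fdiff (Suc k) f (n + i))"
proof -
  have "(\<lambda>m. f (m + r) - f m) = (\<lambda>m. \<Sum>i<r. f (Suc (m + i)) - f (m + i))"
  proof
    show "f (m + r) - f m = (\<Sum>i<r. f (Suc (m + i)) - f (m + i))" for m
      using sum_lessThan_telescope[of "\<lambda>i. f (m + i)" r] by simp
  qed
  then have "fdiff k (\<lambda>m. f (m + r) - f m) n = fdiff k (\<lambda>m. \<Sum>i<r. f (Suc (m + i)) - f (m + i)) n"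
    by simp
  also have "\<dots> = (\<Sum>i<r. fdiff k (\<lambda>m. f (Suc (m + i)) - f (m + i)) n)" by (rule fdiff_sum)
  also have "\<dots> = (\<Sum>i<r. fdiff (Suc k) f (n + i))"
    using fdiff_shift[of k "\<lambda>m. f (Suc m) - f m"] by simp
  finally show ?thesis .
qed

text \<open>Iterated mean value theorem: F (y + 1) - F y has its own chain of derivatives, one
  shorter, to which the induction hypothesis applies.\<close>

lemma fdiff_smooth_bounds:
  fixes F :: "nat \<Rightarrow> real \<Rightarrow> real"
  assumes "\<And>i y. i < k \<Longrightarrow> y > 0 \<Longrightarrow> (F i has_real_derivative F (Suc i) y) (at y)"
    and "x > 0" and "\<And>y. x + real n \<le> y \<Longrightarrow> y \<le> x + real n + real k \<Longrightarrow> L \<le> F k y \<and> F k y \<le> U"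
  shows "L \<le> fdiff k (\<lambda>m. F 0 (x + real m)) n \<and> fdiff k (\<lambda>m. F 0 (x + real m)) n \<le> U"
  using assms
proof (induction k arbitrary: F)
  case 0
  then show ?case by simp
next
  case (Suc k)
  define G where "G = (\<lambda>i y. F i (y + 1) - F i y)"
  have G: "(G i has_real_derivative G (Suc i) y) (at y)" if "i < k" "y > 0" for i y
  proof -
    have "((\<lambda>y. F i (y + 1)) has_real_derivative F (Suc i) (y + 1)) (at y)"
      using Suc.prems(1)[of i "y + 1"] that by (simp add: DERIV_shift)
    then show ?thesis
      unfolding G_def using Suc.prems(1)[of i y] that by (intro DERIV_diff) auto
  qed
  have "L \<le> G k y \<and> G k y \<le> U" if y: "x + real n \<le> y" "y \<le> x + real n + real k" for y
  proof -
    have y0: "y > 0" using y Suc.prems(2) by linarith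
    obtain \<xi> where "y < \<xi>" "\<xi> < y + 1" "F k (y + 1) - F k y = (y + 1 - y) * F (Suc k) \<xi>"
      using MVT2[of y "y + 1" "F k" "F (Suc k)"] Suc.prems(1)[of k] y0 by auto
    then show ?thesis using Suc.prems(3)[of \<xi>] y by (simp add: G_def)
  qed
  from Suc.IH[OF G Suc.prems(2) this]
  show ?case by (simp add: G_def add_ac)
qed

text \<open>Comparison with the integral. The summand r = 0 vanishes because \<open>0 powr x\<close>
  is 0.\<close>

lemma sum_powr_le:
  fixes \<kappa> :: real
  assumes \<kappa>: "0 < \<kappa>" "\<kappa> < 1"
  shows "(\<Sum>r<Suc q. real r powr (- \<kappa>)) \<le> real q powr (1 - \<kappa>) / (1 - \<kappa>)"
proof (induction q)
  case 0
  then show ?case by simp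
next
  case (Suc q)
  have "real (Suc q) powr (- \<kappa>) \<le> (real (Suc q) powr (1 - \<kappa>) - real q powr (1 - \<kappa>)) / (1 - \<kappa>)"
  proof (cases "q = 0")
    case True
    then show ?thesis using \<kappa> by simp
  next
    case False
    then have q: "real q > 0" by simp
    have "((\<lambda>x. x powr (1 - \<kappa>)) has_real_derivative (1 - \<kappa>) * x powr (- \<kappa>)) (at x)" if "x > 0" for x
      using has_real_derivative_powr[OF that, of "1 - \<kappa>"] by simp
    then obtain \<xi> where \<xi>: "real q < \<xi>" "\<xi> < real q + 1"
      "(real q + 1) powr (1 - \<kappa>) - real q powr (1 - \<kappa>) = (real q + 1 - real q) * ((1 - \<kappa>) * \<xi> powr (- \<kappa>))"
      using MVT2[of "real q" "real q + 1" "\<lambda>x. x powr (1 - \<kappa>)" "\<lambda>x. (1 - \<kappa>) * x powr (- \<kappa>)"] q by auto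
    have "(real q + 1) powr (- \<kappa>) \<le> \<xi> powr (- \<kappa>)"
      using \<xi> q \<kappa> by (intro powr_mono2') auto
    then show ?thesis using \<xi>(3) \<kappa> by (simp add: add.commute)
  qed
  with Suc.IH show ?case by (simp add: diff_divide_distrib)
qed


text \<open>A difference test of order \<open>k\<close> as a predicate of its exponents and
  constants, so that one Weyl step maps test to test. The ratio \<open>h\<close> of the two bounds
  stays fixed during differencing while \<open>l\<close> is rescaled by the lag. The condition
  \<open>n + k < N\<close> says that the difference at n uses only values of f inside the
  sum.\<close>

definition diff_test :: "nat \<Rightarrow> real \<Rightarrow> real \<Rightarrow> real \<Rightarrow> real \<Rightarrow> real \<Rightarrow> bool" where
  "diff_test k h \<kappa> \<sigma> \<alpha> \<beta> \<longleftrightarrow> (\<forall>f N l. l > 0 \<longrightarrow>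
     (\<forall>n. n + k < N \<longrightarrow> l \<le> fdiff k f n \<and> fdiff k f n \<le> h * l) \<longrightarrow>
     cmod (\<Sum>n<N. cis (2 * pi * f n))
       \<le> \<alpha> * real N * l powr \<kappa> + \<beta> * real N powr (1 - \<sigma>) * l powr (- \<kappa>))"

text \<open>For fixed i each positive distance occurs at most twice, hence twice the bound of
  \<open>sum_powr_le\<close>.\<close>

lemma sum_dist_powr_le:
  fixes \<kappa> :: real
  assumes \<kappa>: "0 < \<kappa>" "\<kappa> < 1"
  shows "(\<Sum>i<q. \<Sum>j<q. real ((i - j) + (j - i)) powr (- \<kappa>)) \<le> real q * (2 * real q powr (1 - \<kappa>) / (1 - \<kappa>))"
proof -
  have *: "(\<Sum>j<q. real ((i - j) + (j - i)) powr (- \<kappa>)) \<le> 2 * real q powr (1 - \<kappa>) / (1 - \<kappa>)" if i: "i < q" for i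
  proof -
    have S: "(\<Sum>r<Suc m. real r powr (- \<kappa>)) \<le> real q powr (1 - \<kappa>) / (1 - \<kappa>)" if "m \<le> q" for m
      using sum_powr_le[OF \<kappa>, of m] that \<kappa>
      by (elim order_trans) (auto intro!: divide_right_mono powr_mono2)
    have "(\<Sum>j<q. real ((i - j) + (j - i)) powr (- \<kappa>)) =
        (\<Sum>j\<in>{..<i}. real ((i - j) + (j - i)) powr (- \<kappa>)) + (\<Sum>j\<in>{i..<q}. real ((i - j) + (j - i)) powr (- \<kappa>))"
      using i by (subst sum.union_disjoint[symmetric]) (auto intro!: sum.cong)
    also have "(\<Sum>j\<in>{i..<q}. real ((i - j) + (j - i)) powr (- \<kappa>)) = (\<Sum>r<q - i. real r powr (- \<kappa>))"
      by (rule sum.reindex_bij_witness[of _ "\<lambda>r. r + i" "\<lambda>j. j - i"]) auto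
    also have "\<dots> \<le> (\<Sum>r<Suc q. real r powr (- \<kappa>))" by (rule sum_mono2) auto
    also have "\<dots> \<le> real q powr (1 - \<kappa>) / (1 - \<kappa>)" by (rule S) simp
    also have "(\<Sum>j\<in>{..<i}. real ((i - j) + (j - i)) powr (- \<kappa>)) = (\<Sum>r\<in>{1..i}. real r powr (- \<kappa>))"
      by (rule sum.reindex_bij_witness[of _ "\<lambda>r. i - r" "\<lambda>j. i - j"]) auto
    also have "\<dots> \<le> (\<Sum>r<Suc q. real r powr (- \<kappa>))" using i by (intro sum_mono2) auto
    also have "\<dots> \<le> real q powr (1 - \<kappa>) / (1 - \<kappa>)" by (rule S) simp
    finally show ?thesis by simp
  qed
  have "(\<Sum>i<q. \<Sum>j<q. real ((i - j) + (j - i)) powr (- \<kappa>)) \<le> (\<Sum>i<q. 2 * real q powr (1 - \<kappa>) / (1 - \<kappa>))"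
    by (intro sum_mono *) auto
  then show ?thesis by simp
qed

text \<open>
  The differencing length \<open>q\<close> is about \<open>l powr (- 2 \<kappa>')\<close>, which balances the diagonal
  contribution \<open>N^2 / q\<close> against \<open>N^2 (q l)^\<kappa>\<close>. If this exceeds \<open>N / 8\<close>, the second term of the
  claimed bound is already trivial because \<open>\<beta>'\<^sup>2 \<ge> 8\<close>.
\<close>
lemma diff_test_Suc:
  fixes h \<kappa> \<sigma> \<alpha> \<beta> \<alpha>' \<beta>' :: real
  assumes test: "diff_test k h \<kappa> \<sigma> \<alpha> \<beta>"
    and \<kappa>: "0 < \<kappa>" "\<kappa> < 1" and \<sigma>: "0 \<le> \<sigma>" "\<sigma> \<le> 1" and nn: "\<alpha> \<ge> 0" "\<beta> \<ge> 0"
    and \<kappa>': "\<kappa>' = \<kappa> / (2 * (1 + \<kappa>))"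
    and \<alpha>': "\<alpha>' \<ge> 1" "5/4 * (1 + 2 powr \<kappa> * \<alpha>) \<le> \<alpha>'\<^sup>2"
    and \<beta>': "\<beta>' \<ge> 0" "\<beta>'\<^sup>2 \<ge> 8" "5/2 * \<beta> / (1 - \<kappa>) \<le> \<beta>'\<^sup>2"
  shows "diff_test (Suc k) h \<kappa>' (\<sigma> / 2) \<alpha>' \<beta>'"
  unfolding diff_test_def
proof (intro allI impI)
  fix f :: "nat \<Rightarrow> real" and N :: nat and l :: real
  assume l: "l > 0" and D: "\<forall>n. n + Suc k < N \<longrightarrow> l \<le> fdiff (Suc k) f n \<and> fdiff (Suc k) f n \<le> h * l"
  define S where "S = cmod (\<Sum>n<N. cis (2 * pi * f n))"
  define A where "A = \<alpha>' * real N * l powr \<kappa>'"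
  define B where "B = \<beta>' * real N powr (1 - \<sigma>/2) * l powr (- \<kappa>')"
  have AB: "A \<ge> 0" "B \<ge> 0" using \<alpha>' \<beta>' by (auto simp: A_def B_def)
  have SN: "S \<le> real N"
    unfolding S_def using norm_sum[of "\<lambda>n. cis (2 * pi * f n)" "{..<N}"] by simp
  have \<kappa>'0: "\<kappa>' > 0" using \<kappa> by (simp add: \<kappa>')
  \<comment> \<open>The balance that determines \<open>\<kappa>'\<close>: it says that (q0 l) powr
    \<open>\<kappa>\<close> equals 1 / q0.\<close>
  have \<kappa>'e: "(1 - 2 * \<kappa>') * \<kappa> = 2 * \<kappa>'" using \<kappa> by (simp add: \<kappa>' field_simps)
  define q0 where "q0 = l powr (- 2 * \<kappa>')"
  have q00: "q0 > 0" using l by (simp add: q0_def)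
  have A2: "A\<^sup>2 = \<alpha>'\<^sup>2 * (real N)\<^sup>2 / q0"
  proof -
    have "(l powr \<kappa>')\<^sup>2 = 1 / q0" using l by (simp add: q0_def powr_minus power2_eq_square powr_add[symmetric] divide_inverse)
    then show ?thesis by (simp add: A_def power_mult_distrib)
  qed
  have B2: "B\<^sup>2 = \<beta>'\<^sup>2 * real N powr (2 - \<sigma>) * q0"
  proof -
    have "(l powr (- \<kappa>'))\<^sup>2 = q0" using l by (simp add: q0_def power2_eq_square powr_add[symmetric])
    moreover have "(real N powr (1 - \<sigma>/2))\<^sup>2 = real N powr (2 - \<sigma>)"
      by (simp add: power2_eq_square powr_add[symmetric])
    ultimately show ?thesis by (simp add: B_def power_mult_distrib)
  qed
  have "S \<le> A + B"
  proof (cases "N = 0 \<or> l \<ge> 1 \<or> real N \<le> 8 * q0")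
    case True
    then consider "N = 0" | "l \<ge> 1" | "N > 0" "real N \<le> 8 * q0" by blast
    then show ?thesis
    proof cases
      case 1
      then show ?thesis using SN AB by simp
    next
      case 2
      have "1 * 1 \<le> \<alpha>' * l powr \<kappa>'" using 2 \<alpha>' \<kappa>'0 by (intro mult_mono ge_one_powr_ge_zero) auto
      then have "real N \<le> A" using mult_left_mono[of 1 "\<alpha>' * l powr \<kappa>'" "real N"] by (simp add: A_def mult_ac)
      then show ?thesis using SN AB by simp
    next
      case 3
      have "(real N)\<^sup>2 = real N * real N" by (simp add: power2_eq_square)
      also have "\<dots> \<le> real N powr (2 - \<sigma>) * (8 * q0)"
      proof (rule mult_mono)
        have "real N powr 1 \<le> real N powr (2 - \<sigma>)" using 3 \<sigma> by (intro powr_mono) auto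
        then show "real N \<le> real N powr (2 - \<sigma>)" using 3 by simp
      qed (use 3 in auto)
      also have "\<dots> \<le> B\<^sup>2"
      proof -
        have "8 * (real N powr (2 - \<sigma>) * q0) \<le> \<beta>'\<^sup>2 * (real N powr (2 - \<sigma>) * q0)"
          using \<beta>' q00 by (intro mult_right_mono) auto
        then show ?thesis by (simp add: B2 mult_ac)
      qed
      finally have "real N \<le> B" using AB(2) by (rule power2_le_imp_le)
      then show ?thesis using SN AB by simp
    qed
  next
    case False
    then have N: "real N > 0" and l1: "l < 1" and Nq: "8 * q0 < real N" by auto
    have q01: "q0 \<ge> 1"
      using l l1 \<kappa>'0 by (simp add: q0_def powr_minus one_le_inverse_iff powr_le1)
    define q where "q = nceil q0"
    have q: "q0 \<le> real q" "real q \<le> 2 * q0" "q > 0"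
      using le_real_nceil[of q0] real_nceil_less[of q0] q01 nceil_pos[OF q00] by (auto simp: q_def)
    define P where "P = \<alpha> * real N * (real q * l) powr \<kappa>"
    define Q where "Q = \<beta> * real N powr (1 - \<sigma>) * l powr (- \<kappa>)"
    have PQ: "P \<ge> 0" "Q \<ge> 0" using nn by (auto simp: P_def Q_def)
    \<comment> \<open>At r = 0 the last summand is 0 by the convention for \<open>0 powr x\<close>,
      and the trivial bound N covers the diagonal.\<close>
    define G where "G = (\<lambda>r::nat. (if r = 0 then real N else 0) + P + Q * real r powr (- \<kappa>))"
    have G: "cmod (\<Sum>n<N - r. cis (2 * pi * f (n + r)) * cnj (cis (2 * pi * f n))) \<le> G r" if r: "r < q" for r
    proof (cases "r = 0")
      case True
      have "cmod (\<Sum>n<N. cis (2 * pi * f n) * cnj (cis (2 * pi * f n))) \<le> (\<Sum>n<N. 1)"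
        by (intro sum_norm_le) (simp add: norm_mult)
      then show ?thesis using True PQ by (simp add: G_def)
    next
      case False
      define g where "g = (\<lambda>n. f (n + r) - f n)"
      have "cis (2 * pi * f (n + r)) * cnj (cis (2 * pi * f n)) = cis (2 * pi * g n)" for n
        by (simp add: cis_cnj cis_mult g_def right_diff_distrib)
      then have "cmod (\<Sum>n<N - r. cis (2 * pi * f (n + r)) * cnj (cis (2 * pi * f n))) = cmod (\<Sum>n<N - r. cis (2 * pi * g n))"
        by simp
      also have "\<dots> \<le> \<alpha> * real (N - r) * (real r * l) powr \<kappa> + \<beta> * real (N - r) powr (1 - \<sigma>) * (real r * l) powr (- \<kappa>)"
      proof -
        have "real r * l \<le> fdiff k g n \<and> fdiff k g n \<le> h * (real r * l)" if n: "n + k < N - r" for n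
        proof -
          have e: "fdiff k g n = (\<Sum>i<r. fdiff (Suc k) f (n + i))"
            unfolding g_def by (rule fdiff_long_difference)
          have b: "l \<le> fdiff (Suc k) f (n + i)" "fdiff (Suc k) f (n + i) \<le> h * l" if "i < r" for i
            using D[rule_format, of "n + i"] that n by auto
          have "(\<Sum>i<r. l) \<le> fdiff k g n" unfolding e by (rule sum_mono) (use b in auto)
          moreover have "fdiff k g n \<le> (\<Sum>i<r. h * l)" unfolding e by (rule sum_mono) (use b in auto)
          ultimately show ?thesis by (simp add: mult_ac)
        qed
        then show ?thesis using test l False unfolding diff_test_def by simp
      qed
      also have "\<dots> \<le> P + Q * real r powr (- \<kappa>)"
      proof (rule add_mono)
        show "\<alpha> * real (N - r) * (real r * l) powr \<kappa> \<le> P"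
          unfolding P_def using nn l r \<kappa> by (intro mult_mono powr_mono2) auto
        have "\<beta> * real (N - r) powr (1 - \<sigma>) * (real r * l) powr (- \<kappa>) \<le> \<beta> * real N powr (1 - \<sigma>) * (real r * l) powr (- \<kappa>)"
          using nn \<sigma> by (intro mult_right_mono mult_left_mono powr_mono2) auto
        then show "\<beta> * real (N - r) powr (1 - \<sigma>) * (real r * l) powr (- \<kappa>) \<le> Q * real r powr (- \<kappa>)"
          using l by (simp add: Q_def powr_mult mult_ac)
      qed
      finally show ?thesis using False by (simp add: G_def)
    qed
    define X where "X = real q * real N + (real q)\<^sup>2 * P + Q * (real q * (2 * real q powr (1 - \<kappa>) / (1 - \<kappa>)))"
    have X0: "X \<ge> 0" using PQ \<kappa> by (auto simp: X_def intro!: add_nonneg_nonneg mult_nonneg_nonneg)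
    have "(\<Sum>i<q. \<Sum>j<q. G ((i - j) + (j - i))) =
        (\<Sum>i<q. \<Sum>j<q. if i = j then real N else 0) + (\<Sum>i<q. \<Sum>j<q. P) + Q * (\<Sum>i<q. \<Sum>j<q. real ((i - j) + (j - i)) powr (- \<kappa>))"
      unfolding G_def sum.distrib sum_distrib_left
      by (intro arg_cong2[of _ _ _ _ "(+)"] sum.cong refl) auto
    also have "\<dots> \<le> X"
      using PQ unfolding X_def by (intro add_mono mult_left_mono sum_dist_powr_le \<kappa>) (auto simp: power2_eq_square)
    finally have GX: "(\<Sum>i<q. \<Sum>j<q. G ((i - j) + (j - i))) \<le> X" .
    have "(real q * S)\<^sup>2 \<le> real (N + q) * (\<Sum>i<q. \<Sum>j<q. G ((i - j) + (j - i)))"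
      unfolding S_def by (rule van_der_corput) (rule G)
    also have "\<dots> \<le> real (N + q) * X" using GX by (rule mult_left_mono) simp
    \<comment> \<open>q <= 2 q0 and 8 q0 < N give q < N / 4.\<close>
    also have "\<dots> \<le> 5/4 * real N * X" using q Nq X0 by (intro mult_right_mono) auto
    finally have "(real q * S)\<^sup>2 \<le> 5/4 * real N * (real q * real N + (real q)\<^sup>2 * P + Q * (real q * (2 * real q powr (1 - \<kappa>) / (1 - \<kappa>))))"
      by (simp only: X_def)
    also have "\<dots> = (real q)\<^sup>2 * (5/4 * ((real N)\<^sup>2 / real q + real N * P + 2 / (1 - \<kappa>) * (real N * Q * real q powr (- \<kappa>))))"
    proof -
      have "real q powr (1 - \<kappa>) = real q * real q powr (- \<kappa>)"
        using q by (simp add: powr_diff powr_minus divide_inverse)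
      then show ?thesis using q(3) \<kappa> by (simp add: field_simps power2_eq_square)
    qed
    finally have S2: "S\<^sup>2 \<le> 5/4 * ((real N)\<^sup>2 / real q + real N * P + 2 / (1 - \<kappa>) * (real N * Q * real q powr (- \<kappa>)))"
      using q(3) by (simp add: power_mult_distrib)
    have t1: "(real N)\<^sup>2 / real q \<le> (real N)\<^sup>2 / q0" using q q00 by (intro divide_left_mono) auto
    have q0l: "q0 * l = l powr (1 - 2 * \<kappa>')" using l by (simp add: q0_def powr_diff powr_minus field_simps)
    have q0lk: "(q0 * l) powr \<kappa> = 1 / q0" "(q0 * l) powr (- \<kappa>) = q0"
    proof -
      have "(q0 * l) powr \<kappa> = l powr (2 * \<kappa>')" unfolding q0l using \<kappa>'e by (simp add: powr_powr)
      then show "(q0 * l) powr \<kappa> = 1 / q0" using l by (simp add: q0_def powr_minus divide_inverse)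
      then show "(q0 * l) powr (- \<kappa>) = q0" by (simp add: powr_minus)
    qed
    have t2: "real N * P \<le> (2 powr \<kappa> * \<alpha>) * ((real N)\<^sup>2 / q0)"
    proof -
      have "(real q * l) powr \<kappa> \<le> (2 * (q0 * l)) powr \<kappa>"
        using q l \<kappa> by (intro powr_mono2) auto
      also have "\<dots> = 2 powr \<kappa> * (1 / q0)" using q00 l by (subst powr_mult) (auto simp: q0lk)
      finally have "real N * (\<alpha> * real N) * (real q * l) powr \<kappa> \<le> real N * (\<alpha> * real N) * (2 powr \<kappa> * (1 / q0))"
        using nn by (intro mult_left_mono) auto
      then show ?thesis by (simp add: P_def power2_eq_square mult_ac)
    qed
    have t3: "real N * Q * real q powr (- \<kappa>) \<le> \<beta> * (real N powr (2 - \<sigma>) * q0)"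
    proof -
      have "real q powr (- \<kappa>) * l powr (- \<kappa>) = (real q * l) powr (- \<kappa>)" by (simp add: powr_mult l less_imp_le)
      also have "\<dots> \<le> (q0 * l) powr (- \<kappa>)" using q q00 l \<kappa> by (intro powr_mono2') auto
      also have "\<dots> = q0" by (rule q0lk)
      finally have "\<beta> * (real N * real N powr (1 - \<sigma>)) * (real q powr (- \<kappa>) * l powr (- \<kappa>)) \<le> \<beta> * (real N * real N powr (1 - \<sigma>)) * q0"
        using nn by (intro mult_left_mono) auto
      moreover have "real N * real N powr (1 - \<sigma>) = real N powr (2 - \<sigma>)"
        using N powr_add[of "real N" 1 "1 - \<sigma>"] by simp
      moreover have "real N * Q * real q powr (- \<kappa>) = \<beta> * (real N * real N powr (1 - \<sigma>)) * (real q powr (- \<kappa>) * l powr (- \<kappa>))"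
        by (simp only: Q_def mult_ac)
      ultimately show ?thesis by (simp only: mult_ac)
    qed
    have "S\<^sup>2 \<le> 5/4 * ((real N)\<^sup>2 / q0 + (2 powr \<kappa> * \<alpha>) * ((real N)\<^sup>2 / q0) + 2 / (1 - \<kappa>) * (\<beta> * (real N powr (2 - \<sigma>) * q0)))"
    proof -
      have t3': "2 / (1 - \<kappa>) * (real N * Q * real q powr (- \<kappa>)) \<le> 2 / (1 - \<kappa>) * (\<beta> * (real N powr (2 - \<sigma>) * q0))"
        using t3 \<kappa> by (intro mult_left_mono) auto
      show ?thesis by (rule order_trans[OF S2], rule mult_left_mono[OF add_mono[OF add_mono[OF t1 t2] t3']]) simp
    qed
    also have "\<dots> = 5/4 * (1 + 2 powr \<kappa> * \<alpha>) * ((real N)\<^sup>2 / q0) + 5/2 * \<beta> / (1 - \<kappa>) * (real N powr (2 - \<sigma>) * q0)"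
      using \<kappa> q00 by (simp add: field_simps)
    also have "\<dots> \<le> \<alpha>'\<^sup>2 * ((real N)\<^sup>2 / q0) + \<beta>'\<^sup>2 * (real N powr (2 - \<sigma>) * q0)"
      using \<alpha>' \<beta>' q00 by (intro add_mono mult_right_mono) auto
    also have "\<dots> = A\<^sup>2 + B\<^sup>2" by (simp add: A2 B2 mult_ac)
    also have "\<dots> \<le> (A + B)\<^sup>2" using AB by (simp add: power2_sum)
    finally show ?thesis by (rule power2_le_imp_le) (use AB in simp)
  qed
  then show "cmod (\<Sum>n<N. cis (2 * pi * f n)) \<le> \<alpha>' * real N * l powr \<kappa>' + \<beta>' * real N powr (1 - \<sigma>/2) * l powr (- \<kappa>')"
    by (simp add: S_def A_def B_def)
qed


section \<open>The second difference test\<close>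

lemma convex_nat_set_is_interval:
  fixes J :: "nat set"
  assumes "finite J" "\<And>x y z. x \<in> J \<Longrightarrow> y \<in> J \<Longrightarrow> x \<le> z \<Longrightarrow> z \<le> y \<Longrightarrow> z \<in> J"
  shows "\<exists>A B. J = {A..<B}"
proof (cases "J = {}")
  case True
  then show ?thesis by (intro exI[of _ 0]) simp
next
  case False
  then have "J = {Min J..<Suc (Max J)}"
    using Min_le[OF assms(1)] Max_ge[OF assms(1)]
      assms(2)[OF Min_in[OF assms(1) False] Max_in[OF assms(1) False]] by (auto simp: less_Suc_eq_le)
  then show ?thesis by blast
qed

text \<open>Version for level sets of monotone increments, which are intervals whose endpoints are
  not known explicitly.\<close>

lemma kusmin_landau_set:
  fixes f :: "nat \<Rightarrow> real" and k :: int
  assumes J: "finite J" "\<And>x y z. x \<in> J \<Longrightarrow> y \<in> J \<Longrightarrow> x \<le> z \<Longrightarrow> z \<le> y \<Longrightarrow> z \<in> J"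
    and d: "d1 > 0" "d2 > 0" "d1 + d2 \<le> 1"
    and mono: "\<And>n. n \<in> J \<Longrightarrow> Suc n \<in> J \<Longrightarrow> f (n + 1) - f n \<le> f (n + 2) - f (n + 1)"
    and range: "\<And>n. n \<in> J \<Longrightarrow> of_int k + d1 \<le> f (n + 1) - f n \<and> f (n + 1) - f n \<le> of_int k + 1 - d2"
  shows "cmod (\<Sum>n\<in>J. cis (2 * pi * f n)) \<le> (1 / d1 + 1 / d2) / pi"
proof -
  have "\<exists>A B. J = {A..<B}" by (rule convex_nat_set_is_interval) (fact J)+
  then obtain A B where AB: "J = {A..<B}" by blast
  define g where "g = (\<lambda>n. f (A + n))"
  have "(\<Sum>n\<in>J. cis (2 * pi * f n)) = (\<Sum>n<B - A. cis (2 * pi * g n))"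
    unfolding AB g_def by (rule sum.reindex_bij_witness[of _ "\<lambda>n. A + n" "\<lambda>n. n - A"]) auto
  also have "cmod \<dots> \<le> (1 / d1 + 1 / d2) / pi"
  proof (rule kusmin_landau[OF d])
    fix n assume "n + 2 < B - A"
    then have "A + n \<in> J" "Suc (A + n) \<in> J" by (auto simp: AB)
    from mono[OF this] show "g (n + 1) - g n \<le> g (n + 2) - g (n + 1)" by (simp add: g_def)
  next
    fix n assume "n + 1 < B - A"
    then have "A + n \<in> J" by (auto simp: AB)
    from range[OF this] show "of_int k + d1 \<le> g (n + 1) - g n \<and> g (n + 1) - g n \<le> of_int k + 1 - d2"
      by (simp add: g_def)
  qed
  finally show ?thesis .
qed

text \<open>The increments \<open>\<Delta>\<close> are grouped by their nearest integer, which gives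
  at most 32 l M + 2 classes. In each class the indices within \<open>\<delta>\<close> of the
  integer are counted, at most 2 \<open>\<delta>\<close> / l + 1 of them, and the two sides are
  treated by Kusmin-Landau with distances \<open>\<delta>\<close> and 1/2. A class costs at most
  \<open>c\<close>, and 32 * 2.2573 and 2 * 2.2573 are rounded up to 75 and 4.65; the lower-order
  terms fit because 75 s < 1 in the nontrivial case.\<close>

lemma diff_test_2: "diff_test 2 32 (1/2) 1 75 4.65"
  unfolding diff_test_def
proof (intro allI impI)
  fix f :: "nat \<Rightarrow> real" and N :: nat and l :: real
  assume l: "l > 0" and D: "\<forall>n. n + 2 < N \<longrightarrow> l \<le> fdiff 2 f n \<and> fdiff 2 f n \<le> 32 * l"
  define S where "S = cmod (\<Sum>n<N. cis (2 * pi * f n))"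
  define s where "s = sqrt l"
  have s: "s > 0" "s * s = l" using l by (auto simp: s_def)
  have SN: "S \<le> real N"
    unfolding S_def using norm_sum[of "\<lambda>n. cis (2 * pi * f n)" "{..<N}"] by simp
  have "S \<le> 75 * real N * s + 4.65 / s" if N: "N > 0"
  proof (cases "75 * s \<ge> 1")
    case True
    then have "real N * 1 \<le> real N * (75 * s)" by (intro mult_left_mono) auto
    then have "real N \<le> 75 * real N * s" by (simp add: mult_ac)
    moreover have "4.65 / s \<ge> 0" using s by simp
    ultimately show ?thesis by (intro order_trans[OF SN] add_increasing2)
  next
    case False
    \<comment> \<open>Increments inside the sum exist only for n < M; the last term is split off and
      costs 1.\<close>
    obtain M where M: "N = Suc M" using N by (cases N) auto
    define \<Delta> where "\<Delta> = (\<lambda>n. f (n + 1) - f n)"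
    have \<Delta>1: "l \<le> \<Delta> (Suc n) - \<Delta> n" "\<Delta> (Suc n) - \<Delta> n \<le> 32 * l" if "Suc n < M" for n
      using D[rule_format, of n] that by (auto simp: M \<Delta>_def numeral_2_eq_2)
    have \<Delta>: "real (y - x) * l \<le> \<Delta> y - \<Delta> x \<and> \<Delta> y - \<Delta> x \<le> real (y - x) * (32 * l)" if "x \<le> y" "y < M" for x y
      using that
    proof (induction y rule: dec_induct)
      case (step y)
      then have "real (Suc y - x) = real (y - x) + 1" by (simp add: Suc_diff_le)
      then show ?case using step \<Delta>1[of y] by (simp add: algebra_simps)
    qed simp
    have \<Delta>_mono: "\<Delta> x \<le> \<Delta> y" if "x \<le> y" "y < M" for x y
      using \<Delta>[OF that] l by (smt (verit) mult_nonneg_nonneg of_nat_0_le_iff)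
    \<comment> \<open>About sqrt (l / pi), which minimises 2 / (pi \<open>\<delta>\<close>) + 2
      \<open>\<delta>\<close> / l.\<close>
    define \<delta> where "\<delta> = 0.56 * s"
    have \<delta>: "\<delta> > 0" "1/2 + \<delta> \<le> 1" using s False by (auto simp: \<delta>_def)
    define \<kappa> where "\<kappa> = (\<lambda>n. \<lfloor>\<Delta> n + 1/2\<rfloor>)"
    have \<kappa>: "of_int (\<kappa> n) - 1/2 \<le> \<Delta> n" "\<Delta> n < of_int (\<kappa> n) + 1/2" for n
      unfolding \<kappa>_def by linarith+
    have \<kappa>_mono: "\<kappa> x \<le> \<kappa> y" if "x \<le> y" "y < M" for x y
      unfolding \<kappa>_def using \<Delta>_mono[OF that] by (intro floor_mono) auto
    let ?e = "\<lambda>n. cis (2 * pi * f n)"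
    have mono_step: "f (n + 1) - f n \<le> f (n + 2) - f (n + 1)" if "Suc n < M" for n
      using \<Delta>1[OF that] l by (simp add: \<Delta>_def)
    define c where "c = 2.2573 / s + 2.274"
    have "cmod (\<Sum>n | n \<in> {..<M} \<and> \<kappa> n = k. ?e n) \<le> c" for k
    proof -
      define I1 where "I1 = {n. n < M \<and> \<kappa> n = k \<and> \<Delta> n < of_int k - \<delta>}"
      define I2 where "I2 = {n. n < M \<and> \<kappa> n = k \<and> of_int k - \<delta> \<le> \<Delta> n \<and> \<Delta> n \<le> of_int k + \<delta>}"
      define I3 where "I3 = {n. n < M \<and> \<kappa> n = k \<and> of_int k + \<delta> < \<Delta> n}"
      have fin: "finite I1" "finite I2" "finite I3"
        by (auto simp: I1_def I2_def I3_def)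
      have conv1: "z \<in> I1" if "x \<in> I1" "y \<in> I1" "x \<le> z" "z \<le> y" for x y z
        using that \<kappa>_mono[of x z] \<kappa>_mono[of z y] \<Delta>_mono[of z y] by (auto simp: I1_def)
      have conv2: "z \<in> I2" if "x \<in> I2" "y \<in> I2" "x \<le> z" "z \<le> y" for x y z
        using that \<kappa>_mono[of x z] \<kappa>_mono[of z y] \<Delta>_mono[of z y] \<Delta>_mono[of x z] by (auto simp: I2_def)
      have conv3: "z \<in> I3" if "x \<in> I3" "y \<in> I3" "x \<le> z" "z \<le> y" for x y z
        using that \<kappa>_mono[of x z] \<kappa>_mono[of z y] \<Delta>_mono[of x z] by (auto simp: I3_def)
      have "{n. n \<in> {..<M} \<and> \<kappa> n = k} = I1 \<union> (I2 \<union> I3)" by (auto simp: I1_def I2_def I3_def)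
      moreover have "I1 \<inter> (I2 \<union> I3) = {}" "I2 \<inter> I3 = {}" using \<delta> by (auto simp: I1_def I2_def I3_def)
      ultimately have split: "(\<Sum>n | n \<in> {..<M} \<and> \<kappa> n = k. ?e n) = (\<Sum>n\<in>I1. ?e n) + ((\<Sum>n\<in>I2. ?e n) + (\<Sum>n\<in>I3. ?e n))"
        using fin by (simp add: sum.union_disjoint)
      have "cmod (\<Sum>n | n \<in> {..<M} \<and> \<kappa> n = k. ?e n) \<le> cmod (\<Sum>n\<in>I1. ?e n) + (cmod (\<Sum>n\<in>I2. ?e n) + cmod (\<Sum>n\<in>I3. ?e n))"
        unfolding split by (intro order_trans[OF norm_triangle_ineq] add_left_mono norm_triangle_ineq)
      also have "\<dots> \<le> (1 / (1/2) + 1 / \<delta>) / pi + ((2 * \<delta> / l + 1) + (1 / \<delta> + 1 / (1/2)) / pi)"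
      proof (intro add_mono)
        show "cmod (\<Sum>n\<in>I1. ?e n) \<le> (1 / (1/2) + 1 / \<delta>) / pi"
        proof (rule kusmin_landau_set[where k = "k - 1"])
          show "of_int (k - 1) + 1/2 \<le> f (n + 1) - f n \<and> f (n + 1) - f n \<le> of_int (k - 1) + 1 - \<delta>" if "n \<in> I1" for n
            using that \<kappa>[of n] by (auto simp: I1_def \<Delta>_def)
          show "f (n + 1) - f n \<le> f (n + 2) - f (n + 1)" if "n \<in> I1" "Suc n \<in> I1" for n
            using that by (intro mono_step) (simp add: I1_def)
        qed (fact fin conv1 | use \<delta> in simp)+
        show "cmod (\<Sum>n\<in>I3. ?e n) \<le> (1 / \<delta> + 1 / (1/2)) / pi"
        proof (rule kusmin_landau_set[where k = k])
          show "of_int k + \<delta> \<le> f (n + 1) - f n \<and> f (n + 1) - f n \<le> of_int k + 1 - 1/2" if "n \<in> I3" for n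
            using that \<kappa>[of n] by (auto simp: I3_def \<Delta>_def)
          show "f (n + 1) - f n \<le> f (n + 2) - f (n + 1)" if "n \<in> I3" "Suc n \<in> I3" for n
            using that by (intro mono_step) (simp add: I3_def)
        qed (fact fin conv3 | use \<delta> in simp)+
        have "\<exists>A B. I2 = {A..<B}" by (rule convex_nat_set_is_interval) (fact fin conv2)+
        then obtain A B where AB: "I2 = {A..<B}" by blast
        have "cmod (\<Sum>n\<in>I2. ?e n) \<le> real (card I2)"
          using norm_sum[of ?e I2] by simp
        also have "\<dots> \<le> 2 * \<delta> / l + 1"
        proof (cases "A < B")
          case True
          then have "A \<in> I2" "B - 1 \<in> I2" by (auto simp: AB)
          then have "\<Delta> (B - 1) - \<Delta> A \<le> 2 * \<delta>" "B - 1 < M" by (auto simp: I2_def)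
          moreover have "real (B - 1 - A) * l \<le> \<Delta> (B - 1) - \<Delta> A"
            using \<Delta>[of A "B - 1"] \<open>B - 1 < M\<close> True by simp
          ultimately have "real (B - 1 - A) \<le> 2 * \<delta> / l" using l by (simp add: field_simps)
          then show ?thesis using True by (simp add: AB of_nat_diff)
        next
          case False
          then show ?thesis using \<delta> l by (simp add: AB)
        qed
        finally show "cmod (\<Sum>n\<in>I2. ?e n) \<le> 2 * \<delta> / l + 1" .
      qed
      also have "\<dots> \<le> c"
      proof -
        define r where "r = 1 / s"
        have r: "r > 0" using s by (simp add: r_def)
        have dl: "2 * \<delta> / l = 1.12 * r" using s by (simp add: \<delta>_def r_def s(2)[symmetric])
        have "1 / pi \<le> 1 / 3.1415" using pi_bounds by (intro divide_left_mono) auto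
        then have "(4 + 2 / \<delta>) * (1 / pi) \<le> (4 + 2 / \<delta>) * (1 / 3.1415)"
          using \<delta> by (intro mult_left_mono) auto
        also have "\<dots> \<le> 1.2734 + 1.1372 * r"
        proof -
          have "2 / \<delta> = 2 / 0.56 * r" by (simp add: \<delta>_def r_def)
          then show ?thesis using r by simp
        qed
        finally have "(4 + 2 / \<delta>) * (1 / pi) + 1.12 * r + 1 \<le> 1.2734 + 1.1372 * r + 1.12 * r + 1"
          by (intro add_right_mono)
        also have "\<dots> \<le> 2.2573 * r + 2.274" using r by simp
        also have "\<dots> = c" by (simp add: c_def r_def)
        finally have "(4 + 2 / \<delta>) * (1 / pi) + 1.12 * r + 1 \<le> c" .
        moreover have "(1 / (1/2) + 1 / \<delta>) / pi + ((2 * \<delta> / l + 1) + (1 / \<delta> + 1 / (1/2)) / pi)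
            = (4 + 2 / \<delta>) * (1 / pi) + 1.12 * r + 1"
          unfolding dl by (simp add: add_divide_distrib)
        ultimately show ?thesis by (simp only:)
      qed
      finally show ?thesis .
    qed
    note cls = this
    have c: "c > 0" using s by (simp add: c_def add_pos_pos)
    have "cmod (\<Sum>n<M. ?e n) \<le> (32 * l * real M + 2) * c"
    proof (cases "M = 0")
      case True
      then show ?thesis using c by simp
    next
      case False
      have "(\<Sum>n<M. ?e n) = (\<Sum>k\<in>\<kappa> ` {..<M}. \<Sum>n | n \<in> {..<M} \<and> \<kappa> n = k. ?e n)"
        by (rule sum.image_gen) simp
      also have "cmod \<dots> \<le> real (card (\<kappa> ` {..<M})) * c"
        by (rule sum_norm_bound) (rule cls)
      also have "real (card (\<kappa> ` {..<M})) \<le> 32 * l * real M + 2"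
      proof -
        have "\<kappa> ` {..<M} \<subseteq> {\<kappa> 0..\<kappa> (M - 1)}"
          using \<kappa>_mono False by auto
        then have "card (\<kappa> ` {..<M}) \<le> nat (\<kappa> (M - 1) - \<kappa> 0 + 1)"
          using card_mono[of "{\<kappa> 0..\<kappa> (M - 1)}"] by simp
        moreover have "\<kappa> 0 \<le> \<kappa> (M - 1)" using \<kappa>_mono[of 0 "M - 1"] False by simp
        ultimately have "real (card (\<kappa> ` {..<M})) \<le> of_int (\<kappa> (M - 1) - \<kappa> 0 + 1)" by linarith
        also have "\<dots> \<le> (\<Delta> (M - 1) - \<Delta> 0) + 2" using \<kappa>[of "M - 1"] \<kappa>[of 0] by simp
        also have "\<Delta> (M - 1) - \<Delta> 0 \<le> real (M - 1) * (32 * l)" using \<Delta>[of 0 "M - 1"] False by simp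
        also have "real (M - 1) * (32 * l) \<le> real M * (32 * l)" using l by (intro mult_right_mono) auto
        finally show ?thesis by (simp add: mult_ac)
      qed
      finally show ?thesis using c by (simp add: mult_right_mono)
    qed
    moreover have "(\<Sum>n<N. ?e n) = (\<Sum>n<M. ?e n) + ?e M" by (simp add: M)
    then have "S \<le> cmod (\<Sum>n<M. ?e n) + 1" unfolding S_def by (metis norm_triangle_ineq norm_cis)
    ultimately have "S \<le> (32 * (s * s) * real M + 2) * c + 1" using s by simp
    also have "\<dots> = real M * s * (32 * (2.2573 + 2.274 * s)) + 2 * 2.2573 / s + 2 * 2.274 + 1"
      using s(1) by (simp add: c_def field_simps)
    also have "\<dots> \<le> real N * s * 75 + 4.65 / s"
    proof -
      have "real M * s * (32 * (2.2573 + 2.274 * s)) \<le> real N * s * 75"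
        using s(1) False by (intro mult_mono) (auto simp: M)
      moreover have "2 * 2.2573 / s + 2 * 2.274 + 1 \<le> 4.65 / s"
        using s(1) False by (simp add: field_simps)
      ultimately show ?thesis by simp
    qed
    finally show ?thesis by (simp add: mult_ac)
  qed
  note main = this
  have pw: "l powr (1/2) = s" "l powr (- (1/2)) = 1 / s"
    unfolding powr_minus_divide s_def using l by (simp_all only: powr_half_sqrt less_imp_le)
  show "cmod (\<Sum>n<N. cis (2 * pi * f n)) \<le> 75 * real N * l powr (1/2) + 4.65 * real N powr (1 - 1) * l powr (- (1/2))"
  proof (cases "N = 0")
    case False
    then have "4.65 * real N powr (1 - 1) * l powr (- (1/2)) = 4.65 / s" by (simp add: pw(2))
    moreover have "N > 0" using False by simp
    then have "S \<le> 75 * real N * s + 4.65 / s" by (rule main)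
    ultimately show ?thesis unfolding S_def pw(1) by (simp only:)
  qed simp
qed

section \<open>The fifth difference test on dyadic blocks\<close>

lemma powr_le_of_le_power:
  fixes x b :: real
  assumes "x > 0" "b \<ge> 0" "n > 0" "x \<le> b ^ n"
  shows "x powr (1 / real n) \<le> b"
proof -
  have "x powr (1 / real n) \<le> (b ^ n) powr (1 / real n)" using assms by (intro powr_mono2) auto
  also have "\<dots> = b" using assms by (cases "b = 0") (auto simp: powr_realpow[symmetric] powr_powr)
  finally show ?thesis .
qed

lemma le_powr_of_power_le:
  fixes x b :: real
  assumes "b \<ge> 0" "n > 0" "b ^ n \<le> x"
  shows "b \<le> x powr (1 / real n)"
proof -
  have "b = (b ^ n) powr (1 / real n)" using assms by (cases "b = 0") (auto simp: powr_realpow[symmetric] powr_powr)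
  also have "\<dots> \<le> x powr (1 / real n)" using assms by (intro powr_mono2) auto
  finally show ?thesis .
qed

text \<open>1 / \<open>\<kappa>\<close> runs through 2, 6, 14, 30 by doubling its successor, and
  \<open>\<sigma>\<close> is halved each time. The constants are the square roots required by
  \<open>diff_test_Suc\<close>, rounded up.\<close>

lemma diff_test_5: "diff_test 5 32 (1/30) (1/8) 2.65 3.21"
proof -
  have "diff_test (Suc 2) 32 (1/6) (1/2) 11.6 4.83"
  proof (rule diff_test_Suc[OF diff_test_2])
    have "2 powr (1/2) \<le> (1.4143::real)" using powr_le_of_le_power[of 2 "1.4143" 2] by (simp add: power2_eq_square)
    then show "5/4 * (1 + 2 powr (1/2) * 75) \<le> (11.6::real)\<^sup>2" by (simp add: power2_eq_square)
  qed (simp_all add: power2_eq_square)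
  then have "diff_test 3 32 (1/6) (1/2) 11.6 4.83" by (simp add: eval_nat_numeral)
  then have "diff_test (Suc 3) 32 (1/14) (1/2/2) 4.2 3.81"
  proof (rule diff_test_Suc)
    have "2 powr (1/6) \<le> (1.123::real)" using powr_le_of_le_power[of 2 "1.123" 6] by (simp add: eval_nat_numeral)
    then show "5/4 * (1 + 2 powr (1/6) * 11.6) \<le> (4.2::real)\<^sup>2" by (simp add: power2_eq_square)
  qed (simp_all add: power2_eq_square)
  then have "diff_test 4 32 (1/14) (1/4) 4.2 3.81" by (simp add: eval_nat_numeral)
  then have "diff_test (Suc 4) 32 (1/30) (1/4/2) 2.65 3.21"
  proof (rule diff_test_Suc)
    have "2 powr (1/14) \<le> (1.051::real)" using powr_le_of_le_power[of 2 "1.051" 14] by (simp add: eval_nat_numeral)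
    then show "5/4 * (1 + 2 powr (1/14) * 4.2) \<le> (2.65::real)\<^sup>2" by (simp add: power2_eq_square)
  qed (simp_all add: power2_eq_square)
  then show ?thesis by (simp add: eval_nat_numeral)
qed

text \<open>The phase a ln y has fifth derivative 24 a / y^5, which varies by the factor 2^5 = 32 on
  [M, 2 M]; its minimum there is \<open>\<tau>\<close> / M^5. Abel summation divides the bound of
  the test by M.\<close>

lemma cmod_dyadic_block_le:
  fixes t :: real and M B :: nat
  assumes t: "t > 0" and M: "M > 0" "B \<le> 2 * M"
  defines "\<tau> \<equiv> 3 * t / (8 * pi)"
  shows "cmod (\<Sum>n=M..<B. of_nat n powr (- (1 + \<i> * complex_of_real t)))
     \<le> 2.65 * \<tau> powr (1/30) * real M powr (- 1/6) + 3.21 * \<tau> powr (- 1/30) * real M powr (1/24)"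
proof -
  define a where "a = t / (2 * pi)"
  define l where "l = \<tau> / real M ^ 5"
  have \<tau>: "\<tau> > 0" using t by (simp add: \<tau>_def)
  have l: "l > 0" using \<tau> M by (simp add: l_def)
  have a: "a > 0" using t by (simp add: a_def)
  have la: "l = 24 * a / (2 * real M) ^ 5"
    by (simp add: l_def \<tau>_def a_def eval_nat_numeral)
  have la': "32 * l = 24 * a / real M ^ 5"
    by (simp add: l_def \<tau>_def a_def)
  define F where "F = (\<lambda>i::nat. \<lambda>y::real. if i = 0 then a * ln y else if i = 1 then a / y else if i = 2 then - a / y^2
     else if i = 3 then 2 * a / y^3 else if i = 4 then - 6 * a / y^4 else 24 * a / y^5)"
  have F: "(F i has_real_derivative F (Suc i) y) (at y)" if "i < 5" "y > 0" for i y
  proof -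
    have D: "((\<lambda>y. c / y ^ Suc j) has_real_derivative - (real (Suc j) * c) / y ^ Suc (Suc j)) (at y)" for c j
    proof -
      have "((\<lambda>y. c / y ^ Suc j) has_real_derivative - (c * (real (Suc j) * y ^ j)) / (y ^ Suc j * y ^ Suc j)) (at y)"
        using that by (auto intro!: derivative_eq_intros simp del: power_Suc of_nat_Suc)
      moreover have "- (c * (real (Suc j) * y ^ j)) / (y ^ Suc j * y ^ Suc j) = - (real (Suc j) * c) / y ^ Suc (Suc j)"
        using that by (simp add: field_simps)
      ultimately show ?thesis by (simp only:)
    qed
    from that consider "i = 0" | "i = 1" | "i = 2" | "i = 3" | "i = 4" by linarith
    then show ?thesis
    proof cases
      case 1
      have "((\<lambda>y. a * ln y) has_real_derivative a / y) (at y)"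
        using that by (auto intro!: derivative_eq_intros)
      then show ?thesis by (simp add: F_def 1)
    qed (use D[of a 0] D[of "-a" 1] D[of "2 * a" 2] D[of "- 6 * a" 3] in \<open>simp_all add: F_def eval_nat_numeral\<close>)
  qed
  have C: "cmod (\<Sum>i<m. cis (t * ln (real (M + i)))) \<le> 2.65 * real M * l powr (1/30) + 3.21 * real M powr (7/8) * l powr (- 1/30)"
    if m: "m \<le> B - M" for m
  proof -
    define f where "f = (\<lambda>i::nat. F 0 (real M + real i))"
    have "l \<le> fdiff 5 f n \<and> fdiff 5 f n \<le> 32 * l" if n: "n + 5 < m" for n
      unfolding f_def
    proof (rule fdiff_smooth_bounds)
      show "(F i has_real_derivative F (Suc i) y) (at y)" if "i < 5" "y > 0" for i y
        using that by (rule F)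
    next
      fix y assume y: "real M + real n \<le> y" "y \<le> real M + real n + real 5"
      have "real n + 5 \<le> real M" using n m M by linarith
      then have y2: "real M \<le> y" "y \<le> 2 * real M" using y by auto
      have "24 * a / (2 * real M) ^ 5 \<le> 24 * a / y ^ 5"
        using y2 M a by (intro divide_left_mono power_mono) auto
      moreover have "24 * a / y ^ 5 \<le> 24 * a / real M ^ 5"
        using y2 M a by (intro divide_left_mono power_mono) auto
      ultimately show "l \<le> F 5 y \<and> F 5 y \<le> 32 * l" by (simp only: la la' F_def) simp
    qed (use M in auto)
    then have "cmod (\<Sum>i<m. cis (2 * pi * f i)) \<le> 2.65 * real m * l powr (1/30) + 3.21 * real m powr (1 - 1/8) * l powr (- (1/30))"
      using diff_test_5 l unfolding diff_test_def by blast
    also have "\<dots> \<le> 2.65 * real M * l powr (1/30) + 3.21 * real M powr (1 - 1/8) * l powr (- (1/30))"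
      using m M by (intro add_mono mult_right_mono mult_left_mono powr_mono2) auto
    finally show ?thesis by (simp add: f_def F_def a_def)
  qed
  have "cmod (\<Sum>n=M..<B. of_nat n powr (- (1 + \<i> * complex_of_real t))) \<le>
      (2.65 * real M * l powr (1/30) + 3.21 * real M powr (7/8) * l powr (- 1/30)) / real M"
    by (rule cmod_sum_powr_le_of_cis[OF M(1) C])
  also have "\<dots> = 2.65 * \<tau> powr (1/30) * real M powr (- 1/6) + 3.21 * \<tau> powr (- 1/30) * real M powr (1/24)"
  proof -
    have l30: "l powr c = \<tau> powr c * real M powr (- 5 * c)" for c
    proof -
      have "(real M ^ 5) powr c = (real M powr real 5) powr c" using M by (simp only: powr_realpow of_nat_0_less_iff)
      also have "\<dots> = real M powr (5 * c)" by (simp only: powr_powr of_nat_numeral)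
      finally show ?thesis
        using \<tau> by (simp add: l_def powr_divide powr_minus_divide)
    qed
    have "real M powr (7/8) * real M powr (1/6) / real M = real M powr (1/24)"
    proof -
      have "real M powr (7/8) * real M powr (1/6) = real M powr (1/24 + 1)" by (simp add: powr_add[symmetric])
      also have "\<dots> = real M powr (1/24) * real M" by (subst powr_add) simp
      finally show ?thesis using M by simp
    qed
    moreover have "3.21 * real M powr (7/8) * l powr (- 1/30) / real M
        = 3.21 * \<tau> powr (- 1/30) * (real M powr (7/8) * real M powr (1/6) / real M)"
      by (simp add: l30)
    moreover have "2.65 * real M * l powr (1/30) / real M = 2.65 * \<tau> powr (1/30) * real M powr (- 1/6)"
      using M by (simp add: l30)
    ultimately show ?thesis by (simp only: add_divide_distrib)
  qed
  finally show ?thesis .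
qed

text \<open>Each block bound is rewritten as a difference of values at M and 2 M, so that the
  geometric series telescope under doubling of \<open>m\<close>. The last block may overshoot
  \<open>X\<close>, hence \<open>2 * X\<close>.\<close>

lemma cmod_sum_dyadic_le:
  fixes t :: real and m X :: nat
  assumes t: "t > 0" and m: "m > 0" "m \<le> X"
  defines "\<tau> \<equiv> 3 * t / (8 * pi)"
  shows "cmod (\<Sum>n=m..<X. of_nat n powr (- (1 + \<i> * complex_of_real t)))
     \<le> 2.65 * \<tau> powr (1/30) / (1 - 2 powr (- 1/6)) * real m powr (- 1/6)
       + 3.21 * \<tau> powr (- 1/30) / (2 powr (1/24) - 1) * (real (2 * X) powr (1/24) - real m powr (1/24))"
proof -
  define cA where "cA = 2.65 * \<tau> powr (1/30) / (1 - 2 powr (- 1/6))"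
  define cB where "cB = 3.21 * \<tau> powr (- 1/30) / (2 powr (1/24) - 1)"
  let ?S = "\<lambda>m X. cmod (\<Sum>n=m..<X. of_nat n powr (- (1 + \<i> * complex_of_real t)))"
  have r: "2 powr (- 1/6) < (1::real)" "2 powr (1/24) > (1::real)" by (simp_all add: powr_less_one)
  have r0: "1 - 2 powr (- 1/6) \<ge> (0::real)" "2 powr (1/24) - 1 \<ge> (0::real)" using r by linarith+
  have c0: "cA \<ge> 0" "cB \<ge> 0"
    unfolding cA_def cB_def by (intro divide_nonneg_nonneg mult_nonneg_nonneg r0 powr_ge_zero; simp)+
  have block: "?S M B \<le> cA * (real M powr (- 1/6) - real (2 * M) powr (- 1/6)) + cB * (real (2 * M) powr (1/24) - real M powr (1/24))"
    if "M > 0" "B \<le> 2 * M" for M B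
  proof -
    have "cA * (real M powr (- 1/6) - real (2 * M) powr (- 1/6)) = cA * (1 - 2 powr (- 1/6)) * real M powr (- 1/6)"
      by (simp add: powr_mult algebra_simps)
    moreover have "cA * (1 - 2 powr (- 1/6)) = 2.65 * \<tau> powr (1/30)"
      using nonzero_eq_divide_eq[of "1 - 2 powr (- 1/6)" cA "2.65 * \<tau> powr (1/30)"] r(1) cA_def by auto
    moreover have "cB * (real (2 * M) powr (1/24) - real M powr (1/24)) = cB * (2 powr (1/24) - 1) * real M powr (1/24)"
      by (simp add: powr_mult algebra_simps)
    moreover have "cB * (2 powr (1/24) - 1) = 3.21 * \<tau> powr (- 1/30)"
      using nonzero_eq_divide_eq[of "2 powr (1/24) - 1" cB "3.21 * \<tau> powr (- 1/30)"] r(2) cB_def by auto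
    ultimately show ?thesis using cmod_dyadic_block_le[OF t that] by (simp only: \<tau>_def)
  qed
  have "?S m X \<le> cA * real m powr (- 1/6) + cB * (real (2 * X) powr (1/24) - real m powr (1/24))"
    using m
  proof (induction "X - m" arbitrary: m rule: less_induct)
    case less
    show ?case
    proof (cases "X \<le> 2 * m")
      case True
      have "cA * (real m powr (- 1/6) - real (2 * m) powr (- 1/6)) \<le> cA * real m powr (- 1/6)"
        using c0 by (intro mult_left_mono) auto
      moreover have "cB * (real (2 * m) powr (1/24) - real m powr (1/24)) \<le> cB * (real (2 * X) powr (1/24) - real m powr (1/24))"
        using c0 less.prems by (intro mult_left_mono diff_right_mono powr_mono2) auto
      ultimately show ?thesis using block[OF less.prems(1) True] by linarith
    next
      case False
      have "(\<Sum>n=m..<X. of_nat n powr (- (1 + \<i> * complex_of_real t)))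
        = (\<Sum>n=m..<2 * m. of_nat n powr (- (1 + \<i> * complex_of_real t))) + (\<Sum>n=2 * m..<X. of_nat n powr (- (1 + \<i> * complex_of_real t)))"
        using False by (intro sum.atLeastLessThan_concat[symmetric]) auto
      then have "?S m X \<le> ?S m (2 * m) + ?S (2 * m) X" by (simp only: norm_triangle_ineq)
      moreover have "?S m (2 * m) \<le> cA * (real m powr (- 1/6) - real (2 * m) powr (- 1/6)) + cB * (real (2 * m) powr (1/24) - real m powr (1/24))"
        using less.prems by (intro block) auto
      moreover have "?S (2 * m) X \<le> cA * real (2 * m) powr (- 1/6) + cB * (real (2 * X) powr (1/24) - real (2 * m) powr (1/24))"
        using False less.prems by (intro less.hyps) auto
      ultimately show ?thesis by (simp only: right_diff_distrib)
    qed
  qed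
  then show ?thesis by (simp only: cA_def cB_def)
qed

section \<open>The three bounds\<close>

lemma cmod_zeta_le_half_ln:
  fixes t :: real
  assumes t: "t \<ge> 50"
  shows "cmod (zeta (1 + \<i> * of_real t)) \<le> 1/2 * ln t + 1.93"
proof -
  define q where "q = 1 / sqrt t"
  have q0: "q > 0" using t by (simp add: q_def)
  have tq: "1 / q\<^sup>2 = t" using t by (simp add: q_def power_divide)
  have lnq: "ln (1 / q) = 1/2 * ln t" using t by (simp add: q_def ln_sqrt)
  have "cmod (zeta (1 + \<i> * of_real (1 / q\<^sup>2))) \<le> ln (1 / q) + 1.93"
  proof (cases "q \<ge> 85/1000")
    case True
    have "sqrt t \<ge> 10000/1415"
      using t by (intro real_le_rsqrt) (simp add: power2_eq_square)
    then have "q \<le> 1415/10000" using t by (simp add: q_def field_simps)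
    with True show ?thesis by (rule cmod_zeta_le_half_ln_medium)
  next
    case False
    define K where "K = nat \<lfloor>17/100 / q\<rfloor>"
    have "17/100 / q > 2" using False q0 by (simp add: field_simps)
    then have "\<lfloor>17/100 / q\<rfloor> \<ge> 2" by (simp add: le_floor_iff)
    then have "nat \<lfloor>17/100 / q\<rfloor> \<ge> 2" "real (nat \<lfloor>17/100 / q\<rfloor>) = of_int \<lfloor>17/100 / q\<rfloor>" by linarith+
    then have K: "K \<ge> 2" "real K = of_int \<lfloor>17/100 / q\<rfloor>" by (simp_all only: K_def)
    have "real K \<le> 17/100 / q" "17/100 / q < real K + 1" unfolding K(2) by linarith+
    then have "real K * q \<le> 17/100" "17/100 < real K * q + q" using q0 by (simp_all add: field_simps)
    with K(1) q0 show ?thesis by (intro cmod_zeta_le_half_ln_large)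
  qed
  then show ?thesis by (simp only: tq lnq)
qed

text \<open>Below \<open>m0\<close> the terms are estimated trivially. The factor 2048 costs 11 ln
  2, about 7.6, but divides the first dyadic term by more than 3.56. The three parts cost 8.25, 6.9
  and 22.5.\<close>

lemma cmod_sum_powr_le_fifth_ln:
  fixes t :: real and X :: nat
  assumes t: "ln t \<ge> 140" "t > 0" and X: "sqrt t / 2 \<le> real X" "real X \<le> sqrt t + 1"
  shows "cmod (\<Sum>n=1..<X. of_nat n powr (- (1 + \<i> * complex_of_real t))) \<le> 1/5 * ln t + 38"
proof -
  define \<tau> where "\<tau> = 3 * t / (8 * pi)"
  define m0 where "m0 = 2048 * \<tau> powr (1/5)"
  define m where "m = nceil m0"
  let ?f = "\<lambda>n. of_nat n powr (- (1 + \<i> * complex_of_real t))"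
  have tpow: "t powr c = exp (c * ln t)" for c using t by (simp add: powr_def)
  have \<tau>t: "0.119 * t \<le> \<tau>" "\<tau> \<le> t"
  proof -
    have pi': "1 / (8 * 3.1416) \<le> 1 / (8 * pi)" "1 / (8 * pi) \<le> 1 / (8 * 3.1415)"
      by (intro divide_left_mono mult_left_mono; use pi_bounds in simp)+
    have "3 * t * (1 / (8 * 3.1416)) \<le> 3 * t * (1 / (8 * pi))" "3 * t * (1 / (8 * pi)) \<le> 3 * t * (1 / (8 * 3.1415))"
      by (intro mult_left_mono pi'; use t in simp)+
    then show "0.119 * t \<le> \<tau>" "\<tau> \<le> t" using t by (simp_all add: \<tau>_def)
  qed
  have t1: "t \<ge> 1" "\<tau> \<ge> 1"
  proof -
    have "141 \<le> exp (ln t)" using exp_ge_add_one_self[of "ln t"] t by linarith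
    then show "t \<ge> 1" "\<tau> \<ge> 1" using \<tau>t t by auto
  qed
  have m0: "m0 \<ge> 2048" using t1 by (simp add: m0_def ge_one_powr_ge_zero)
  have m: "m0 \<le> real m" "real m < m0 + 1" "m > 0"
    using le_real_nceil[of m0] real_nceil_less[of m0] nceil_pos[of m0] m0 by (auto simp: m_def)
  have mX: "m \<le> X"
  proof -
    have "real m \<le> 2 * m0" using m m0 by linarith
    also have "\<dots> \<le> 4096 * t powr (1/5)"
      using \<tau>t t1 by (auto simp: m0_def intro!: powr_mono2)
    also have "\<dots> \<le> t powr (1/2) / 2"
    proof -
      have "8 ^ 6 \<le> exp (7::real) ^ 6" using exp_ge_add_one_self[of "7::real"] by (intro power_mono) auto
      also have "\<dots> = exp 42" by (simp add: exp_of_nat_mult[symmetric])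
      also have "\<dots> \<le> exp (3/10 * ln t)" using t by simp
      finally have "8192 \<le> exp (3/10 * ln t)" by simp
      then have "8192 * exp (1/5 * ln t) \<le> exp (3/10 * ln t) * exp (1/5 * ln t)"
        by (intro mult_right_mono) auto
      also have "\<dots> = exp (1/2 * ln t)" by (simp add: exp_add[symmetric])
      finally show ?thesis by (simp add: tpow)
    qed
    also have "t powr (1/2) / 2 \<le> real X" using X t by (simp add: powr_half_sqrt)
    finally show ?thesis by simp
  qed
  have "(\<Sum>n=1..<X. ?f n) = (\<Sum>n=1..<m. ?f n) + (\<Sum>n=m..<X. ?f n)"
    using m mX by (intro sum.atLeastLessThan_concat[symmetric]) auto
  then have "cmod (\<Sum>n=1..<X. ?f n) \<le> cmod (\<Sum>n=1..<m. ?f n) + cmod (\<Sum>n=m..<X. ?f n)"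
    by (simp only: norm_triangle_ineq)
  moreover have "cmod (\<Sum>n=1..<m. ?f n) \<le> 1/5 * ln t + 8.25"
  proof -
    have "cmod (\<Sum>n=1..<m. ?f n) \<le> ln m0 + euler_mascheroni + 1 / (2 * m0)"
      unfolding m_def using m0 by (intro cmod_sum_powr_le_ln) auto
    moreover have "1 / (2 * m0) \<le> 1 / (2 * 2048)" using m0 by (intro divide_left_mono) auto
    moreover have "ln m0 = ln 2048 + 1/5 * ln \<tau>"
      using t1 by (simp add: m0_def ln_mult ln_powr)
    moreover have "ln 2048 = 11 * ln (2::real)" using ln_realpow[of 2 11] by simp
    moreover have "ln \<tau> \<le> ln t" using \<tau>t t1 by simp
    moreover have "euler_mascheroni \<le> (0.57727::real)"
      using euler_mascheroni_le ln_numeral_bounds(1) by simp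
    ultimately show ?thesis using ln_numeral_bounds(2) by simp
  qed
  moreover have "cmod (\<Sum>n=m..<X. ?f n) \<le> 6.9 + 22.5"
  proof -
    define rA rB where "rA = 1 - 2 powr (- 1/6 :: real)" and "rB = 2 powr (1/24 :: real) - 1"
    have r: "rA \<ge> 0.109" "rB \<ge> 0.0292"
    proof -
      have "1.1224 \<le> (2::real) powr (1/6)" using le_powr_of_power_le[of "1.1224" 6 2] by (simp add: eval_nat_numeral)
      then have "1 / 2 powr (1/6) \<le> (1 / 1.1224 :: real)" by (intro divide_left_mono) auto
      moreover have "2 powr (- 1/6) = (1 / 2 powr (1/6) :: real)" using powr_minus_divide[of "2::real" "1/6"] by simp
      ultimately show "rA \<ge> 0.109" by (simp add: rA_def)
      have "1.0292 \<le> (2::real) powr (1/24)" using le_powr_of_power_le[of "1.0292" 24 2] by (simp add: eval_nat_numeral)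
      then show "rB \<ge> 0.0292" by (simp add: rB_def)
    qed
    have "\<tau> powr (1/30) * real m powr (- 1/6) \<le> 1 / 3.56"
    proof -
      have "real m powr (- 1/6) \<le> m0 powr (- 1/6)" using m m0 by (intro powr_mono2') auto
      then have "\<tau> powr (1/30) * real m powr (- 1/6) \<le> \<tau> powr (1/30) * m0 powr (- 1/6)"
        by (intro mult_left_mono) auto
      also have "m0 powr (- 1/6) = 2048 powr (- 1/6) * \<tau> powr (- 1/30)"
        by (simp add: m0_def powr_mult powr_powr)
      also have "\<tau> powr (1/30) * (2048 powr (- 1/6) * \<tau> powr (- 1/30)) = 2048 powr (- 1/6) * (\<tau> powr (1/30) * \<tau> powr (- 1/30))"
        by (simp only: mult_ac)
      also have "\<tau> powr (1/30) * \<tau> powr (- 1/30) = 1" using t1 by (simp add: powr_add[symmetric])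
      also have "2048 powr (- 1/6) * 1 = (1 / 2048 powr (1/6) :: real)" using powr_minus_divide[of "2048::real" "1/6"] by simp
      also have "\<dots> \<le> 1 / 3.56"
      proof (rule divide_left_mono)
        show "3.56 \<le> (2048::real) powr (1/6)" using le_powr_of_power_le[of "3.56" 6 2048] by (simp add: eval_nat_numeral)
      qed auto
      finally show ?thesis .
    qed
    then have "2.65 * (\<tau> powr (1/30) * real m powr (- 1/6)) / rA \<le> 2.65 * (1 / 3.56) / 0.109"
      using r by (intro frac_le mult_left_mono) auto
    also have "\<dots> \<le> 6.9" by simp
    finally have A: "2.65 * (\<tau> powr (1/30) * real m powr (- 1/6)) / rA \<le> 6.9" .
    have "\<tau> powr (- 1/30) * real (2 * X) powr (1/24) \<le> 1.074 * 1.047 * 0.181"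
    proof -
      have "(0.119::real) powr (- 1/30) = (1 / 0.119) powr (1/30)"
        using powr_minus_divide[of "0.119::real" "1/30"] by (simp add: powr_divide)
      also have "\<dots> \<le> 1.074" using powr_le_of_le_power[of "1 / 0.119" "1.074" 30] by (simp add: eval_nat_numeral)
      finally have c1: "(0.119::real) powr (- 1/30) \<le> 1.074" .
      have c2: "(3::real) powr (1/24) \<le> 1.047" using powr_le_of_le_power[of 3 "1.047" 24] by (simp add: eval_nat_numeral)
      have "\<tau> powr (- 1/30) \<le> (0.119 * t) powr (- 1/30)" using \<tau>t t by (intro powr_mono2') auto
      also have "\<dots> = 0.119 powr (- 1/30) * t powr (- 1/30)" by (rule powr_mult)
      also have "\<dots> \<le> 1.074 * t powr (- 1/30)" using c1 by (intro mult_right_mono) auto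
      finally have T1: "\<tau> powr (- 1/30) \<le> 1.074 * t powr (- 1/30)" .
      have "sqrt t \<ge> 2"
      proof -
        have "141 \<le> exp (ln t)" using exp_ge_add_one_self[of "ln t"] t by linarith
        then show ?thesis using t by (intro real_le_rsqrt) simp
      qed
      then have "real (2 * X) \<le> 3 * t powr (1/2)" using X t by (simp add: powr_half_sqrt)
      then have "real (2 * X) powr (1/24) \<le> (3 * t powr (1/2)) powr (1/24)" by (intro powr_mono2) auto
      also have "\<dots> = 3 powr (1/24) * t powr (1/48)" by (simp add: powr_mult powr_powr)
      also have "\<dots> \<le> 1.047 * t powr (1/48)" using c2 by (intro mult_right_mono) auto
      finally have T2: "real (2 * X) powr (1/24) \<le> 1.047 * t powr (1/48)" .
      have "\<tau> powr (- 1/30) * real (2 * X) powr (1/24) \<le> (1.074 * t powr (- 1/30)) * (1.047 * t powr (1/48))"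
        using T1 T2 by (intro mult_mono) auto
      also have "\<dots> = 1.074 * 1.047 * (t powr (- 1/30) * t powr (1/48))" by simp
      \<comment> \<open>1/30 - 1/48 = 1/80, and ln t >= 140 makes this at most exp (-7/4).\<close>
      also have "t powr (- 1/30) * t powr (1/48) = exp (- (1/80 * ln t))"
        by (simp add: tpow exp_add[symmetric])
      also have "exp (- (1/80 * ln t)) \<le> 0.181"
      proof -
        have "1.5332 \<le> exp (7/16::real)" using exp_lower_Taylor_quadratic[of "7/16::real"] by (simp add: power2_eq_square)
        then have "1.5332 ^ 4 \<le> exp (7/16::real) ^ 4" by (intro power_mono) auto
        also have "\<dots> = exp (7/4)" by (simp add: exp_of_nat_mult[symmetric])
        also have "\<dots> \<le> exp (1/80 * ln t)" using t by simp
        finally have "5.525 \<le> exp (1/80 * ln t)" by (simp add: eval_nat_numeral)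
        then have "1 / exp (1/80 * ln t) \<le> 1 / 5.525" by (rule divide_left_mono) simp_all
        also have "\<dots> \<le> 0.181" by simp
        finally show ?thesis by (simp only: exp_minus inverse_eq_divide)
      qed
      finally show ?thesis by simp
    qed
    then have "3.21 * (\<tau> powr (- 1/30) * real (2 * X) powr (1/24)) / rB \<le> 3.21 * (1.074 * 1.047 * 0.181) / 0.0292"
      using r by (intro frac_le mult_left_mono) auto
    also have "\<dots> \<le> 22.5" by simp
    finally have B: "3.21 * (\<tau> powr (- 1/30) * real (2 * X) powr (1/24)) / rB \<le> 22.5" .
    have "cmod (\<Sum>n=m..<X. ?f n) \<le> 2.65 * \<tau> powr (1/30) / rA * real m powr (- 1/6)
       + 3.21 * \<tau> powr (- 1/30) / rB * (real (2 * X) powr (1/24) - real m powr (1/24))"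
      using cmod_sum_dyadic_le[OF t(2) m(3) mX] by (simp only: \<tau>_def rA_def rB_def)
    also have "\<dots> \<le> 2.65 * \<tau> powr (1/30) / rA * real m powr (- 1/6) + 3.21 * \<tau> powr (- 1/30) / rB * real (2 * X) powr (1/24)"
      using r by (intro add_left_mono mult_left_mono divide_nonneg_nonneg mult_nonneg_nonneg) auto
    also have "\<dots> = 2.65 * (\<tau> powr (1/30) * real m powr (- 1/6)) / rA + 3.21 * (\<tau> powr (- 1/30) * real (2 * X) powr (1/24)) / rB"
      by (simp only: times_divide_eq_left mult.assoc)
    also have "\<dots> \<le> 6.9 + 22.5" by (rule add_mono[OF A B])
    finally show ?thesis .
  qed
  ultimately show ?thesis by simp
qed

text \<open>The splitting point \<open>y\<close> and the tail are those of the bound with 1/2. Only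
  the initial sum changes; it costs 38, the tail at most 3, the truncation at most 1/2.\<close>

lemma cmod_zeta_le_fifth_ln:
  fixes t :: real
  assumes t: "ln t \<ge> 140" "t > 0"
  shows "cmod (zeta (1 + \<i> * of_real t)) \<le> 1/5 * ln t + 44.02"
proof -
  define q where "q = 1 / sqrt t"
  define K where "K = nat \<lfloor>17/100 / q\<rfloor>"
  define p where "p = real K * q"
  define a where "a = 1 / (2 * pi * q\<^sup>2)"
  define y where "y = a / (real K + 1/2)"
  have q0: "q > 0" using t by (simp add: q_def)
  have tq: "2 * pi * a = t" using t by (simp add: a_def q_def power_divide)
  have q1: "q \<le> 1/1000"
  proof -
    have "11 ^ 14 \<le> exp (10::real) ^ 14" using exp_ge_add_one_self[of "10::real"] by (intro power_mono) auto
    also have "\<dots> = exp 140" by (simp add: exp_of_nat_mult[symmetric])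
    also have "\<dots> \<le> exp (ln t)" using t(1) by (simp only: exp_le_cancel_iff)
    finally have "t \<ge> 1000\<^sup>2" using t by simp
    then have "sqrt t \<ge> 1000" by (rule real_le_rsqrt)
    then show ?thesis unfolding q_def using t by (intro divide_left_mono) auto
  qed
  have "17/100 / q > 2" using q1 q0 by (simp add: field_simps)
  then have "\<lfloor>17/100 / q\<rfloor> \<ge> 2" by (simp add: le_floor_iff)
  then have "nat \<lfloor>17/100 / q\<rfloor> \<ge> 2" "real (nat \<lfloor>17/100 / q\<rfloor>) = of_int \<lfloor>17/100 / q\<rfloor>" by linarith+
  then have K: "K \<ge> 2" "real K = of_int \<lfloor>17/100 / q\<rfloor>" by (simp_all only: K_def)
  have "real K \<le> 17/100 / q" "17/100 / q < real K + 1" unfolding K(2) by linarith+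
  then have p: "p \<le> 17/100" "17/100 < p + q" using q0 by (simp_all add: p_def field_simps)
  have p0: "p \<ge> 0" using q0 by (simp add: p_def)
  define w where "w = 2 * pi * (p + q/2)"
  have w: "1 \<le> w" "w \<le> 2"
  proof -
    have "2 * 3.1415 * (16/100) \<le> w" unfolding w_def using p q1 pi_bounds by (intro mult_mono) auto
    then show "1 \<le> w" by simp
    have "w \<le> 2 * 3.1416 * (18/100)" unfolding w_def using p q1 pi_bounds p0 q0 by (intro mult_mono) auto
    then show "w \<le> 2" by simp
  qed
  have y: "y = sqrt t / w"
  proof -
    have "2 * pi * q\<^sup>2 * (real K + 1/2) = q * w"
      by (simp add: w_def p_def algebra_simps power2_eq_square)
    then have "y = 1 / (q * w)" by (simp add: y_def a_def)
    then show ?thesis by (simp add: q_def)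
  qed
  have st: "sqrt t \<ge> 1000" using q1 t by (simp add: q_def field_simps)
  have yb: "sqrt t / 2 \<le> y" "y \<le> sqrt t"
  proof -
    show "sqrt t / 2 \<le> y" unfolding y using w t by (intro divide_left_mono) auto
    have "sqrt t / w \<le> sqrt t / 1" using w t by (intro divide_left_mono) auto
    then show "y \<le> sqrt t" unfolding y by simp
  qed
  have "cmod (\<Sum>n=1..<nceil y. of_nat n powr (- (1 + \<i> * complex_of_real t))) \<le> 1/5 * ln t + 38"
    using yb st le_real_nceil[of y] real_nceil_less[of y] by (intro cmod_sum_powr_le_fifth_ln t) auto
  moreover have "cmod (zeta (1 + \<i> * of_real t)) \<le> cmod (\<Sum>n=1..<nceil y. of_nat n powr (- (1 + \<i> * complex_of_real t)))
      + cmod (line_sum t y (a / (1/5))) + 1 / (2 * (a / (1/5))) + 1 / t + (t\<^sup>2 + 5/2) / (24 * (a / (1/5))\<^sup>2)"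
  proof (rule cmod_zeta_le_line_sum[OF t(2)])
    show "1 \<le> y" using yb st by simp
    show "y \<le> a / (1/5)" unfolding y_def using q0 by (intro divide_left_mono) (auto simp: a_def)
  qed
  moreover have "1 / (2 * (a / (1/5))) + 1 / t + (t\<^sup>2 + 5/2) / (24 * (a / (1/5))\<^sup>2) \<le> 1/2"
  proof -
    have "1 / (2 * (a / (1/5))) + 1 / t + (t\<^sup>2 + 5/2) / (24 * (a / (1/5))\<^sup>2)
      \<le> (pi / 5 + 1) * q\<^sup>2 + pi\<^sup>2 / 150 * (1 + 5/2 * q ^ 4)"
      using euler_maclaurin_error_poly[OF q0] unfolding a_def[symmetric] tq .
    also have "\<dots> \<le> (4 / 5 + 1) * (1/1000)\<^sup>2 + 9.87 / 150 * (1 + 5/2 * (1/1000) ^ 4)"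
      using q0 q1 pi_bounds by (intro add_mono mult_mono divide_right_mono power_mono) auto
    also have "\<dots> \<le> 1/2" by (simp add: eval_nat_numeral)
    finally show ?thesis .
  qed
  moreover have "cmod (line_sum t y (a / (1/5))) \<le> 3"
  proof -
    have "cmod (line_sum t y (a / (1/5))) \<le> 5/4 * q + 5/8 * q / real K + 4 * p * q + 2 * q\<^sup>2 + 16/5 * p + 29/10 * p * q\<^sup>2
      + pi * (1 + 8/5 * q) * (p\<^sup>2 + p * q) + (1 - 8/5 * q) * (5/4) * (5/2 * p - 2 * q)
      + (1 - 8/5 * q) * (5/4 * q + 10 * q\<^sup>2)"
      using cmod_line_sum_tail_poly[of q K] q0 q1 K(1) p(1)
      unfolding a_def[symmetric] y_def[symmetric] tq p_def[symmetric] by simp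
    moreover have "5/8 * q / real K \<le> 5/8 * q / 1" using K(1) q0 by (intro divide_left_mono) auto
    moreover have "4 * p * q \<le> 4 * (17/100) * (1/1000)" using p p0 q0 q1 by (intro mult_mono) auto
    moreover have q2: "q\<^sup>2 \<le> (1/1000)\<^sup>2" using q0 q1 by (intro power_mono) auto
    moreover have "29/10 * p * q\<^sup>2 \<le> 29/10 * (17/100) * (1/1000)\<^sup>2"
      using p p0 q2 by (intro mult_mono) auto
    moreover have "pi * (1 + 8/5 * q) * (p\<^sup>2 + p * q) \<le> 3.1416 * (1 + 8/5 * (1/1000)) * ((17/100)\<^sup>2 + 17/100 * (1/1000))"
      using p p0 q0 q1 pi_bounds by (intro mult_mono add_mono power_mono) auto
    moreover have "(1 - 8/5 * q) * (5/4) * (5/2 * p - 2 * q) \<le> 1 * (5/4) * (5/2 * (17/100))"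
      using p p0 q0 q1 by (intro mult_mono) auto
    moreover have "(1 - 8/5 * q) * (5/4 * q + 10 * q\<^sup>2) \<le> 1 * (5/4 * (1/1000) + 10 * (1/1000)\<^sup>2)"
      using q0 q1 q2 by (intro mult_mono add_mono mult_left_mono) auto
    ultimately show ?thesis using p(1) q1 by (simp add: power2_eq_square)
  qed
  moreover have "z \<le> x + 44.02"
    if "A \<le> x + 38" "z \<le> A + L + e1 + e2 + e3" "e1 + e2 + e3 \<le> 1/2" "L \<le> 3" for z x A L e1 e2 e3 :: real
    using that by simp
  ultimately show ?thesis by blast
qed

theorem theorem1p1:
  shows "(\<forall>t::real. t \<ge> 3 \<longrightarrow>
            cmod (zeta (1 + \<i> * of_real t))
              \<le> Min {ln t, 1/2 * ln t + 1.93, 1/5 * ln t + 44.02}) \<and>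
         (\<forall>t::real. t \<ge> 8.261 * 10 ^ 60 \<longrightarrow>
            cmod (zeta (1 + \<i> * of_real t)) \<le> 1/5 * ln t + 44.02)"
proof -
  have ln20: "ln (20::real) \<le> 3" "ln (50::real) \<le> 3.9125" "ln (50::real) \<ge> 3.9"
  proof -
    have "ln (20::real) = 2 * ln 2 + ln 5" "ln (50::real) = ln 2 + 2 * ln 5"
      using ln_mult[of 4 "5::real"] ln_mult[of 2 "25::real"] ln_realpow[of 2 2] ln_realpow[of 5 2] by simp_all
    then show "ln (20::real) \<le> 3" "ln (50::real) \<le> 3.9125" "ln (50::real) \<ge> 3.9"
      using ln_numeral_bounds by simp_all
  qed
  \<comment> \<open>At t = 50, 1/2 ln t already exceeds 1.93, so there the second bound implies the
    first. Below, the first implies the second: directly up to 20, and up to 50 through the gain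
    0.1115.\<close>
  have half: "cmod (zeta (1 + \<i> * of_real t)) \<le> ln t \<and> cmod (zeta (1 + \<i> * of_real t)) \<le> 1/2 * ln t + 1.93"
    if t: "t \<ge> 3" for t :: real
  proof (cases "t \<ge> 50")
    case True
    then have "ln 50 \<le> ln t" by simp
    then show ?thesis using cmod_zeta_le_half_ln[OF True] ln20(3) by simp
  next
    case False
    have le_ln: "cmod (zeta (1 + \<i> * of_real t)) \<le> ln t"
    proof -
      consider "t \<le> 5" | "5 \<le> t" "t \<le> 9" | "9 \<le> t" by linarith
      then show ?thesis
      proof cases
        case 3
        then have "1 / t \<le> 1 / 9" by (intro divide_left_mono) auto
        then show ?thesis using cmod_zeta_le_ln_ge_9[OF 3] by simp
      qed (use t cmod_zeta_le_ln_3_5 cmod_zeta_le_ln_5_9 in auto)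
    qed
    have "cmod (zeta (1 + \<i> * of_real t)) \<le> 1/2 * ln t + 1.93"
    proof (cases "t \<le> 20")
      case True
      then have "ln t \<le> ln 20" using t by simp
      then show ?thesis using le_ln ln20(1) by simp
    next
      case False
      then have "1 / t \<le> 1 / 20" by (intro divide_left_mono) auto
      moreover have "cmod (zeta (1 + \<i> * of_real t)) \<le> ln t - 0.1115 + 1 / t"
        using False by (intro cmod_zeta_le_ln_ge_9) simp
      moreover have "ln t \<le> ln 50" using \<open>\<not> t \<ge> 50\<close> t by simp
      ultimately show ?thesis using ln20(2) by simp
    qed
    with le_ln show ?thesis by blast
  qed
  \<comment> \<open>Below ln t = 140 the bound with 1/2 suffices, since 3/10 * 140 = 42 <= 44.02 -
    1.93.\<close>
  have fifth: "cmod (zeta (1 + \<i> * of_real t)) \<le> 1/5 * ln t + 44.02" if t: "t \<ge> 3" for t :: real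
  proof (cases "ln t \<ge> 140")
    case True
    then show ?thesis using t by (intro cmod_zeta_le_fifth_ln) auto
  next
    case False
    then show ?thesis using half[OF t] by simp
  qed
  show ?thesis
  proof (intro conjI allI impI)
    fix t :: real assume "t \<ge> 3"
    then show "cmod (zeta (1 + \<i> * of_real t)) \<le> Min {ln t, 1/2 * ln t + 1.93, 1/5 * ln t + 44.02}"
      using half[of t] fifth[of t] by simp
  next
    fix t :: real assume "t \<ge> 8.261 * 10 ^ 60"
    then have "t \<ge> 3" by simp
    then show "cmod (zeta (1 + \<i> * of_real t)) \<le> 1/5 * ln t + 44.02" by (rule fifth)
  qed
qed

end
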